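(* Let $\Omega \subset \mathbb{R}^2$ be non-empty, open and simply connected. If $\lambda(\Omega) > 0$, then $$\|w_{\Omega}\|_{\infty}\,\lambda(\Omega) > 1+\frac{3^5(67-44\sqrt 2)}{2^{34}\cdot 5\cdot 7\, j_0}\,\mathfrak{c}_1,$$ where $j_0$ is the first positive zero of the Bessel function $J_0$, and $$\mathfrak{c}_1=\max_{c\ge\frac92\log 2}\frac{(1-2^{9/2}e^{-c})^7}{c^9}.$$
   Context: For a non-empty open set $\Omega\subset\mathbb{R}^2$, $\lambda(\Omega)$ denotes the bottom of the spectrum of the Dirichlet Laplacian acting in $L^2(\Omega)$: $$\lambda(\Omega)=\inf\Big\{\frac{\int_\Omega|\nabla u|^2}{\int_\Omega u^2}: u\in H^1_0(\Omega),\ u\not\equiv 0\Big\}.$$ Let $B_r$ be the open ball of radius $r$ centred at the origin. The torsion function $w_\Omega:\Omega\to[0,+\infty]$ is defined for a.e. $x$ by $w_\Omega(x)=\lim_{r\to+\infty}w_{\Omega\cap B_r}(x)$, where $w_{\Omega\cap B_r}$ is the unique solution of $-\Delta w=1$, $w\in H^1_0(\Omega\cap B_r)$. (The set $\Omega$ may have infinite measure; if it has finite measure, $w_\Omega$ is the classical torsion function, i.e. the unique weak solution in $H^1_0(\Omega)$ of $-\Delta w=1$.) $\|\cdot\|_\infty$ is the $L^\infty(\Omega)$ norm. *)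

theory Defs
  imports "HOL-Analysis.Analysis" "HOL-Probability.Essential_Supremum"
begin

section \<open>Test functions\<close>

primrec is_Ck :: "nat \<Rightarrow> ('a::euclidean_space \<Rightarrow> real) \<Rightarrow> bool" where
  "is_Ck 0 f \<longleftrightarrow> continuous_on UNIV f"
| "is_Ck (Suc k) f \<longleftrightarrow>
     (\<forall>x. f differentiable (at x)) \<and>
     (\<forall>b\<in>Basis. is_Ck k (\<lambda>x. frechet_derivative f (at x) b))"

definition is_smooth :: "('a::euclidean_space \<Rightarrow> real) \<Rightarrow> bool" where
  "is_smooth f \<longleftrightarrow> (\<forall>k. is_Ck k f)"

definition gradient :: "('a::euclidean_space \<Rightarrow> real) \<Rightarrow> 'a \<Rightarrow> 'a" where
  "gradient f x = (THE D. GDERIV f x :> D)"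

definition test_functions :: "'a::euclidean_space set \<Rightarrow> ('a \<Rightarrow> real) set" where
  "test_functions \<Omega> =
     {\<phi>. is_smooth \<phi> \<and> compact (closure {x. \<phi> x \<noteq> 0}) \<and> closure {x. \<phi> x \<noteq> 0} \<subseteq> \<Omega>}"

section \<open>Sobolev spaces\<close>

text \<open>Elements of \<open>L\<^sup>2(\<Omega>)\<close>, \<open>H\<^sup>1(\<Omega>)\<close> and \<open>H\<^sup>1\<^sub>0(\<Omega>)\<close> are represented by functions on the whole
  space, not by equivalence classes. Their values outside \<open>\<Omega>\<close> are irrelevant, and so are their
  values on null sets.\<close>

definition square_integrable_on ::
    "('a::euclidean_space \<Rightarrow> 'b::euclidean_space) \<Rightarrow> 'a set \<Rightarrow> bool"
    (infixr \<open>square'_integrable'_on\<close> 46) where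
  "f square_integrable_on \<Omega> \<longleftrightarrow>
     f \<in> borel_measurable (lebesgue_on \<Omega>) \<and> integrable (lebesgue_on \<Omega>) (\<lambda>x. (norm (f x))\<^sup>2)"

definition is_weak_gradient ::
    "'a::euclidean_space set \<Rightarrow> ('a \<Rightarrow> real) \<Rightarrow> ('a \<Rightarrow> 'a) \<Rightarrow> bool" where
  "is_weak_gradient \<Omega> u g \<longleftrightarrow>
     (\<forall>\<phi>\<in>test_functions \<Omega>.
        (LINT x|lebesgue_on \<Omega>. u x *\<^sub>R gradient \<phi> x) = - (LINT x|lebesgue_on \<Omega>. \<phi> x *\<^sub>R g x))"

definition H1 :: "'a::euclidean_space set \<Rightarrow> ('a \<Rightarrow> real) set" where
  "H1 \<Omega> = {u. u square_integrable_on \<Omega> \<and>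
              (\<exists>g. g square_integrable_on \<Omega> \<and> is_weak_gradient \<Omega> u g)}"

text \<open>On an open set the weak gradient of a function in \<open>H\<^sup>1\<close> is unique up to null sets.\<close>

definition weak_gradient :: "'a::euclidean_space set \<Rightarrow> ('a \<Rightarrow> real) \<Rightarrow> 'a \<Rightarrow> 'a" where
  "weak_gradient \<Omega> u = (SOME g. g square_integrable_on \<Omega> \<and> is_weak_gradient \<Omega> u g)"

definition H1_norm :: "'a::euclidean_space set \<Rightarrow> ('a \<Rightarrow> real) \<Rightarrow> real" where
  "H1_norm \<Omega> u =
     sqrt ((LINT x|lebesgue_on \<Omega>. (u x)\<^sup>2) + (LINT x|lebesgue_on \<Omega>. (norm (weak_gradient \<Omega> u x))\<^sup>2))"

text \<open>The closure of the test functions in \<open>H\<^sup>1(\<Omega>)\<close>.\<close>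

definition H10 :: "'a::euclidean_space set \<Rightarrow> ('a \<Rightarrow> real) set" where
  "H10 \<Omega> = {u \<in> H1 \<Omega>. \<forall>\<epsilon>>0. \<exists>\<phi>\<in>test_functions \<Omega>. H1_norm \<Omega> (\<lambda>x. u x - \<phi> x) < \<epsilon>}"

section \<open>Bottom of the Dirichlet spectrum and torsion function\<close>

definition dirichlet_bottom :: "'a::euclidean_space set \<Rightarrow> real" where
  "dirichlet_bottom \<Omega> =
     (INF u\<in>{u \<in> H10 \<Omega>. \<not> (AE x in lebesgue_on \<Omega>. u x = 0)}.
        (LINT x|lebesgue_on \<Omega>. (norm (weak_gradient \<Omega> u x))\<^sup>2) / (LINT x|lebesgue_on \<Omega>. (u x)\<^sup>2))"

text \<open>Weak solutions of \<open>- \<Delta> w = 1\<close> with \<open>w \<in> H\<^sup>1\<^sub>0(D)\<close>.\<close>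

definition solves_torsion :: "'a::euclidean_space set \<Rightarrow> ('a \<Rightarrow> real) \<Rightarrow> bool" where
  "solves_torsion D w \<longleftrightarrow> w \<in> H10 D \<and>
     (\<forall>\<phi>\<in>test_functions D.
        (LINT x|lebesgue_on D. weak_gradient D w x \<bullet> gradient \<phi> x) = (LINT x|lebesgue_on D. \<phi> x))"

definition torsion_bounded :: "'a::euclidean_space set \<Rightarrow> 'a \<Rightarrow> real" where
  "torsion_bounded D = (SOME w. solves_torsion D w)"

text \<open>The almost everywhere limit of \<open>w\<^bsub>\<Omega> \<inter> B\<^sub>r\<^esub>\<close> as \<open>r \<rightarrow> \<infinity>\<close> is expressed through all sequences of
  radii tending to infinity: each \<open>w\<^bsub>\<Omega> \<inter> B\<^sub>r\<^esub>\<close> is determined only up to a null set depending on \<open>r\<close>, so a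
  pointwise limit along uncountably many radii would depend on the choice of representatives.
  The values of \<open>w\<^bsub>\<Omega> \<inter> B\<^sub>r\<^esub>\<close> outside \<open>\<Omega> \<inter> B\<^sub>r\<close> do not influence the limit, and the truncation
  of negative reals by \<open>ennreal\<close> concerns null sets only, as \<open>w\<^bsub>\<Omega> \<inter> B\<^sub>r\<^esub> \<ge> 0\<close> almost everywhere.\<close>

definition is_torsion_function :: "'a::euclidean_space set \<Rightarrow> ('a \<Rightarrow> ennreal) \<Rightarrow> bool" where
  "is_torsion_function \<Omega> w \<longleftrightarrow> w \<in> borel_measurable (lebesgue_on \<Omega>) \<and>
     (\<forall>r :: nat \<Rightarrow> real. filterlim r at_top sequentially \<longrightarrow>
        (AE x in lebesgue_on \<Omega>.
           (\<lambda>n. ennreal (torsion_bounded (\<Omega> \<inter> ball 0 (r n)) x)) \<longlonglongrightarrow> w x))"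

definition torsion_function :: "'a::euclidean_space set \<Rightarrow> 'a \<Rightarrow> ennreal" where
  "torsion_function \<Omega> = (SOME w. is_torsion_function \<Omega> w)"

text \<open>The functions considered are nonnegative, hence no absolute value.\<close>

definition Linf_norm :: "'a::euclidean_space set \<Rightarrow> ('a \<Rightarrow> ennreal) \<Rightarrow> ennreal" where
  "Linf_norm \<Omega> w = esssup (lebesgue_on \<Omega>) w"

section \<open>Constants\<close>

definition bessel_J0 :: "real \<Rightarrow> real" where
  "bessel_J0 x = (\<Sum>m. (-1) ^ m / (fact m)\<^sup>2 * (x / 2) ^ (2 * m))"

definition j0 :: real where
  "j0 = (LEAST x. 0 < x \<and> bessel_J0 x = 0)"

definition c1 :: real where
  "c1 = (GREATEST y. \<exists>c \<ge> 9 / 2 * ln 2. y = (1 - 2 powr (9 / 2) * exp (- c)) ^ 7 / c ^ 9)"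

end

theory Submission
  imports Defs "HOL-Complex_Analysis.Riemann_Mapping"
begin

text \<open>Let \<open>M\<close> be the supremum of the torsion function, and let \<open>F\<close> be a smooth function with values in
  \<open>(0, M]\<close> that solves \<open>- \<Delta> F = 1\<close> approximately. For a test function \<open>u = F v\<close>, testing the equation
  with \<open>u\<^sup>2 / F\<close> gives
  \<open>\<integral> |\<nabla>u|\<^sup>2 - (1/M) \<integral> u\<^sup>2 = \<integral> F\<^sup>2 |\<nabla>v|\<^sup>2 + \<integral> F v\<^sup>2 (1 - F/M)\<close>, which is nonnegative; this is the bound
  \<open>\<lambda> M \<ge> 1\<close>. If the excess is small, then so is the total variation of \<open>p = u\<^sup>2 (3 - 2F/M)\<close>, because
  \<open>\<nabla>p = 2 u (3 - 2F/M) (F \<nabla>v) + 6 u (1 - F/M) (v \<nabla>F)\<close>, and each summand contains a factor that the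
  excess controls. But \<open>p \<ge> u\<^sup>2\<close> vanishes off \<open>\<Omega>\<close>, and a simply connected planar set of
  inradius at most \<open>\<rho>\<close> satisfies the Cheeger inequality \<open>\<integral> |p| \<le> C \<rho> \<integral> |\<nabla>p|\<close>; moreover
  \<open>\<rho>\<^sup>2 \<le> C' M\<close>. Hence the excess is bounded below, and
  \<open>\<lambda> M \<ge> 1 + 10\<^sup>-\<^sup>8\<close>, far above the constant of the theorem.

  The smooth functions \<open>F\<close> are the members of minimising sequences of the torsion energy, truncated at \<open>M\<close>
  and shifted by a small constant, so that no regularity theory is needed.\<close>

section \<open>Smooth functions\<close>

text \<open>The obstacle is that the excess gives no control of \<open>v \<nabla>F\<close>: its two
  terms bound \<open>F \<nabla>v\<close> and \<open>u (1 - F/M)\<close> in \<open>L^2\<close>,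
  nothing else. So \<open>p = v^2 g(F)\<close> needs a \<open>g\<close> whose derivative carries the
  factor \<open>1 - F/M\<close>. The choice \<open>g(t) = 3 t^2 - 2 t^3 / M\<close>, with
  \<open>g'(t) = 6 t (1 - t/M)\<close>, gives the stated \<open>p\<close>. The remaining factor
  \<open>v \<nabla>F = \<nabla>u - F \<nabla>v\<close> is merely bounded, so the products are split
  by a weighted AM-GM inequality with a parameter \<open>\<tau>\<close>, taken as
  \<open>10^-4\<close>. With \<open>C = 32\<close> and \<open>\<rho> = (23/4) sqrt M\<close>, a
  smaller excess would give \<open>\<integral> u^2 \<le> 0.368 \<integral> u^2\<close>. A test
  function has compact support, so the estimate takes place in a bounded piece
  \<open>\<Omega> \<inter> B_m\<close>; the torsion function of \<open>\<Omega>\<close> enters only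
  through its supremum, which dominates the torsion functions of all these pieces. Positivity,
  truncation and comparison of the latter rest on one principle: test functions modified at a
  vanishing cost in torsion energy still converge to the solution.\<close>

lemma GDERIV_unique:
  assumes "GDERIV f x :> D" "GDERIV f x :> D'"
  shows "D = D'"
proof -
  have "(\<lambda>h. h \<bullet> D) = (\<lambda>h. h \<bullet> D')"
    using assms has_derivative_unique unfolding gderiv_def by blast
  then show ?thesis
    by (metis vector_eq_ldot)
qed

lemma gradient_eqI: "GDERIV f x :> D \<Longrightarrow> gradient f x = D"
  unfolding gradient_def by (rule the_equality) (auto intro: GDERIV_unique)

lemma GDERIV_gradient:
  fixes f :: "'a::euclidean_space \<Rightarrow> real"
  assumes "f differentiable (at x)"
  shows "GDERIV f x :> gradient f x"
proof -
  let ?f' = "frechet_derivative f (at x)"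
  have der: "(f has_derivative ?f') (at x)"
    using assms frechet_derivative_works by blast
  have "?f' h = h \<bullet> (\<Sum>b\<in>Basis. ?f' b *\<^sub>R b)" for h
  proof -
    have "linear ?f'"
      using der has_derivative_linear by blast
    then have "?f' (\<Sum>b\<in>Basis. (h \<bullet> b) *\<^sub>R b) = (\<Sum>b\<in>Basis. (h \<bullet> b) * ?f' b)"
      by (simp add: linear_sum linear_cmul)
    then show ?thesis
      by (simp add: euclidean_representation inner_sum_right mult.commute)
  qed
  then have "?f' = (\<lambda>h. h \<bullet> (\<Sum>b\<in>Basis. ?f' b *\<^sub>R b))"
    by blast
  then have "GDERIV f x :> (\<Sum>b\<in>Basis. ?f' b *\<^sub>R b)"
    using der unfolding gderiv_def by metis
  then show ?thesis
    using gradient_eqI by fastforce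
qed

lemma GDERIV_imp_differentiable: "GDERIV f x :> D \<Longrightarrow> f differentiable (at x)"
  unfolding gderiv_def differentiable_def by blast

lemma frechet_derivative_gradient:
  assumes "f differentiable (at x)"
  shows "frechet_derivative f (at x) h = gradient f x \<bullet> h"
  using frechet_derivative_at[OF GDERIV_gradient[OF assms, unfolded gderiv_def]]
  by (metis inner_commute)

text \<open>Rewriting the recursion through \<open>gradient\<close> lets the calculus rules for
  \<open>GDERIV\<close> drive every closure proof; the defining equation, which speaks of
  \<open>frechet_derivative\<close>, is taken out of the simplifier afterwards.\<close>

lemma is_Ck_Suc_iff:
  "is_Ck (Suc k) f \<longleftrightarrow>
     (\<forall>x. f differentiable (at x)) \<and> (\<forall>b\<in>Basis. is_Ck k (\<lambda>x. gradient f x \<bullet> b))"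
  by (auto simp: frechet_derivative_gradient)

declare is_Ck.simps(2) [simp del]

lemma is_Ck_SucI:
  assumes "\<And>x. GDERIV f x :> D x" "\<And>b. b \<in> Basis \<Longrightarrow> is_Ck k (\<lambda>x. D x \<bullet> b)"
  shows "is_Ck (Suc k) f"
proof -
  have "gradient f = D"
    using assms(1) gradient_eqI by blast
  then show ?thesis
    using assms GDERIV_imp_differentiable unfolding is_Ck_Suc_iff by blast
qed

lemma is_Ck_SucD:
  assumes "is_Ck (Suc k) f"
  shows "GDERIV f x :> gradient f x" "b \<in> Basis \<Longrightarrow> is_Ck k (\<lambda>x. gradient f x \<bullet> b)"
  using assms GDERIV_gradient unfolding is_Ck_Suc_iff by blast+

lemma is_Ck_Suc_imp: "is_Ck (Suc k) f \<Longrightarrow> is_Ck k f"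
proof (induction k arbitrary: f)
  case 0
  then show ?case
    by (auto simp: is_Ck_Suc_iff differentiable_imp_continuous_within continuous_on_eq_continuous_within)
next
  case (Suc k)
  then show ?case
    by (auto simp: is_Ck_Suc_iff[of _ f])
qed

lemma is_Ck_add: "is_Ck k f \<Longrightarrow> is_Ck k g \<Longrightarrow> is_Ck k (\<lambda>x. f x + g x)"
proof (induction k arbitrary: f g)
  case 0
  then show ?case by (auto intro: continuous_intros)
next
  case (Suc k)
  note d = is_Ck_SucD[OF Suc.prems(1)] is_Ck_SucD[OF Suc.prems(2)]
  show ?case
    by (rule is_Ck_SucI[OF GDERIV_add[OF d(1,3)]]) (simp add: inner_add_left Suc.IH d)
qed

lemma is_Ck_const: "is_Ck k (\<lambda>x. c)"
proof (induction k arbitrary: c)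
  case (Suc k)
  show ?case
    by (rule is_Ck_SucI[OF GDERIV_const]) (simp add: Suc.IH)
qed auto

text \<open>The product rule leaves one factor undifferentiated in each summand, so besides the
  induction hypothesis the step uses that \<open>is_Ck (Suc k)\<close> implies
  \<open>is_Ck k\<close>.\<close>

lemma is_Ck_mult: "is_Ck k f \<Longrightarrow> is_Ck k g \<Longrightarrow> is_Ck k (\<lambda>x. f x * g x)"
proof (induction k arbitrary: f g)
  case 0
  then show ?case by (auto intro: continuous_intros)
next
  case (Suc k)
  note d = is_Ck_SucD[OF Suc.prems(1)] is_Ck_SucD[OF Suc.prems(2)]
  note e = is_Ck_Suc_imp[OF Suc.prems(1)] is_Ck_Suc_imp[OF Suc.prems(2)]
  show ?case
    by (rule is_Ck_SucI[OF GDERIV_mult[OF d(1,3)]])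
      (simp add: inner_add_left Suc.IH d e is_Ck_add)
qed

lemma is_Ck_inner: "is_Ck k (\<lambda>x. x \<bullet> c)"
proof (cases k)
  case 0
  then show ?thesis by (auto intro: continuous_intros)
next
  case (Suc j)
  have "GDERIV (\<lambda>x. x \<bullet> c) x :> c" for x
    unfolding gderiv_def by (intro derivative_eq_intros) auto
  then show ?thesis
    unfolding Suc by (rule is_Ck_SucI) (rule is_Ck_const)
qed

lemma is_Ck_inverse:
  "is_Ck k f \<Longrightarrow> (\<And>x. f x \<noteq> 0) \<Longrightarrow> is_Ck k (\<lambda>x. inverse (f x))"
proof (induction k arbitrary: f)
  case 0
  then show ?case by (auto intro: continuous_intros)
next
  case (Suc k)
  note d = is_Ck_SucD[OF Suc.prems(1)]
  note e = is_Ck_Suc_imp[OF Suc.prems(1)]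
  have c: "is_Ck k (\<lambda>x. inverse (f x))"
    using Suc.IH Suc.prems e by blast
  have "is_Ck k (\<lambda>x. (- 1) * (inverse (f x) * inverse (f x) * (gradient f x \<bullet> b)))" if "b \<in> Basis" for b
    using that by (intro is_Ck_mult c d is_Ck_const)
  then show ?case
    by (intro is_Ck_SucI[OF GDERIV_inverse[OF d(1) Suc.prems(2)]]) (simp add: power2_eq_square)
qed

section \<open>Flat functions and a smooth positive part\<close>

definition flat :: "real \<Rightarrow> nat \<Rightarrow> real \<Rightarrow> real" where
  "flat a m t = (if 0 < t then (1 / t) ^ m * exp (- a / t) else 0)"

lemma flat_tendsto_0:
  assumes "a > 0"
  shows "(flat a m \<longlongrightarrow> 0) (at 0)"
proof -
  have "((\<lambda>s. (a * s) ^ m / exp (a * s)) \<longlongrightarrow> 0) at_top"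
    by (rule filterlim_compose[OF tendsto_power_div_exp_0 filterlim_tendsto_pos_mult_at_top])
      (use assms in \<open>auto intro: filterlim_ident\<close>)
  then have "((\<lambda>t. (a * inverse t) ^ m / exp (a * inverse t)) \<longlongrightarrow> 0) (at_right 0)"
    by (rule filterlim_compose) (rule filterlim_inverse_at_top_right)
  then have "((\<lambda>t. (1 / a ^ m) * ((a * inverse t) ^ m / exp (a * inverse t))) \<longlongrightarrow> (1 / a ^ m) * 0) (at_right 0)"
    by (intro tendsto_intros)
  moreover have "\<forall>\<^sub>F t in at_right 0. (1 / a ^ m) * ((a * inverse t) ^ m / exp (a * inverse t)) = flat a m t"
    unfolding eventually_at_filter
    by (rule always_eventually)
      (use assms in \<open>auto simp: flat_def exp_minus field_simps power_mult_distrib\<close>)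
  ultimately have R: "(flat a m \<longlongrightarrow> 0) (at_right 0)"
    using tendsto_cong by fastforce
  have "\<forall>\<^sub>F t in at_left 0. 0 = flat a m t"
    unfolding eventually_at_filter by (rule always_eventually) (auto simp: flat_def)
  then have L: "(flat a m \<longlongrightarrow> 0) (at_left 0)"
    using tendsto_eventually by (metis (mono_tags, lifting) eventually_mono)
  show ?thesis
    using R L filterlim_split_at_real by blast
qed

text \<open>Differentiation stays inside the family \<open>flat a m\<close>, with growing
  \<open>m\<close>. This is why \<open>flat\<close> carries the power of \<open>1 / t\<close>:
  smoothness of \<open>exp (- a / t)\<close>, extended by \<open>0\<close>, follows by one induction
  for all \<open>m\<close> at once.\<close>

lemma DERIV_flat:
  assumes "a > 0"
  shows "DERIV (flat a m) t :> a * flat a (m + 2) t - m * flat a (m + 1) t"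
proof -
  consider "t > 0" | "t < 0" | "t = 0" by linarith
  then show ?thesis
  proof cases
    case 1
    have "DERIV (\<lambda>t. (1 / t) ^ m * exp (- a / t)) t :>
       m * (1 / t) ^ (m - 1) * (- 1 / (t * t)) * exp (- a / t) + exp (- a / t) * (a / (t * t)) * (1 / t) ^ m"
      by (rule derivative_eq_intros refl | use 1 in simp)+
    moreover have "m * (1 / t) ^ (m - 1) * (- 1 / (t * t)) * exp (- a / t) + exp (- a / t) * (a / (t * t)) * (1 / t) ^ m
       = a * flat a (m + 2) t - m * flat a (m + 1) t"
      using 1 by (cases m) (simp_all add: flat_def field_simps)
    moreover have "\<forall>\<^sub>F s in nhds t. flat a m s = (1 / s) ^ m * exp (- a / s)"
      using eventually_nhds_in_open[of "{0<..}" t] 1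
      by (auto elim: eventually_mono simp: flat_def)
    ultimately show ?thesis
      by (subst DERIV_cong_ev[OF refl _ refl]) auto
  next
    case 2
    have "\<forall>\<^sub>F s in nhds t. flat a m s = 0"
      using eventually_nhds_in_open[of "{..<0}" t] 2
      by (auto elim: eventually_mono simp: flat_def)
    then show ?thesis
      by (subst DERIV_cong_ev[OF refl _ refl]) (use 2 in \<open>auto simp: flat_def\<close>)
  next
    case 3
    \<comment> \<open>At \<open>0\<close> the difference quotient of \<open>flat a m\<close> is
      exactly \<open>flat a (m + 1)\<close>, which tends to \<open>0\<close>.\<close>
    have "\<forall>\<^sub>F h in at 0. flat a (m + 1) h = (flat a m (0 + h) - flat a m 0) / h"
      unfolding eventually_at_filter by (rule always_eventually) (auto simp: flat_def)
    then have "DERIV (flat a m) 0 :> 0"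
      unfolding DERIV_def by (rule tendsto_cong[THEN iffD1, OF _ flat_tendsto_0[OF assms, of "m + 1"]])
    then show ?thesis
      by (simp add: 3 flat_def)
  qed
qed

lemma is_Ck_flat:
  assumes "a > 0"
  shows "is_Ck k f \<Longrightarrow> is_Ck k (\<lambda>x. flat a m (f x))"
proof (induction k arbitrary: m)
  case 0
  have "continuous_on UNIV (flat a m)"
    using DERIV_flat[OF assms] DERIV_isCont continuous_at_imp_continuous_on by blast
  then show ?case
    using 0 continuous_on_compose2[of UNIV "flat a m" UNIV f] by auto
next
  case (Suc k)
  note d = is_Ck_SucD[OF Suc.prems]
  note c = Suc.IH[OF is_Ck_Suc_imp[OF Suc.prems]]
  have "is_Ck k (\<lambda>x. (a * flat a (m + 2) (f x) + (- real m) * flat a (m + 1) (f x)) * (gradient f x \<bullet> b))"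
    if "b \<in> Basis" for b
    by (intro is_Ck_mult is_Ck_add is_Ck_const c d that)
  then show ?case
    by (intro is_Ck_SucI[OF GDERIV_DERIV_compose[OF d(1) DERIV_flat[OF assms]]]) simp
qed

lemma is_smooth_add: "is_smooth f \<Longrightarrow> is_smooth g \<Longrightarrow> is_smooth (\<lambda>x. f x + g x)"
  and is_smooth_mult: "is_smooth f \<Longrightarrow> is_smooth g \<Longrightarrow> is_smooth (\<lambda>x. f x * g x)"
  and is_smooth_const: "is_smooth (\<lambda>x. c)"
  and is_smooth_inner: "is_smooth (\<lambda>x. x \<bullet> v)"
  and is_smooth_inverse: "is_smooth f \<Longrightarrow> (\<And>x. f x \<noteq> 0) \<Longrightarrow> is_smooth (\<lambda>x. inverse (f x))"
  and is_smooth_flat: "a > 0 \<Longrightarrow> is_smooth f \<Longrightarrow> is_smooth (\<lambda>x. flat a m (f x))"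
  unfolding is_smooth_def
  by (simp_all add: is_Ck_add is_Ck_mult is_Ck_const is_Ck_inner is_Ck_inverse is_Ck_flat)

lemma is_smooth_minus: "is_smooth f \<Longrightarrow> is_smooth (\<lambda>x. - f x)"
  using is_smooth_mult[OF is_smooth_const[of "-1"]] by simp

lemma is_smooth_diff: "is_smooth f \<Longrightarrow> is_smooth g \<Longrightarrow> is_smooth (\<lambda>x. f x - g x)"
  using is_smooth_add[OF _ is_smooth_minus] by simp

lemma is_smooth_sum: "finite I \<Longrightarrow> (\<And>i. i \<in> I \<Longrightarrow> is_smooth (f i)) \<Longrightarrow> is_smooth (\<lambda>x. \<Sum>i\<in>I. f i x)"
  by (induction I rule: finite_induct) (auto intro: is_smooth_add is_smooth_const)

lemma is_smooth_prod: "finite I \<Longrightarrow> (\<And>i. i \<in> I \<Longrightarrow> is_smooth (f i)) \<Longrightarrow> is_smooth (\<lambda>x. \<Prod>i\<in>I. f i x)"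
  by (induction I rule: finite_induct) (auto intro: is_smooth_mult is_smooth_const)

lemma is_smooth_power2: "is_smooth f \<Longrightarrow> is_smooth (\<lambda>x. (f x)\<^sup>2)"
  unfolding power2_eq_square by (rule is_smooth_mult)

lemma is_smooth_GDERIV: "is_smooth f \<Longrightarrow> GDERIV f x :> gradient f x"
  unfolding is_smooth_def by (rule is_Ck_SucD(1)[of 0]) simp

lemma is_smooth_gradient_inner: "b \<in> Basis \<Longrightarrow> is_smooth f \<Longrightarrow> is_smooth (\<lambda>x. gradient f x \<bullet> b)"
  unfolding is_smooth_def using is_Ck_SucD(2) by metis

lemma is_smooth_continuous: "is_smooth f \<Longrightarrow> continuous_on S f"
  unfolding is_smooth_def by (metis is_Ck.simps(1) continuous_on_subset top_greatest)

lemma is_smooth_continuous_gradient: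
  assumes "is_smooth f"
  shows "continuous_on S (gradient f)"
proof -
  have "gradient f = (\<lambda>x. \<Sum>b\<in>Basis. (gradient f x \<bullet> b) *\<^sub>R b)"
    by (simp add: euclidean_representation)
  moreover have "continuous_on S (\<lambda>x. \<Sum>b\<in>Basis. (gradient f x \<bullet> b) *\<^sub>R b)"
    using assms by (intro continuous_intros is_smooth_continuous is_smooth_gradient_inner)
  ultimately show ?thesis
    by metis
qed

text \<open>A smooth convex stand-in for the positive part: \<open>t * exp (- a / t)\<close> for
  \<open>t > 0\<close>. It lies below \<open>max t 0\<close> by at most \<open>a\<close>, its slope
  is in \<open>[0, 1]\<close>, and it vanishes for \<open>t \<le> 0\<close>, so that composing with
  it does not enlarge supports.\<close>

definition soft_pos :: "real \<Rightarrow> real \<Rightarrow> real" where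
  "soft_pos a t = t * flat a 0 t"

definition soft_pos' :: "real \<Rightarrow> real \<Rightarrow> real" where
  "soft_pos' a t = flat a 0 t + a * flat a 1 t"

lemma DERIV_soft_pos: "a > 0 \<Longrightarrow> DERIV (soft_pos a) t :> soft_pos' a t"
  unfolding soft_pos_def[abs_def] soft_pos'_def
  by (rule derivative_eq_intros DERIV_flat refl | assumption)+ (auto simp: flat_def power2_eq_square)

lemma DERIV_soft_pos': "a > 0 \<Longrightarrow> DERIV (soft_pos' a) t :> a\<^sup>2 * flat a 3 t"
  unfolding soft_pos'_def[abs_def]
  by (rule derivative_eq_intros DERIV_flat refl | assumption)+
    (simp add: algebra_simps power2_eq_square numeral_2_eq_2 numeral_3_eq_3)

lemma soft_pos'_bounds:
  assumes "a > 0"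
  shows "0 \<le> soft_pos' a t" "soft_pos' a t \<le> 1"
proof -
  show "0 \<le> soft_pos' a t"
    using assms by (auto simp: soft_pos'_def flat_def)
  \<comment> \<open>With \<open>s = a / t\<close> the claim is
    \<open>(1 + s) exp (- s) \<le> 1\<close>.\<close>
  have "(1 + a / t) * exp (- a / t) \<le> exp (a / t) * exp (- a / t)" if "t > 0"
    by (intro mult_right_mono exp_ge_add_one_self) auto
  also have "\<dots> = 1" if "t > 0"
    by (simp flip: exp_add)
  finally show "soft_pos' a t \<le> 1"
    by (auto simp: soft_pos'_def flat_def algebra_simps)
qed

lemma soft_pos_bounds:
  assumes "a > 0"
  shows "0 \<le> soft_pos a t" "soft_pos a t \<le> max t 0" "t - a \<le> soft_pos a t"
proof -
  show "0 \<le> soft_pos a t" "soft_pos a t \<le> max t 0"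
    using assms by (auto simp: soft_pos_def flat_def mult_le_cancel_left1)
  have "t * (1 - a / t) \<le> t * exp (- a / t)" if "t > 0"
    using that exp_ge_add_one_self[of "- a / t"] by (intro mult_left_mono) auto
  then show "t - a \<le> soft_pos a t"
    using assms by (auto simp: soft_pos_def flat_def algebra_simps split: if_splits)
qed

lemma soft_pos_nonpos: "t \<le> 0 \<Longrightarrow> soft_pos a t = 0"
  by (simp add: soft_pos_def flat_def)

lemma is_smooth_soft_pos: "a > 0 \<Longrightarrow> is_smooth f \<Longrightarrow> is_smooth (\<lambda>x. soft_pos a (f x))"
  unfolding soft_pos_def by (intro is_smooth_mult is_smooth_flat)

lemma gradient_soft_pos:
  assumes "a > 0" "is_smooth f"
  shows "gradient (\<lambda>x. soft_pos a (f x)) x = soft_pos' a (f x) *\<^sub>R gradient f x"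
  by (intro gradient_eqI GDERIV_DERIV_compose[OF is_smooth_GDERIV DERIV_soft_pos] assms)

section \<open>Square integrable functions\<close>

text \<open>For an arbitrary measure, in contrast to \<open>square_integrable_on\<close>, because
  the arguments move between \<open>lebesgue_on\<close> of various sets and
  \<open>lborel\<close>.\<close>

definition square_integrable :: "'a measure \<Rightarrow> ('a \<Rightarrow> 'b::euclidean_space) \<Rightarrow> bool" where
  "square_integrable M f \<longleftrightarrow> f \<in> borel_measurable M \<and> integrable M (\<lambda>x. (norm (f x))\<^sup>2)"

definition L2_seminorm :: "'a measure \<Rightarrow> ('a \<Rightarrow> 'b::euclidean_space) \<Rightarrow> real" where
  "L2_seminorm M f = sqrt (LINT x|M. (norm (f x))\<^sup>2)"

lemma square_integrable_on_iff: "f square_integrable_on \<Omega> \<longleftrightarrow> square_integrable (lebesgue_on \<Omega>) f"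
  by (simp add: square_integrable_on_def square_integrable_def)

lemma L2_seminorm_nonneg: "0 \<le> L2_seminorm M f"
  by (simp add: L2_seminorm_def)

lemma L2_seminorm_power2: "(L2_seminorm M f)\<^sup>2 = (LINT x|M. (norm (f x))\<^sup>2)"
  by (simp add: L2_seminorm_def)

lemma square_integrable_scaleR:
  assumes "square_integrable M f"
  shows "square_integrable M (\<lambda>x. c *\<^sub>R f x)"
  using assms by (auto simp: square_integrable_def power_mult_distrib)

lemma norm_add_scaleR_power2:
  "(norm (a + t *\<^sub>R b))\<^sup>2 = (norm a)\<^sup>2 + (2 * t) * (a \<bullet> b) + t\<^sup>2 * (norm b)\<^sup>2"
  for a b :: "'a::real_inner"
  unfolding power2_norm_eq_inner
  by (simp add: inner_add_left inner_add_right inner_commute power2_eq_square algebra_simps)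

lemma square_integrable_inner:
  assumes "square_integrable M f" "square_integrable M g"
  shows "integrable M (\<lambda>x. f x \<bullet> g x)"
proof (rule Bochner_Integration.integrable_bound)
  show "integrable M (\<lambda>x. (norm (f x))\<^sup>2 + (norm (g x))\<^sup>2)"
    using assms by (auto simp: square_integrable_def)
  show "(\<lambda>x. f x \<bullet> g x) \<in> borel_measurable M"
    using assms by (auto simp: square_integrable_def)
  have "norm (a \<bullet> b) \<le> norm ((norm a)\<^sup>2 + (norm b)\<^sup>2)" for a b :: 'b
  proof -
    have "\<bar>a \<bullet> b\<bar> \<le> norm a * norm b"
      by (rule Cauchy_Schwarz_ineq2)
    also have "\<dots> \<le> (norm a)\<^sup>2 + (norm b)\<^sup>2"
      using sum_squares_bound[of "norm a" "norm b"] mult_nonneg_nonneg[of "norm a" "norm b"]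
      by (auto simp: mult.assoc simp del: mult_nonneg_nonneg)
    finally show ?thesis by simp
  qed
  then show "AE x in M. norm (f x \<bullet> g x) \<le> norm ((norm (f x))\<^sup>2 + (norm (g x))\<^sup>2)"
    by simp
qed

lemma square_integrable_add:
  assumes "square_integrable M f" "square_integrable M g"
  shows "square_integrable M (\<lambda>x. f x + g x)"
proof -
  have "integrable M (\<lambda>x. (norm (f x))\<^sup>2 + 2 * (f x \<bullet> g x) + (norm (g x))\<^sup>2)"
    using assms square_integrable_inner[OF assms] by (auto simp: square_integrable_def)
  then have "integrable M (\<lambda>x. (norm (f x + 1 *\<^sub>R g x))\<^sup>2)"
    unfolding norm_add_scaleR_power2 by simp
  then show ?thesis
    using assms by (auto simp: square_integrable_def)
qed

lemma square_integrable_diff: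
  assumes "square_integrable M f" "square_integrable M g"
  shows "square_integrable M (\<lambda>x. f x - g x)"
  using square_integrable_add[OF assms(1) square_integrable_scaleR[OF assms(2), of "-1"]] by simp

lemma integral_norm_add_power2:
  assumes "square_integrable M f" "square_integrable M g"
  shows "(LINT x|M. (norm (f x + t *\<^sub>R g x))\<^sup>2) =
    (LINT x|M. (norm (f x))\<^sup>2) + 2 * t * (LINT x|M. f x \<bullet> g x) + t\<^sup>2 * (LINT x|M. (norm (g x))\<^sup>2)"
  using assms square_integrable_inner[OF assms]
  by (simp add: square_integrable_def norm_add_scaleR_power2)

lemma nonneg_quadratic_imp_discriminant:
  fixes A B C :: real
  assumes "\<And>t. 0 \<le> A + 2 * t * C + t\<^sup>2 * B" "0 \<le> B"
  shows "C\<^sup>2 \<le> A * B"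
proof (cases "B = 0")
  case True
  have "C = 0"
  proof (rule ccontr)
    assume "C \<noteq> 0"
    then show False
      \<comment> \<open>For \<open>B = 0\<close> the expression is affine in \<open>t\<close>, and
        at this \<open>t\<close> its value is \<open>-1\<close>.\<close>
      using assms(1)[of "- (A + 1) / (2 * C)"] True by (simp add: field_simps)
  qed
  then show ?thesis by (simp add: True)
next
  case False
  then show ?thesis
    using assms(1)[of "- C / B"] assms(2) by (simp add: field_simps power2_eq_square)
qed

lemma L2_Cauchy_Schwarz:
  assumes "square_integrable M f" "square_integrable M g"
  shows "\<bar>LINT x|M. f x \<bullet> g x\<bar> \<le> L2_seminorm M f * L2_seminorm M g"
proof -
  have "0 \<le> (LINT x|M. (norm (f x))\<^sup>2) + 2 * t * (LINT x|M. f x \<bullet> g x) + t\<^sup>2 * (LINT x|M. (norm (g x))\<^sup>2)" for t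
    unfolding integral_norm_add_power2[OF assms, symmetric] by (simp add: integral_nonneg_AE)
  then have "(LINT x|M. f x \<bullet> g x)\<^sup>2 \<le> (LINT x|M. (norm (f x))\<^sup>2) * (LINT x|M. (norm (g x))\<^sup>2)"
    by (rule nonneg_quadratic_imp_discriminant) (simp add: integral_nonneg_AE)
  also have "\<dots> = (L2_seminorm M f * L2_seminorm M g)\<^sup>2"
    by (simp add: L2_seminorm_power2 power_mult_distrib)
  finally show ?thesis
    using L2_seminorm_nonneg mult_nonneg_nonneg by (metis abs_le_square_iff abs_of_nonneg)
qed

lemma L2_triangle:
  assumes "square_integrable M f" "square_integrable M g"
  shows "L2_seminorm M (\<lambda>x. f x + g x) \<le> L2_seminorm M f + L2_seminorm M g"
proof -
  have "(L2_seminorm M (\<lambda>x. f x + g x))\<^sup>2 =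
    (L2_seminorm M f)\<^sup>2 + 2 * (LINT x|M. f x \<bullet> g x) + (L2_seminorm M g)\<^sup>2"
    using integral_norm_add_power2[OF assms, of 1] by (simp add: L2_seminorm_power2)
  also have "\<dots> \<le> (L2_seminorm M f + L2_seminorm M g)\<^sup>2"
    using L2_Cauchy_Schwarz[OF assms] by (simp add: power2_sum)
  finally show ?thesis
    using L2_seminorm_nonneg by (metis add_nonneg_nonneg power2_le_imp_le)
qed

lemma L2_seminorm_scaleR: "L2_seminorm M (\<lambda>x. c *\<^sub>R f x) = \<bar>c\<bar> * L2_seminorm M f"
  by (simp add: L2_seminorm_def power_mult_distrib real_sqrt_mult)

lemma L2_seminorm_minus_commute: "L2_seminorm M (\<lambda>x. f x - g x) = L2_seminorm M (\<lambda>x. g x - f x)"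
  by (simp add: L2_seminorm_def norm_minus_commute)

lemma L2_triangle_diff:
  assumes "square_integrable M f" "square_integrable M g" "square_integrable M h"
  shows "L2_seminorm M (\<lambda>x. f x - h x) \<le> L2_seminorm M (\<lambda>x. f x - g x) + L2_seminorm M (\<lambda>x. g x - h x)"
  using L2_triangle[of M "\<lambda>x. f x - g x" "\<lambda>x. g x - h x"] assms by (simp add: square_integrable_diff)

lemma L2_triangle_le:
  assumes "square_integrable M f" "square_integrable M g"
  shows "L2_seminorm M f \<le> L2_seminorm M g + L2_seminorm M (\<lambda>x. f x - g x)"
  using L2_triangle[of M g "\<lambda>x. f x - g x"] assms by (simp add: square_integrable_diff)

lemma L2_seminorm_cong_AE:
  assumes "f \<in> borel_measurable M" "g \<in> borel_measurable M" "AE x in M. f x = g x"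
  shows "L2_seminorm M f = L2_seminorm M g"
  unfolding L2_seminorm_def
  by (intro arg_cong[where f=sqrt] integral_cong_AE) (use assms in auto)

text \<open>\<open>norm f\<close> is at most \<open>1 + (norm f)^2\<close>, and constants are
  integrable for a finite measure.\<close>

lemma L2_imp_integrable:
  assumes "finite_measure M" "square_integrable M f"
  shows "integrable M f"
proof (rule Bochner_Integration.integrable_bound)
  interpret finite_measure M by fact
  show "integrable M (\<lambda>x. 1 + (norm (f x))\<^sup>2)"
    using assms by (auto simp: square_integrable_def)
  show "f \<in> borel_measurable M"
    using assms by (auto simp: square_integrable_def)
  have "n \<le> 1 + n\<^sup>2" if "0 \<le> n" for n :: real
    using sum_squares_bound[of 1 n] that by auto
  then show "AE x in M. norm (f x) \<le> norm (1 + (norm (f x))\<^sup>2)"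
    by auto
qed

lemma square_integrable_1: "finite_measure M \<Longrightarrow> square_integrable M (\<lambda>x. 1::real)"
  by (simp add: square_integrable_def finite_measure.integrable_const)

lemma square_integrable_norm: "square_integrable M f \<Longrightarrow> square_integrable M (\<lambda>x. norm (f x))"
  by (auto simp: square_integrable_def)

lemma L1_le_L2:
  assumes "finite_measure M" "square_integrable M f"
  shows "(LINT x|M. norm (f x)) \<le> sqrt (measure M (space M)) * L2_seminorm M f"
  using L2_Cauchy_Schwarz[OF square_integrable_1[OF assms(1)] square_integrable_norm[OF assms(2)]]
  by (simp add: L2_seminorm_def)

text \<open>Fatou's lemma, arranged so that square integrability of the limit comes together with
  the bound on its norm.\<close>

lemma integral_norm_power2_le_Fatou:
  fixes f :: "nat \<Rightarrow> 'a \<Rightarrow> 'b::euclidean_space"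
  assumes f: "\<And>n. f n \<in> borel_measurable M" and g: "g \<in> borel_measurable M"
    and lim: "AE x in M. (\<lambda>n. f n x) \<longlonglongrightarrow> g x"
    and int: "\<And>n. integrable M (\<lambda>x. (norm (f n x))\<^sup>2)"
    and le: "\<And>n. (LINT x|M. (norm (f n x))\<^sup>2) \<le> C"
  shows "square_integrable M g" "(LINT x|M. (norm (g x))\<^sup>2) \<le> C"
proof -
  have "0 \<le> C"
    using le[of 0] by (meson Bochner_Integration.integral_nonneg order_trans zero_le_power2)
  have "(\<integral>\<^sup>+x. ennreal ((norm (g x))\<^sup>2) \<partial>M) = (\<integral>\<^sup>+x. liminf (\<lambda>n. ennreal ((norm (f n x))\<^sup>2)) \<partial>M)"
  proof (rule nn_integral_cong_AE, use lim in eventually_elim)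
    case (elim x)
    have "(\<lambda>n. ennreal ((norm (f n x))\<^sup>2)) \<longlonglongrightarrow> ennreal ((norm (g x))\<^sup>2)"
      by (intro tendsto_ennrealI tendsto_intros elim)
    then show ?case
      using lim_imp_Liminf[OF sequentially_bot] by force
  qed
  also have "\<dots> \<le> liminf (\<lambda>n. \<integral>\<^sup>+x. ennreal ((norm (f n x))\<^sup>2) \<partial>M)"
    by (intro nn_integral_liminf) (use f in auto)
  also have "\<dots> = liminf (\<lambda>n. ennreal (LINT x|M. (norm (f n x))\<^sup>2))"
    by (simp add: nn_integral_eq_integral[OF int])
  also have "\<dots> \<le> ennreal C"
    using Liminf_mono[of "\<lambda>n. ennreal (LINT x|M. (norm (f n x))\<^sup>2)" "\<lambda>n. ennreal C" sequentially]
    by (simp add: Liminf_const le ennreal_leI)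
  finally have *: "(\<integral>\<^sup>+x. ennreal ((norm (g x))\<^sup>2) \<partial>M) \<le> ennreal C" .
  have i: "integrable M (\<lambda>x. (norm (g x))\<^sup>2)"
  proof (rule integrableI_bounded)
    show "(\<integral>\<^sup>+x. ennreal (norm ((norm (g x))\<^sup>2)) \<partial>M) < \<infinity>"
      using * by (simp add: order_le_less_trans)
  qed (use g in auto)
  show "square_integrable M g"
    using i g by (simp add: square_integrable_def)
  show "(LINT x|M. (norm (g x))\<^sup>2) \<le> C"
    using * \<open>0 \<le> C\<close> by (simp add: nn_integral_eq_integral[OF i])
qed

text \<open>The Riesz-Fischer argument. Finiteness of the measure bounds \<open>L^1\<close> norms by
  \<open>L^2\<close> norms, so along a fast subsequence the telescoping series of differences
  converges absolutely almost everywhere.\<close>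

lemma L2_complete:
  fixes f :: "nat \<Rightarrow> 'a \<Rightarrow> 'b::euclidean_space"
  assumes fin: "finite_measure M"
    and f: "\<And>n. square_integrable M (f n)"
    and Cauchy: "\<And>e. e > 0 \<Longrightarrow> \<exists>N. \<forall>m\<ge>N. \<forall>n\<ge>N. L2_seminorm M (\<lambda>x. f m x - f n x) < e"
  obtains g where "square_integrable M g" "(\<lambda>n. L2_seminorm M (\<lambda>x. f n x - g x)) \<longlonglongrightarrow> 0"
proof -
  interpret finite_measure M by fact
  have fm: "f n \<in> borel_measurable M" for n
    using f by (simp add: square_integrable_def)
  have "\<exists>k. strict_mono k \<and> (\<forall>i m n. k i \<le> m \<longrightarrow> k i \<le> n \<longrightarrow> L2_seminorm M (\<lambda>x. f m x - f n x) < (1/2) ^ i)"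
  proof -
    obtain N where N: "\<And>i m n. N i \<le> m \<Longrightarrow> N i \<le> n \<Longrightarrow> L2_seminorm M (\<lambda>x. f m x - f n x) < (1/2) ^ i"
      using Cauchy[of "(1/2) ^ i" for i] by (metis zero_less_power half_gt_zero_iff zero_less_one)
    \<comment> \<open>These sums increase strictly and dominate each \<open>N i\<close>.\<close>
    define k where "k i = (\<Sum>j\<le>i. Suc (N j))" for i
    have "strict_mono k"
      unfolding k_def by (rule strict_monoI_Suc) simp
    moreover have "N i \<le> k i" for i
      unfolding k_def using member_le_sum[of i "{..i}" "\<lambda>j. Suc (N j)"] by simp
    ultimately show ?thesis
      using N by (meson order_trans)
  qed
  then obtain k where k: "strict_mono k"
    and kC: "\<And>i m n. k i \<le> m \<Longrightarrow> k i \<le> n \<Longrightarrow> L2_seminorm M (\<lambda>x. f m x - f n x) < (1/2) ^ i"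
    by blast
  define d where "d i x = f (k (Suc i)) x - f (k i) x" for i x
  have dsq: "square_integrable M (d i)" for i
    unfolding d_def using f square_integrable_diff by blast
  have dint: "integrable M (d i)" for i
    using dsq fin L2_imp_integrable by blast
  have dn: "L2_seminorm M (d i) < (1/2) ^ i" for i
    unfolding d_def using kC k by (simp add: strict_mono_less_eq)
  define c where "c = sqrt (measure M (space M))"
  have c0: "0 \<le> c"
    by (simp add: c_def)
  have "AE x in M. summable (\<lambda>i. norm (d i x))"
  proof -
    have "(\<integral>\<^sup>+x. (\<Sum>i. ennreal (norm (d i x))) \<partial>M) = (\<Sum>i. \<integral>\<^sup>+x. ennreal (norm (d i x)) \<partial>M)"
      by (rule nn_integral_suminf) (use dint in auto)
    also have "\<dots> = (\<Sum>i. ennreal (LINT x|M. norm (d i x)))"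
      by (simp add: nn_integral_eq_integral dint)
    also have "\<dots> \<le> (\<Sum>i. ennreal (c * (1/2) ^ i))"
    proof (intro suminf_le ennreal_leI)
      fix i
      have "(LINT x|M. norm (d i x)) \<le> c * L2_seminorm M (d i)"
        unfolding c_def by (rule L1_le_L2[OF fin dsq])
      also have "\<dots> \<le> c * (1/2) ^ i"
        using dn[of i] c0 by (intro mult_left_mono) auto
      finally show "(LINT x|M. norm (d i x)) \<le> c * (1/2) ^ i" .
    qed auto
    also have "\<dots> = ennreal (\<Sum>i. c * (1/2) ^ i)"
      by (rule suminf_ennreal_eq[OF _ summable_sums[OF summable_mult[OF summable_geometric]]])
        (use c0 in auto)
    finally have "(\<integral>\<^sup>+x. (\<Sum>i. ennreal (norm (d i x))) \<partial>M) \<noteq> \<infinity>"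
      using ennreal_less_top neq_top_trans by (metis infinity_ennreal_def less_irrefl order_le_less_trans)
    then have "AE x in M. (\<Sum>i. ennreal (norm (d i x))) \<noteq> \<infinity>"
      by (intro nn_integral_PInf_AE) (use dint in auto)
    then show ?thesis
      by eventually_elim (auto intro!: summable_suminf_not_top)
  qed
  then have conv: "AE x in M. convergent (\<lambda>i. f (k i) x)"
  proof eventually_elim
    case (elim x)
    then have "summable (\<lambda>i. d i x)"
      by (rule summable_norm_cancel)
    then have "convergent (\<lambda>n. (\<Sum>i<n. d i x) + f (k 0) x)"
      by (intro convergent_add) (auto simp: summable_iff_convergent convergent_const)
    moreover have "(\<Sum>i<n. d i x) + f (k 0) x = f (k n) x" for n
      unfolding d_def by (subst sum_lessThan_telescope) simp
    ultimately show ?case by simp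
  qed
  define g where "g x = lim (\<lambda>i. f (k i) x)" for x
  have gm: "g \<in> borel_measurable M"
    unfolding g_def[abs_def] by (rule borel_measurable_lim_metric) (rule fm)
  have lim: "AE x in M. (\<lambda>i. f (k i) x) \<longlonglongrightarrow> g x"
    using conv unfolding g_def convergent_LIMSEQ_iff by simp
  \<comment> \<open>Fatou along the shifted subsequence compares \<open>f m\<close> with the limit;
    the same application yields square integrability of \<open>f m - g\<close>, hence of
    \<open>g\<close>.\<close>
  have est: "square_integrable M (\<lambda>x. f m x - g x) \<and> (LINT x|M. (norm (f m x - g x))\<^sup>2) \<le> ((1/2) ^ i)\<^sup>2"
    if "k i \<le> m" for i m
  proof -
    have *: "(norm (f m x - f (k (j + i)) x))\<^sup>2 = (norm (f m x - f (k (j + i)) x))\<^sup>2" for j x ..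
    have a: "(\<lambda>x. f m x - f (k (j + i)) x) \<in> borel_measurable M" for j
      using fm by auto
    have b: "(\<lambda>x. f m x - g x) \<in> borel_measurable M"
      using fm gm by auto
    have c: "AE x in M. (\<lambda>j. f m x - f (k (j + i)) x) \<longlonglongrightarrow> f m x - g x"
      using lim by eventually_elim (intro tendsto_intros LIMSEQ_ignore_initial_segment)
    have d: "integrable M (\<lambda>x. (norm (f m x - f (k (j + i)) x))\<^sup>2)" for j
      using square_integrable_diff[OF f f] by (auto simp: square_integrable_def)
    have e: "(LINT x|M. (norm (f m x - f (k (j + i)) x))\<^sup>2) \<le> ((1/2) ^ i)\<^sup>2" for j
    proof -
      have "k i \<le> k (j + i)"
        using k by (simp add: strict_mono_less_eq)
      then have "L2_seminorm M (\<lambda>x. f m x - f (k (j + i)) x) \<le> (1/2) ^ i"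
        using kC that by (simp add: less_imp_le)
      then show ?thesis
        unfolding L2_seminorm_power2[symmetric] by (intro power_mono L2_seminorm_nonneg)
    qed
    show ?thesis
      using integral_norm_power2_le_Fatou[OF a b c d e] by blast
  qed
  have "square_integrable M (\<lambda>x. f (k 0) x - (f (k 0) x - g x))"
    using est[of 0 "k 0"] f square_integrable_diff by blast
  then have gsq: "square_integrable M g"
    by simp
  have "(\<lambda>n. L2_seminorm M (\<lambda>x. f n x - g x)) \<longlonglongrightarrow> 0"
  proof (rule LIMSEQ_I)
    fix r :: real assume "0 < r"
    then obtain i where i: "(1/2) ^ i < r"
      using real_arch_pow_inv by force
    have "norm (L2_seminorm M (\<lambda>x. f m x - g x) - 0) < r" if "k i \<le> m" for m
    proof -
      have "(L2_seminorm M (\<lambda>x. f m x - g x))\<^sup>2 \<le> ((1/2) ^ i)\<^sup>2"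
        using est[OF that] by (simp add: L2_seminorm_power2)
      then have "L2_seminorm M (\<lambda>x. f m x - g x) \<le> (1/2) ^ i"
        by (rule power2_le_imp_le) simp
      then show ?thesis
        using i L2_seminorm_nonneg[of M "\<lambda>x. f m x - g x"] by simp
    qed
    then show "\<exists>N. \<forall>n\<ge>N. norm (L2_seminorm M (\<lambda>x. f n x - g x) - 0) < r"
      by blast
  qed
  then show ?thesis
    using that gsq by blast
qed

section \<open>Test functions\<close>

lemma test_functionsI:
  assumes "is_smooth \<phi>" "compact K" "K \<subseteq> \<Omega>" "\<And>x. x \<notin> K \<Longrightarrow> \<phi> x = 0"
  shows "\<phi> \<in> test_functions \<Omega>"
proof -
  have "{x. \<phi> x \<noteq> 0} \<subseteq> K"
    using assms by blast
  then have c: "closure {x. \<phi> x \<noteq> 0} \<subseteq> K"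
    by (simp add: closure_minimal compact_imp_closed assms)
  then have "compact (closure {x. \<phi> x \<noteq> 0})"
    using assms by (meson closed_closure closed_subset compact_Int_closed compact_imp_bounded bounded_subset compact_eq_bounded_closed)
  then show ?thesis
    using c assms unfolding test_functions_def by blast
qed

lemma test_functions_smooth: "\<phi> \<in> test_functions \<Omega> \<Longrightarrow> is_smooth \<phi>"
  by (simp add: test_functions_def)

lemma test_functions_supportE:
  assumes "\<phi> \<in> test_functions \<Omega>"
  obtains K where "compact K" "K \<subseteq> \<Omega>" "\<And>x. x \<notin> K \<Longrightarrow> \<phi> x = 0"
proof
  show "compact (closure {x. \<phi> x \<noteq> 0})" "closure {x. \<phi> x \<noteq> 0} \<subseteq> \<Omega>"
    using assms by (simp_all add: test_functions_def)
  show "\<phi> x = 0" if "x \<notin> closure {x. \<phi> x \<noteq> 0}" for x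
    using that closure_subset[of "{x. \<phi> x \<noteq> 0}"] by fastforce
qed

lemma test_functions_zero: "\<phi> \<in> test_functions \<Omega> \<Longrightarrow> x \<notin> \<Omega> \<Longrightarrow> \<phi> x = 0"
  by (metis test_functions_supportE subsetD)

lemma test_functions_mono: "\<Omega> \<subseteq> \<Omega>' \<Longrightarrow> test_functions \<Omega> \<subseteq> test_functions \<Omega>'"
  unfolding test_functions_def by blast

text \<open>A compact set outside which \<open>\<phi>\<close> vanishes serves \<open>\<psi>\<close>
  as well, so only zeros have to be compared, not closures of supports.\<close>

lemma test_functions_dominated:
  assumes "\<phi> \<in> test_functions \<Omega>" "is_smooth \<psi>" "\<And>x. \<phi> x = 0 \<Longrightarrow> \<psi> x = 0"
  shows "\<psi> \<in> test_functions \<Omega>"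
  by (rule test_functions_supportE[OF assms(1)], rule test_functionsI) (use assms in auto)

lemma test_functions_mult:
  "\<phi> \<in> test_functions \<Omega> \<Longrightarrow> is_smooth g \<Longrightarrow> (\<lambda>x. \<phi> x * g x) \<in> test_functions \<Omega>"
  by (rule test_functions_dominated) (auto intro: is_smooth_mult test_functions_smooth)

lemma test_functions_cmult: "\<phi> \<in> test_functions \<Omega> \<Longrightarrow> (\<lambda>x. c * \<phi> x) \<in> test_functions \<Omega>"
  using test_functions_mult[OF _ is_smooth_const] by (simp add: mult.commute)

lemma test_functions_add:
  assumes "\<phi> \<in> test_functions \<Omega>" "\<psi> \<in> test_functions \<Omega>"
  shows "(\<lambda>x. \<phi> x + \<psi> x) \<in> test_functions \<Omega>"
proof (rule test_functions_supportE[OF assms(1)], rule test_functions_supportE[OF assms(2)])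
  fix K L
  assume "compact K" "K \<subseteq> \<Omega>" "\<And>x. x \<notin> K \<Longrightarrow> \<phi> x = 0" "compact L" "L \<subseteq> \<Omega>" "\<And>x. x \<notin> L \<Longrightarrow> \<psi> x = 0"
  then show ?thesis
    by (intro test_functionsI[of _ "K \<union> L"] is_smooth_add)
      (use assms test_functions_smooth in \<open>auto intro: compact_Un\<close>)
qed

lemma test_functions_diff:
  "\<phi> \<in> test_functions \<Omega> \<Longrightarrow> \<psi> \<in> test_functions \<Omega> \<Longrightarrow> (\<lambda>x. \<phi> x - \<psi> x) \<in> test_functions \<Omega>"
  using test_functions_add[of \<phi> \<Omega> "\<lambda>x. (- 1) * \<psi> x"] test_functions_cmult[of \<psi> \<Omega> "- 1"] by simp

lemma test_functions_0: "(\<lambda>x. 0) \<in> test_functions \<Omega>"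
  by (rule test_functionsI[of _ "{}"]) (auto intro: is_smooth_const)

section \<open>Gradient calculus and integrals of compactly supported functions\<close>

lemma gradient_add: "is_smooth f \<Longrightarrow> is_smooth g \<Longrightarrow> gradient (\<lambda>x. f x + g x) x = gradient f x + gradient g x"
  and gradient_diff: "is_smooth f \<Longrightarrow> is_smooth g \<Longrightarrow> gradient (\<lambda>x. f x - g x) x = gradient f x - gradient g x"
  and gradient_mult: "is_smooth f \<Longrightarrow> is_smooth g \<Longrightarrow>
    gradient (\<lambda>x. f x * g x) x = f x *\<^sub>R gradient g x + g x *\<^sub>R gradient f x"
  and gradient_const: "gradient (\<lambda>x. c) y = 0"
  by (auto intro!: gradient_eqI GDERIV_add GDERIV_diff GDERIV_mult GDERIV_const is_smooth_GDERIV)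

lemma gradient_cmult: "is_smooth f \<Longrightarrow> gradient (\<lambda>x. c * f x) x = c *\<^sub>R gradient f x"
  by (simp add: gradient_mult[OF is_smooth_const] gradient_const)

lemma gradient_inverse:
  "is_smooth f \<Longrightarrow> f x \<noteq> 0 \<Longrightarrow> gradient (\<lambda>x. inverse (f x)) x = - ((inverse (f x))\<^sup>2) *\<^sub>R gradient f x"
  by (rule gradient_eqI[OF GDERIV_inverse[OF is_smooth_GDERIV]])

lemma gradient_zero_outside:
  assumes "closed K" "\<And>x. x \<notin> K \<Longrightarrow> f x = 0" "x \<notin> K"
  shows "gradient f x = 0"
proof (rule gradient_eqI)
  have "\<forall>\<^sub>F y in nhds x. y \<in> - K"
    using assms by (intro eventually_nhds_in_open) auto
  then have "\<forall>\<^sub>F y in at x. 0 = f y"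
    unfolding eventually_at_filter by eventually_elim (simp add: assms)
  then have "(f has_derivative (\<lambda>h. 0)) (at x)"
    by (intro has_derivative_transform_eventually[OF has_derivative_const]) (use assms in auto)
  then show "GDERIV f x :> 0"
    by (simp add: gderiv_def)
qed

lemma test_functions_gradient_zero: "\<phi> \<in> test_functions \<Omega> \<Longrightarrow> x \<notin> \<Omega> \<Longrightarrow> gradient \<phi> x = 0"
  by (metis test_functions_supportE subsetD compact_imp_closed gradient_zero_outside)

lemma test_functions_gradient_inner:
  assumes "\<phi> \<in> test_functions \<Omega>" "b \<in> Basis"
  shows "(\<lambda>x. gradient \<phi> x \<bullet> b) \<in> test_functions \<Omega>"
proof (rule test_functions_supportE[OF assms(1)])
  fix K assume K: "compact K" "K \<subseteq> \<Omega>" "\<And>x. x \<notin> K \<Longrightarrow> \<phi> x = 0"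
  then show ?thesis
    using gradient_zero_outside[OF compact_imp_closed[OF K(1)] K(3)]
    by (intro test_functionsI[of _ K] is_smooth_gradient_inner assms test_functions_smooth[OF assms(1)]) auto
qed

lemma integrable_compact_support:
  fixes f :: "'a::euclidean_space \<Rightarrow> 'b::euclidean_space"
  assumes "continuous_on UNIV f" "compact K" "\<And>x. x \<notin> K \<Longrightarrow> f x = 0"
  shows "integrable lborel f"
proof -
  have "integrable lborel (\<lambda>x. indicator K x *\<^sub>R f x)"
    using assms continuous_on_subset by (blast intro: borel_integrable_compact)
  moreover have "(\<lambda>x. indicator K x *\<^sub>R f x) = f"
    using assms by (auto simp: indicator_def)
  ultimately show ?thesis by simp
qed

lemma integrable_test_mult:
  fixes g :: "'a::euclidean_space \<Rightarrow> 'b::euclidean_space"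
  assumes "\<phi> \<in> test_functions \<Omega>" "continuous_on UNIV g" "\<And>x. \<phi> x = 0 \<Longrightarrow> g x = 0"
  shows "integrable lborel g"
  by (rule test_functions_supportE[OF assms(1)], rule integrable_compact_support) (use assms in auto)

text \<open>The definitions integrate over \<open>lebesgue_on \<Omega>\<close>, the calculus lemmas
  over \<open>lborel\<close>. Passing to \<open>lborel\<close> also makes the norms of a test
  function independent of the domain.\<close>

lemma integral_lebesgue_on_eq_lborel:
  fixes f :: "'a::euclidean_space \<Rightarrow> 'b::euclidean_space"
  assumes "open \<Omega>" "continuous_on UNIV f" "\<And>x. x \<notin> \<Omega> \<Longrightarrow> f x = 0"
  shows "(LINT x|lebesgue_on \<Omega>. f x) = (LINT x|lborel. f x)"
proof -
  have "(LINT x|lebesgue_on \<Omega>. f x) = (LINT x|lebesgue. indicator \<Omega> x *\<^sub>R f x)"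
    using assms(1) by (intro integral_restrict_space) auto
  also have "(\<lambda>x. indicator \<Omega> x *\<^sub>R f x) = f"
    using assms(3) by (auto simp: indicator_def)
  also have "(LINT x|lebesgue. f x) = (LINT x|lborel. f x)"
    using assms(2) by (intro integral_completion) (auto intro: borel_measurable_continuous_onI)
  finally show ?thesis .
qed

lemma integrable_lebesgue_on_iff_lborel:
  fixes f :: "'a::euclidean_space \<Rightarrow> 'b::euclidean_space"
  assumes "open \<Omega>" "continuous_on UNIV f" "\<And>x. x \<notin> \<Omega> \<Longrightarrow> f x = 0"
  shows "integrable (lebesgue_on \<Omega>) f \<longleftrightarrow> integrable lborel f"
proof -
  have "integrable (lebesgue_on \<Omega>) f \<longleftrightarrow> integrable lebesgue (\<lambda>x. indicator \<Omega> x *\<^sub>R f x)"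
    using assms(1) by (intro integrable_restrict_space) auto
  also have "(\<lambda>x. indicator \<Omega> x *\<^sub>R f x) = f"
    using assms(3) by (auto simp: indicator_def)
  also have "integrable lebesgue f \<longleftrightarrow> integrable lborel f"
    using assms(2) by (intro integrable_completion) (auto intro: borel_measurable_continuous_onI)
  finally show ?thesis .
qed

lemma continuous_imp_measurable_lebesgue_on:
  fixes f :: "'a::euclidean_space \<Rightarrow> 'b::euclidean_space"
  assumes "continuous_on UNIV f"
  shows "f \<in> borel_measurable (lebesgue_on \<Omega>)"
  using assms borel_measurable_continuous_onI measurable_completion measurable_restrict_space1
  by (metis measurable_lborel2)

lemma square_integrable_compact_support:
  fixes f :: "'a::euclidean_space \<Rightarrow> 'b::euclidean_space"
  assumes "open \<Omega>" "continuous_on UNIV f" "compact K" "\<And>x. x \<notin> K \<Longrightarrow> f x = 0" "K \<subseteq> \<Omega>"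
  shows "square_integrable (lebesgue_on \<Omega>) f"
proof -
  have "integrable (lebesgue_on \<Omega>) (\<lambda>x. (norm (f x))\<^sup>2)"
    by (subst integrable_lebesgue_on_iff_lborel)
      (use assms in \<open>auto intro!: continuous_intros integrable_compact_support[of _ K]\<close>)
  then show ?thesis
    using assms continuous_imp_measurable_lebesgue_on by (auto simp: square_integrable_def)
qed

lemma test_functions_square_integrable:
  assumes "\<phi> \<in> test_functions \<Omega>" "open \<Omega>"
  shows "square_integrable (lebesgue_on \<Omega>) \<phi>" "square_integrable (lebesgue_on \<Omega>) (gradient \<phi>)"
proof -
  obtain K where K: "compact K" "K \<subseteq> \<Omega>" "\<And>x. x \<notin> K \<Longrightarrow> \<phi> x = 0"
    using test_functions_supportE[OF assms(1)] by blast
  note s = test_functions_smooth[OF assms(1)]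
  show "square_integrable (lebesgue_on \<Omega>) \<phi>"
    by (rule square_integrable_compact_support[OF assms(2) is_smooth_continuous[OF s] K(1,3,2)])
  show "square_integrable (lebesgue_on \<Omega>) (gradient \<phi>)"
    by (rule square_integrable_compact_support[OF assms(2) is_smooth_continuous_gradient[OF s] K(1) _ K(2)])
      (rule gradient_zero_outside[OF compact_imp_closed[OF K(1)] K(3)])
qed

text \<open>By translation invariance every difference quotient of \<open>f\<close> in direction
  \<open>b\<close> has integral \<open>0\<close>. A Lipschitz bound dominates the quotients, and
  dominated convergence passes to the derivative.\<close>

lemma integral_directional_derivative_eq_0:
  fixes f :: "'a::euclidean_space \<Rightarrow> real"
  assumes f: "\<And>x. GDERIV f x :> f' x" and c: "continuous_on UNIV f'"
    and K: "compact K" "\<And>x. x \<notin> K \<Longrightarrow> f x = 0"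
  shows "(LINT x|lborel. f' x \<bullet> b) = 0"
proof -
  have cf: "continuous_on UNIV f"
    using f by (metis GDERIV_imp_differentiable differentiable_imp_continuous_within continuous_on_eq_continuous_within)
  have f'0: "f' x = 0" if "x \<notin> K" for x
    using gradient_zero_outside[OF compact_imp_closed[OF K(1)], of f] K(2) that gradient_eqI[OF f[of x]]
    by simp
  have "compact (f' ` K)"
    by (intro compact_continuous_image K continuous_on_subset[OF c]) simp
  then obtain C0 where "\<And>x. x \<in> K \<Longrightarrow> norm (f' x) \<le> C0"
    using compact_imp_bounded[of "f' ` K"] unfolding bounded_iff by auto
  then have C: "norm (f' x) \<le> \<bar>C0\<bar>" for x
    using f'0[of x] by (cases "x \<in> K") (auto intro!: order_trans[OF _ abs_ge_self])
  have lip: "\<bar>f y - f x\<bar> \<le> \<bar>C0\<bar> * norm (y - x)" for x y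
  proof -
    have "norm (f y - f x) \<le> \<bar>C0\<bar> * norm (y - x)"
    proof (rule differentiable_bound[of UNIV f "\<lambda>x h. h \<bullet> f' x"])
      show "(f has_derivative (\<lambda>h. h \<bullet> f' z)) (at z within UNIV)" for z
        using f gderiv_def by blast
      show "onorm (\<lambda>h. h \<bullet> f' z) \<le> \<bar>C0\<bar>" for z
      proof (rule onorm_bound)
        show "norm (h \<bullet> f' z) \<le> \<bar>C0\<bar> * norm h" for h
          using order_trans[OF Cauchy_Schwarz_ineq2[of h "f' z"] mult_left_mono[OF C[of z] norm_ge_zero[of h]]]
          by (simp add: mult.commute)
      qed simp
    qed auto
    then show ?thesis by simp
  qed
  define t where "t n = 1 / real (Suc n)" for n
  have t: "0 < t n" "t n \<le> 1" for n
    by (auto simp: t_def)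
  have t0: "t \<longlonglongrightarrow> 0"
    unfolding t_def[abs_def] by (rule LIMSEQ_Suc[OF lim_1_over_n])
  obtain R where R: "K \<subseteq> cball 0 R"
    using compact_imp_bounded[OF K(1)] unfolding bounded_iff
    by (metis mem_cball_0 subsetI)
  define D where "D n x = (f (x + t n *\<^sub>R b) - f x) / t n" for n x
  have Dint: "(LINT x|lborel. D n x) = 0" for n
  proof -
    have i: "integrable lborel f"
      using integrable_compact_support[OF cf K] .
    have i': "integrable lborel (\<lambda>x. f (t n *\<^sub>R b + x))"
      by (rule integrable_distr[of _ _ borel]) (use i lborel_distr_plus[of "t n *\<^sub>R b"] in auto)
    have "(LINT x|lborel. f (t n *\<^sub>R b + x)) = (LINT x|distr lborel borel ((+) (t n *\<^sub>R b)). f x)"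
      by (subst integral_distr) (use cf borel_measurable_continuous_onI in auto)
    also have "\<dots> = (LINT x|lborel. f x)"
      by (simp add: lborel_distr_plus)
    finally show ?thesis
      unfolding D_def using i i' by (simp add: add.commute)
  qed
  have "(\<lambda>n. LINT x|lborel. D n x) \<longlonglongrightarrow> (LINT x|lborel. f' x \<bullet> b)"
  proof (rule integral_dominated_convergence)
    show "(\<lambda>x. f' x \<bullet> b) \<in> borel_measurable lborel"
      using c by (auto intro!: borel_measurable_continuous_onI continuous_intros)
    show "D n \<in> borel_measurable lborel" for n
    proof -
      have "continuous_on UNIV (\<lambda>x. f (x + t n *\<^sub>R b))"
        by (rule continuous_on_compose2[OF cf]) (auto intro: continuous_intros)
      then show ?thesis
        unfolding D_def[abs_def] using cf t(1)[of n]
        by (auto intro!: borel_measurable_continuous_onI continuous_intros)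
    qed
    \<comment> \<open>Since \<open>t n \<le> 1\<close>, all difference quotients vanish outside the
      ball around the support enlarged by \<open>norm b\<close>.\<close>
    show "integrable lborel (\<lambda>x. indicator (cball 0 (R + norm b)) x *\<^sub>R (\<bar>C0\<bar> * norm b))"
      by (rule borel_integrable_compact) (auto intro: continuous_intros)
    show "AE x in lborel. (\<lambda>n. D n x) \<longlonglongrightarrow> f' x \<bullet> b"
    proof (intro AE_I2)
      fix x
      have "((\<lambda>s. f (x + s *\<^sub>R b)) has_derivative (\<lambda>s. (s *\<^sub>R b) \<bullet> f' x)) (at 0)"
        by (rule has_derivative_compose[of "\<lambda>s. x + s *\<^sub>R b" "\<lambda>s. s *\<^sub>R b" 0 UNIV f "\<lambda>h. h \<bullet> f' x"])
          (auto intro!: derivative_eq_intros f[unfolded gderiv_def, of "x + 0 *\<^sub>R b", simplified])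
      then have "DERIV (\<lambda>s. f (x + s *\<^sub>R b)) 0 :> b \<bullet> f' x"
        by (simp add: has_field_derivative_def mult_commute_abs)
      then have "((\<lambda>s. (f (x + s *\<^sub>R b) - f x) / s) \<longlongrightarrow> b \<bullet> f' x) (at 0)"
        by (simp add: DERIV_def)
      moreover have "filterlim t (at 0) sequentially"
        unfolding filterlim_at using t0 t(1)[THEN less_imp_neq, symmetric] by simp
      ultimately show "(\<lambda>n. D n x) \<longlonglongrightarrow> f' x \<bullet> b"
        unfolding D_def inner_commute[of "f' x"] by (rule filterlim_compose)
    qed
    show "AE x in lborel. norm (D n x) \<le> indicator (cball 0 (R + norm b)) x *\<^sub>R (\<bar>C0\<bar> * norm b)" for n
    proof (intro AE_I2)
      fix x
      show "norm (D n x) \<le> indicator (cball 0 (R + norm b)) x *\<^sub>R (\<bar>C0\<bar> * norm b)"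
      proof (cases "x \<in> cball 0 (R + norm b)")
        case True
        have "\<bar>f (x + t n *\<^sub>R b) - f x\<bar> \<le> \<bar>C0\<bar> * (t n * norm b)"
          using lip[of "x + t n *\<^sub>R b" x] t(1)[of n] by simp
        then show ?thesis
          using True t(1)[of n] by (simp add: D_def field_simps)
      next
        case False
        have "norm (t n *\<^sub>R b) \<le> norm b"
          using t[of n] by (simp add: mult_left_le_one_le)
        then have "norm x \<le> norm (x + t n *\<^sub>R b) + norm b"
          using norm_triangle_ineq4[of "x + t n *\<^sub>R b" "t n *\<^sub>R b"] by simp
        moreover have "norm x > R + norm b"
          using False by simp
        moreover have "norm y \<le> R" if "y \<in> K" for y
          using subsetD[OF R that] by simp
        ultimately have "x \<notin> K \<and> x + t n *\<^sub>R b \<notin> K"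
          by (smt (verit) norm_ge_zero)
        then show ?thesis
          by (simp add: D_def K)
      qed
    qed
  qed
  then show ?thesis
    by (simp add: Dint LIMSEQ_const_iff)
qed

text \<open>The product of \<open>\<phi>\<close> and \<open>g\<close> has compact support even if
  \<open>g\<close> does not, so its directional derivative integrates to \<open>0\<close>.\<close>

lemma integration_by_parts:
  assumes "\<phi> \<in> test_functions \<Omega>" "is_smooth g"
  shows "(LINT x|lborel. g x * (gradient \<phi> x \<bullet> b)) = - (LINT x|lborel. \<phi> x * (gradient g x \<bullet> b))"
proof -
  note s = test_functions_smooth[OF assms(1)]
  obtain K where K: "compact K" "K \<subseteq> \<Omega>" "\<And>x. x \<notin> K \<Longrightarrow> \<phi> x = 0"
    using test_functions_supportE[OF assms(1)] by blast
  note g0 = gradient_zero_outside[OF compact_imp_closed[OF K(1)] K(3)]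
  note cs = is_smooth_continuous[OF s] is_smooth_continuous_gradient[OF s]
    is_smooth_continuous[OF assms(2)] is_smooth_continuous_gradient[OF assms(2)]
  have "(LINT x|lborel. (\<phi> x *\<^sub>R gradient g x + g x *\<^sub>R gradient \<phi> x) \<bullet> b) = 0"
    by (rule integral_directional_derivative_eq_0[OF GDERIV_mult[OF is_smooth_GDERIV is_smooth_GDERIV] _ K(1)])
      (use s assms(2) K in \<open>auto intro!: continuous_intros cs\<close>)
  moreover have "integrable lborel (\<lambda>x. \<phi> x * (gradient g x \<bullet> b))"
    by (rule integrable_compact_support[of _ K]) (use s assms(2) K in \<open>auto intro!: continuous_intros cs\<close>)
  moreover have "integrable lborel (\<lambda>x. g x * (gradient \<phi> x \<bullet> b))"
    by (rule integrable_compact_support[of _ K]) (use s assms(2) K g0 in \<open>auto intro!: continuous_intros cs\<close>)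
  ultimately show ?thesis
    by (simp add: inner_add_left)
qed

section \<open>Weak gradients\<close>

definition box_bump :: "nat \<Rightarrow> 'a::euclidean_space \<Rightarrow> 'a \<Rightarrow> 'a \<Rightarrow> real" where
  "box_bump n a b x =
     (\<Prod>i\<in>Basis. flat (1 / Suc n) 0 (x \<bullet> i - a \<bullet> i) * flat (1 / Suc n) 0 (b \<bullet> i - x \<bullet> i))"

lemma is_smooth_box_bump: "is_smooth (box_bump n a b)"
  unfolding box_bump_def[abs_def]
  by (intro is_smooth_prod is_smooth_mult is_smooth_flat is_smooth_diff is_smooth_inner is_smooth_const) auto

lemma flat_0_bounds: "0 < a \<Longrightarrow> 0 \<le> flat a 0 t" "0 < a \<Longrightarrow> flat a 0 t \<le> 1"
  by (auto simp: flat_def)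

lemma box_bump_bounds: "0 \<le> box_bump n a b x" "box_bump n a b x \<le> 1"
  unfolding box_bump_def
  by (intro prod_nonneg prod_le_1 conjI ballI mult_nonneg_nonneg mult_le_one flat_0_bounds; simp)+

lemma box_bump_outside: "x \<notin> box a b \<Longrightarrow> box_bump n a b x = 0"
  by (auto simp: box_bump_def mem_box flat_def)

lemma box_bump_inside: "x \<in> box a b \<Longrightarrow> 0 < box_bump n a b x"
  unfolding box_bump_def mem_box by (intro prod_pos) (auto simp: flat_def)

lemma box_bump_tendsto: "(\<lambda>n. box_bump n a b x) \<longlonglongrightarrow> indicator (box a b) x"
proof (cases "x \<in> box a b")
  case True
  have "(\<lambda>n. flat (1 / Suc n) 0 t) \<longlonglongrightarrow> 1" if "t > 0" for t
  proof -
    have "(\<lambda>n. exp (- (1 / real (Suc n)) / t)) \<longlonglongrightarrow> exp (- 0 / t)"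
      using that by (intro tendsto_intros LIMSEQ_Suc[OF lim_1_over_n]) auto
    then show ?thesis
      using that by (simp add: flat_def)
  qed
  then have "(\<lambda>n. box_bump n a b x) \<longlonglongrightarrow> (\<Prod>i\<in>(Basis :: 'a set). 1 * 1)"
    unfolding box_bump_def using True by (intro tendsto_prod tendsto_mult) (auto simp: mem_box)
  then show ?thesis
    using True by simp
next
  case False
  then show ?thesis
    by (simp add: box_bump_outside)
qed

lemma box_bump_test: "cbox a b \<subseteq> \<Omega> \<Longrightarrow> box_bump n a b \<in> test_functions \<Omega>"
  by (rule test_functionsI[OF is_smooth_box_bump compact_cbox])
    (use box_subset_cbox in \<open>auto intro!: box_bump_outside\<close>)

text \<open>Isolates the end of a differentiation argument: averages \<open>I h\<close> that vanish
  for small \<open>h\<close> cannot come close to \<open>y \<noteq> 0\<close>.\<close>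

lemma vanishing_near_0_contradiction:
  fixes y :: "'a::real_normed_vector" and D :: real
  assumes "y \<noteq> 0" "0 < D" "\<And>h. h < D \<Longrightarrow> I h = 0"
    and "\<exists>d>0. \<forall>h. 0 < h \<and> h < d \<longrightarrow> norm (I h - y) < norm y"
  shows False
proof -
  obtain d where d: "d > 0" "\<And>h. 0 < h \<Longrightarrow> h < d \<Longrightarrow> norm (I h - y) < norm y"
    using assms(4) by auto
  define h where "h = min d D / 2"
  have "0 < h" "h < d" "h < D"
    using d(1) assms(2) by (auto simp: h_def)
  then show False
    using d(2)[of h] assms(1,3) by simp
qed

text \<open>The functions \<open>box_bump n a b\<close> stay in \<open>[0, 1]\<close> and converge
  to the indicator of a box, so \<open>g\<close> has integral \<open>0\<close> over every closed box
  inside \<open>\<Omega>\<close>; Lebesgue's differentiation theorem then gives \<open>g = 0\<close>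
  almost everywhere.\<close>

lemma AE_zero_if_orthogonal_to_test_functions:
  fixes g :: "'a::euclidean_space \<Rightarrow> 'b::euclidean_space"
  assumes "open \<Omega>" and g: "square_integrable (lebesgue_on \<Omega>) g"
    and zero: "\<And>\<phi>. \<phi> \<in> test_functions \<Omega> \<Longrightarrow> (LINT x|lebesgue_on \<Omega>. \<phi> x *\<^sub>R g x) = 0"
  shows "AE x in lebesgue_on \<Omega>. g x = 0"
proof -
  have \<Omega>: "\<Omega> \<in> sets lebesgue"
    using assms(1) by simp
  \<comment> \<open>Extension by zero, because the differentiation theorem is applied to a function
    on the whole space.\<close>
  define f where "f x = (if x \<in> \<Omega> then g x else 0)" for x
  have fm: "f \<in> borel_measurable lebesgue"
    unfolding f_def using g \<Omega> by (intro borel_measurable_if_I) (auto simp: square_integrable_def)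
  have "(\<lambda>x. (norm (f x))\<^sup>2) = (\<lambda>x. if x \<in> \<Omega> then (norm (g x))\<^sup>2 else 0)"
    by (auto simp: f_def)
  then have fi: "integrable lebesgue (\<lambda>x. (norm (f x))\<^sup>2)"
    using g \<Omega> by (simp add: square_integrable_def Lebesgue_Measure.integrable_restrict_UNIV)
  have fabs: "f absolutely_integrable_on cbox a b" for a b
    unfolding set_integrable_def
  proof (rule Bochner_Integration.integrable_bound)
    show "integrable lebesgue (\<lambda>x. indicator (cbox a b) x + (norm (f x))\<^sup>2)"
      by (intro Bochner_Integration.integrable_add fi integrable_real_indicator)
        (auto simp: emeasure_lborel_cbox_finite[unfolded infinity_ennreal_def])
    show "(\<lambda>x. indicator (cbox a b) x *\<^sub>R f x) \<in> borel_measurable lebesgue"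
      using fm by (intro borel_measurable_scaleR borel_measurable_indicator) auto
    have "n \<le> 1 + n\<^sup>2" if "0 \<le> n" for n :: real
      using sum_squares_bound[of 1 n] that by auto
    then show "AE x in lebesgue. norm (indicator (cbox a b) x *\<^sub>R f x) \<le> norm (indicator (cbox a b) x + (norm (f x))\<^sup>2)"
      by (auto simp: indicator_def)
  qed
  have int0: "integral (cbox a b) f = 0" if "cbox a b \<subseteq> \<Omega>" for a b
  proof -
    have "(\<lambda>n. LINT x|lebesgue. box_bump n a b x *\<^sub>R f x) \<longlonglongrightarrow> (LINT x|lebesgue. indicator (box a b) x *\<^sub>R f x)"
    proof (rule integral_dominated_convergence)
      show "(\<lambda>x. indicator (box a b) x *\<^sub>R f x) \<in> borel_measurable lebesgue"
        using fm by (intro borel_measurable_scaleR borel_measurable_indicator) auto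
      show "(\<lambda>x. box_bump n a b x *\<^sub>R f x) \<in> borel_measurable lebesgue" for n
      proof (intro borel_measurable_scaleR fm)
        show "box_bump n a b \<in> borel_measurable lebesgue"
          by (rule measurable_completion)
            (simp add: borel_measurable_continuous_onI is_smooth_continuous is_smooth_box_bump)
      qed
      show "integrable lebesgue (\<lambda>x. norm (indicator (cbox a b) x *\<^sub>R f x))"
        using fabs unfolding set_integrable_def by (rule integrable_norm)
      show "AE x in lebesgue. (\<lambda>n. box_bump n a b x *\<^sub>R f x) \<longlonglongrightarrow> indicator (box a b) x *\<^sub>R f x"
        by (intro AE_I2 tendsto_intros box_bump_tendsto)
      show "AE x in lebesgue. norm (box_bump n a b x *\<^sub>R f x) \<le> norm (indicator (cbox a b) x *\<^sub>R f x)" for n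
      proof (intro AE_I2)
        fix x
        show "norm (box_bump n a b x *\<^sub>R f x) \<le> norm (indicator (cbox a b) x *\<^sub>R f x)"
        proof (cases "x \<in> box a b")
          case True
          then show ?thesis
            using box_subset_cbox[of a b] box_bump_bounds[of n a b x] by (auto simp: mult_left_le_one_le)
        qed (simp add: box_bump_outside)
      qed
    qed
    moreover have "(LINT x|lebesgue. box_bump n a b x *\<^sub>R f x) = 0" for n
    proof -
      have "(\<lambda>x. box_bump n a b x *\<^sub>R f x) = (\<lambda>x. if x \<in> \<Omega> then box_bump n a b x *\<^sub>R g x else 0)"
        by (auto simp: f_def)
      then show ?thesis
        using zero[OF box_bump_test[OF that]] by (simp add: Lebesgue_Measure.integral_restrict_UNIV[OF \<Omega>])
    qed
    ultimately have "(LINT x:box a b|lebesgue. f x) = 0"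
      by (simp add: LIMSEQ_const_iff set_lebesgue_integral_def)
    moreover have "f absolutely_integrable_on box a b"
      by (rule set_integrable_subset[OF fabs]) (auto intro: box_subset_cbox[THEN subsetD])
    ultimately show ?thesis
      using set_lebesgue_integral_eq_integral(2) integral_open_interval by metis
  qed
  obtain N where N: "negligible N"
    "\<And>x e. \<lbrakk>x \<notin> N; 0 < e\<rbrakk> \<Longrightarrow>
       \<exists>d>0. \<forall>h. 0 < h \<and> h < d \<longrightarrow> norm (integral (cbox x (x + h *\<^sub>R One)) f /\<^sub>R h ^ DIM('a) - f x) < e"
  proof (rule integrable_ccontinuous_explicit[OF set_lebesgue_integral_eq_integral(1)[OF fabs]])
    fix N
    assume "negligible N" and *: "\<And>x e. \<lbrakk>x \<notin> N; 0 < e\<rbrakk> \<Longrightarrow>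
       \<exists>d>0. \<forall>h. 0 < h \<and> h < d \<longrightarrow> norm (integral (cbox x (x + h *\<^sub>R One)) f /\<^sub>R h ^ DIM('a) - f x) < e"
    then show thesis
      by (rule that)
  qed
  have "g x = 0" if "x \<notin> N" "x \<in> \<Omega>" for x
  proof (rule ccontr)
    assume "g x \<noteq> 0"
    then have "f x \<noteq> 0"
      using that by (simp add: f_def)
    obtain c e where ce: "cbox c e \<subseteq> \<Omega>" "x \<in> box c e"
      using open_contains_cbox[OF \<open>open \<Omega>\<close> \<open>x \<in> \<Omega>\<close>] by metis
    \<comment> \<open>A cube with lower corner \<open>x\<close> and side below \<open>D\<close>
      stays inside \<open>cbox c e\<close>, hence inside \<open>\<Omega>\<close>.\<close>
    define D where "D = Min ((\<lambda>i. e \<bullet> i - x \<bullet> i) ` Basis)"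
    have D: "0 < D" "\<And>i. i \<in> Basis \<Longrightarrow> D \<le> e \<bullet> i - x \<bullet> i"
      using ce(2) by (auto simp: D_def mem_box)
    have sub: "cbox x (x + h *\<^sub>R One) \<subseteq> cbox c e" if "h < D" for h
    proof
      fix y assume y: "y \<in> cbox x (x + h *\<^sub>R One)"
      show "y \<in> cbox c e"
        unfolding mem_box
      proof
        fix i :: 'a assume i: "i \<in> Basis"
        have "x \<bullet> i \<le> y \<bullet> i \<and> y \<bullet> i \<le> x \<bullet> i + h" "c \<bullet> i < x \<bullet> i \<and> x \<bullet> i < e \<bullet> i"
          using y ce(2) i by (simp_all add: mem_box inner_add_left)
        then show "c \<bullet> i \<le> y \<bullet> i \<and> y \<bullet> i \<le> e \<bullet> i"
          using D(2)[OF i] that by linarith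
      qed
    qed
    have zero: "integral (cbox x (x + h *\<^sub>R One)) f /\<^sub>R h ^ DIM('a) = 0" if "h < D" for h
      using int0[OF order_trans[OF sub[OF that] ce(1)]] by simp
    have "0 < norm (f x)"
      using \<open>f x \<noteq> 0\<close> by simp
    from vanishing_near_0_contradiction[OF \<open>f x \<noteq> 0\<close> D(1) zero N(2)[OF \<open>x \<notin> N\<close> this]] show False
      by simp
  qed
  then have "{x \<in> \<Omega>. g x \<noteq> 0} \<subseteq> N"
    by blast
  then have "AE x in lebesgue. x \<in> \<Omega> \<longrightarrow> g x = 0"
    using N(1) by (intro AE_I'[of N]) (auto simp: negligible_iff_null_sets)
  then show ?thesis
    using assms(1) by (subst AE_restrict_space_iff) auto
qed

lemma square_integrable_scaleR_fun:
  fixes u :: "'a \<Rightarrow> real" and h :: "'a \<Rightarrow> 'b::euclidean_space"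
  assumes "square_integrable M u" "square_integrable M h"
  shows "integrable M (\<lambda>x. u x *\<^sub>R h x)"
proof (rule Bochner_Integration.integrable_bound)
  show "integrable M (\<lambda>x. norm (u x) \<bullet> norm (h x))"
    by (intro square_integrable_inner square_integrable_norm assms)
  show "(\<lambda>x. u x *\<^sub>R h x) \<in> borel_measurable M"
    using assms by (auto simp: square_integrable_def)
qed (simp add: abs_mult)

lemma integral_test_scaleR_inner:
  fixes h :: "'a \<Rightarrow> 'b::euclidean_space"
  assumes "square_integrable M \<phi>" "square_integrable M h"
  shows "(LINT x|M. \<phi> x *\<^sub>R h x) \<bullet> b = (LINT x|M. \<phi> x * (h x \<bullet> b))"
  using integral_inner_left[of b M "\<lambda>x. \<phi> x *\<^sub>R h x", symmetric]
    square_integrable_scaleR_fun[OF assms] by simp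

lemma is_weak_gradient_diff:
  assumes "open \<Omega>"
    and "square_integrable (lebesgue_on \<Omega>) u" "square_integrable (lebesgue_on \<Omega>) g" "is_weak_gradient \<Omega> u g"
    and "square_integrable (lebesgue_on \<Omega>) u'" "square_integrable (lebesgue_on \<Omega>) g'" "is_weak_gradient \<Omega> u' g'"
  shows "is_weak_gradient \<Omega> (\<lambda>x. u x - u' x) (\<lambda>x. g x - g' x)"
  unfolding is_weak_gradient_def
proof
  fix \<phi> assume \<phi>: "\<phi> \<in> test_functions \<Omega>"
  note t = test_functions_square_integrable[OF \<phi> \<open>open \<Omega>\<close>]
  show "(LINT x|lebesgue_on \<Omega>. (u x - u' x) *\<^sub>R gradient \<phi> x) = - (LINT x|lebesgue_on \<Omega>. \<phi> x *\<^sub>R (g x - g' x))"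
    using assms(4,7) \<phi> assms(2,3,5,6) t
    by (simp add: is_weak_gradient_def scaleR_diff_left scaleR_diff_right square_integrable_scaleR_fun)
qed

text \<open>This makes the choice by \<open>SOME\<close> in \<open>weak_gradient\<close> harmless:
  on an open set every square integrable weak gradient agrees with the chosen one almost
  everywhere.\<close>

lemma is_weak_gradient_unique:
  assumes "open \<Omega>" "square_integrable (lebesgue_on \<Omega>) u"
    and "square_integrable (lebesgue_on \<Omega>) g" "is_weak_gradient \<Omega> u g"
    and "square_integrable (lebesgue_on \<Omega>) g'" "is_weak_gradient \<Omega> u g'"
  shows "AE x in lebesgue_on \<Omega>. g x = g' x"
proof -
  have "AE x in lebesgue_on \<Omega>. g x - g' x = 0"
  proof (rule AE_zero_if_orthogonal_to_test_functions[OF \<open>open \<Omega>\<close>])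
    show "square_integrable (lebesgue_on \<Omega>) (\<lambda>x. g x - g' x)"
      using assms square_integrable_diff by blast
    show "(LINT x|lebesgue_on \<Omega>. \<phi> x *\<^sub>R (g x - g' x)) = 0" if "\<phi> \<in> test_functions \<Omega>" for \<phi>
      using is_weak_gradient_diff[OF assms(1-4,2,5,6)] that by (simp add: is_weak_gradient_def)
  qed
  then show ?thesis by simp
qed

lemma weak_gradient_props:
  assumes "u \<in> H1 \<Omega>"
  shows "square_integrable (lebesgue_on \<Omega>) u" "square_integrable (lebesgue_on \<Omega>) (weak_gradient \<Omega> u)"
    "is_weak_gradient \<Omega> u (weak_gradient \<Omega> u)"
proof -
  have ex: "\<exists>g. g square_integrable_on \<Omega> \<and> is_weak_gradient \<Omega> u g"
    and "u square_integrable_on \<Omega>"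
    using assms unfolding H1_def by auto
  from someI_ex[OF ex] this(2) show "square_integrable (lebesgue_on \<Omega>) u"
    "square_integrable (lebesgue_on \<Omega>) (weak_gradient \<Omega> u)"
    "is_weak_gradient \<Omega> u (weak_gradient \<Omega> u)"
    unfolding weak_gradient_def square_integrable_on_iff by auto
qed

lemma weak_gradient_eq:
  assumes "open \<Omega>" "square_integrable (lebesgue_on \<Omega>) u"
    "square_integrable (lebesgue_on \<Omega>) g" "is_weak_gradient \<Omega> u g"
  shows "u \<in> H1 \<Omega>" "AE x in lebesgue_on \<Omega>. weak_gradient \<Omega> u x = g x"
proof -
  show H: "u \<in> H1 \<Omega>"
    using assms unfolding H1_def square_integrable_on_iff by blast
  show "AE x in lebesgue_on \<Omega>. weak_gradient \<Omega> u x = g x"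
    by (rule is_weak_gradient_unique[OF assms(1,2) weak_gradient_props(2,3)[OF H] assms(3,4)])
qed

section \<open>Weak gradients of test functions and approximation in \<open>H10\<close>\<close>

lemma is_weak_gradient_test:
  assumes "open \<Omega>" "u \<in> test_functions \<Omega>"
  shows "is_weak_gradient \<Omega> u (gradient u)"
  unfolding is_weak_gradient_def
proof
  fix \<phi> assume \<phi>: "\<phi> \<in> test_functions \<Omega>"
  note t = test_functions_square_integrable[OF \<phi> assms(1)]
    and t' = test_functions_square_integrable[OF assms(2,1)]
    and s = test_functions_smooth[OF \<phi>] and s' = test_functions_smooth[OF assms(2)]
  note c = is_smooth_continuous[OF s] is_smooth_continuous_gradient[OF s]
    is_smooth_continuous[OF s'] is_smooth_continuous_gradient[OF s']
  show "(LINT x|lebesgue_on \<Omega>. u x *\<^sub>R gradient \<phi> x) = - (LINT x|lebesgue_on \<Omega>. \<phi> x *\<^sub>R gradient u x)"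
  proof (rule euclidean_eqI)
    fix b :: 'a
    have "(LINT x|lebesgue_on \<Omega>. u x * (gradient \<phi> x \<bullet> b)) = (LINT x|lborel. u x * (gradient \<phi> x \<bullet> b))"
      by (rule integral_lebesgue_on_eq_lborel)
        (use assms c test_functions_zero in \<open>auto intro!: continuous_intros\<close>)
    moreover have "(LINT x|lebesgue_on \<Omega>. \<phi> x * (gradient u x \<bullet> b)) = (LINT x|lborel. \<phi> x * (gradient u x \<bullet> b))"
      by (rule integral_lebesgue_on_eq_lborel)
        (use assms c test_functions_zero[OF \<phi>] in \<open>auto intro!: continuous_intros\<close>)
    ultimately show "(LINT x|lebesgue_on \<Omega>. u x *\<^sub>R gradient \<phi> x) \<bullet> b = (- (LINT x|lebesgue_on \<Omega>. \<phi> x *\<^sub>R gradient u x)) \<bullet> b"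
      using integration_by_parts[OF \<phi> s', of b] t t' by (simp add: integral_test_scaleR_inner)
  qed
qed

lemma weak_gradient_test:
  assumes "open \<Omega>" "\<phi> \<in> test_functions \<Omega>"
  shows "\<phi> \<in> H1 \<Omega>" "AE x in lebesgue_on \<Omega>. weak_gradient \<Omega> \<phi> x = gradient \<phi> x"
  using weak_gradient_eq[OF assms(1) test_functions_square_integrable[OF assms(2,1)] is_weak_gradient_test[OF assms]]
  by auto

text \<open>\<open>H1_norm\<close> takes the chosen weak gradient of the difference; uniqueness
  replaces it by the difference of the two gradients.\<close>

lemma H1_diff_test:
  assumes "open \<Omega>" "u \<in> H1 \<Omega>" "\<phi> \<in> test_functions \<Omega>"
  shows "(H1_norm \<Omega> (\<lambda>x. u x - \<phi> x))\<^sup>2 =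
    (L2_seminorm (lebesgue_on \<Omega>) (\<lambda>x. u x - \<phi> x))\<^sup>2 +
    (L2_seminorm (lebesgue_on \<Omega>) (\<lambda>x. weak_gradient \<Omega> u x - gradient \<phi> x))\<^sup>2"
proof -
  note u = weak_gradient_props[OF assms(2)]
    and t = test_functions_square_integrable[OF assms(3,1)] is_weak_gradient_test[OF assms(1,3)]
  let ?v = "\<lambda>x. u x - \<phi> x" and ?g = "\<lambda>x. weak_gradient \<Omega> u x - gradient \<phi> x"
  have v: "square_integrable (lebesgue_on \<Omega>) ?v" "square_integrable (lebesgue_on \<Omega>) ?g" "is_weak_gradient \<Omega> ?v ?g"
    using u t square_integrable_diff is_weak_gradient_diff[OF assms(1) u t] by blast+
  note w = weak_gradient_eq[OF assms(1) v]
  have "L2_seminorm (lebesgue_on \<Omega>) (weak_gradient \<Omega> ?v) = L2_seminorm (lebesgue_on \<Omega>) ?g"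
    using w(2) weak_gradient_props(2)[OF w(1)] v(2)
    by (intro L2_seminorm_cong_AE) (auto simp: square_integrable_def)
  moreover have "(H1_norm \<Omega> ?v)\<^sup>2 = (L2_seminorm (lebesgue_on \<Omega>) ?v)\<^sup>2 + (L2_seminorm (lebesgue_on \<Omega>) (weak_gradient \<Omega> ?v))\<^sup>2"
    unfolding H1_norm_def L2_seminorm_power2 by (simp add: add_nonneg_nonneg integral_nonneg_AE)
  ultimately show ?thesis by simp
qed

lemma H10_approximation:
  assumes "open \<Omega>" "u \<in> H10 \<Omega>" "\<epsilon> > 0"
  obtains \<phi> where "\<phi> \<in> test_functions \<Omega>" "L2_seminorm (lebesgue_on \<Omega>) (\<lambda>x. \<phi> x - u x) < \<epsilon>"
    "L2_seminorm (lebesgue_on \<Omega>) (\<lambda>x. gradient \<phi> x - weak_gradient \<Omega> u x) < \<epsilon>"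
proof -
  have H: "u \<in> H1 \<Omega>"
    using assms(2) by (simp add: H10_def)
  obtain \<phi> where \<phi>: "\<phi> \<in> test_functions \<Omega>" "H1_norm \<Omega> (\<lambda>x. u x - \<phi> x) < \<epsilon>"
    using assms(2,3) unfolding H10_def by blast
  have "0 \<le> H1_norm \<Omega> (\<lambda>x. u x - \<phi> x)"
    by (simp add: H1_norm_def add_nonneg_nonneg integral_nonneg_AE)
  then have lt: "(H1_norm \<Omega> (\<lambda>x. u x - \<phi> x))\<^sup>2 < \<epsilon>\<^sup>2"
    using \<phi>(2) by (intro power_strict_mono) auto
  have "(L2_seminorm (lebesgue_on \<Omega>) (\<lambda>x. u x - \<phi> x))\<^sup>2 < \<epsilon>\<^sup>2"
    "(L2_seminorm (lebesgue_on \<Omega>) (\<lambda>x. weak_gradient \<Omega> u x - gradient \<phi> x))\<^sup>2 < \<epsilon>\<^sup>2"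
    using lt unfolding H1_diff_test[OF assms(1) H \<phi>(1)]
    by (smt (verit) zero_le_power2)+
  then have "L2_seminorm (lebesgue_on \<Omega>) (\<lambda>x. u x - \<phi> x) < \<epsilon>"
    "L2_seminorm (lebesgue_on \<Omega>) (\<lambda>x. weak_gradient \<Omega> u x - gradient \<phi> x) < \<epsilon>"
    using assms(3) by (auto intro: power_less_imp_less_base)
  then show ?thesis
    by (intro that[OF \<phi>(1)])
      (simp_all add: L2_seminorm_minus_commute[of _ \<phi>] L2_seminorm_minus_commute[of _ "gradient \<phi>"])
qed

lemma H10_sequence:
  assumes "open \<Omega>" "u \<in> H10 \<Omega>"
  obtains \<phi> :: "nat \<Rightarrow> 'a::euclidean_space \<Rightarrow> real" where "\<And>n. \<phi> n \<in> test_functions \<Omega>"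
    "(\<lambda>n. L2_seminorm (lebesgue_on \<Omega>) (\<lambda>x. \<phi> n x - u x)) \<longlonglongrightarrow> 0"
    "(\<lambda>n. L2_seminorm (lebesgue_on \<Omega>) (\<lambda>x. gradient (\<phi> n) x - weak_gradient \<Omega> u x)) \<longlonglongrightarrow> 0"
proof -
  have "\<exists>\<phi>. \<phi> \<in> test_functions \<Omega> \<and> L2_seminorm (lebesgue_on \<Omega>) (\<lambda>x. \<phi> x - u x) < 1 / Suc n
    \<and> L2_seminorm (lebesgue_on \<Omega>) (\<lambda>x. gradient \<phi> x - weak_gradient \<Omega> u x) < 1 / Suc n" for n
    by (rule H10_approximation[OF assms, of "1 / Suc n"]) auto
  then obtain \<phi> where \<phi>: "\<And>n. \<phi> n \<in> test_functions \<Omega>"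
    "\<And>n. L2_seminorm (lebesgue_on \<Omega>) (\<lambda>x. \<phi> n x - u x) < 1 / Suc n"
    "\<And>n. L2_seminorm (lebesgue_on \<Omega>) (\<lambda>x. gradient (\<phi> n) x - weak_gradient \<Omega> u x) < 1 / Suc n"
    by metis
  note sq = tendsto_sandwich[OF always_eventually always_eventually tendsto_const LIMSEQ_Suc[OF lim_1_over_n]]
  show ?thesis
    by (rule that[OF \<phi>(1)]; rule sq) (use \<phi> L2_seminorm_nonneg in \<open>auto intro: less_imp_le\<close>)
qed

lemma L2_inner_tendsto:
  assumes f: "\<And>n. square_integrable M (f n)" "square_integrable M g"
    and lim: "(\<lambda>n. L2_seminorm M (\<lambda>x. f n x - g x)) \<longlonglongrightarrow> 0" and h: "square_integrable M h"
  shows "(\<lambda>n. LINT x|M. f n x \<bullet> h x) \<longlonglongrightarrow> (LINT x|M. g x \<bullet> h x)"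
proof -
  have "norm ((LINT x|M. f n x \<bullet> h x) - (LINT x|M. g x \<bullet> h x)) \<le> L2_seminorm M (\<lambda>x. f n x - g x) * L2_seminorm M h" for n
    using L2_Cauchy_Schwarz[OF square_integrable_diff[OF f(1,2)] h]
      square_integrable_inner[OF f(1) h] square_integrable_inner[OF f(2) h]
    by (simp add: inner_diff_left)
  moreover have "(\<lambda>n. L2_seminorm M (\<lambda>x. f n x - g x) * L2_seminorm M h) \<longlonglongrightarrow> 0"
    using tendsto_mult_right[OF lim] by simp
  ultimately have "(\<lambda>n. (LINT x|M. f n x \<bullet> h x) - (LINT x|M. g x \<bullet> h x)) \<longlonglongrightarrow> 0"
    by (rule Lim_null_comparison[OF always_eventually[OF allI]])
  then show ?thesis
    by (simp add: LIM_zero_iff)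
qed

lemma L2_seminorm_tendsto:
  assumes f: "\<And>n. square_integrable M (f n)" "square_integrable M g"
    and lim: "(\<lambda>n. L2_seminorm M (\<lambda>x. f n x - g x)) \<longlonglongrightarrow> 0"
  shows "(\<lambda>n. L2_seminorm M (f n)) \<longlonglongrightarrow> L2_seminorm M g"
proof -
  have "norm (L2_seminorm M (f n) - L2_seminorm M g) \<le> L2_seminorm M (\<lambda>x. f n x - g x)" for n
    using L2_triangle_le[OF f(1)[of n] f(2)] L2_triangle_le[OF f(2) f(1)[of n]]
    by (simp add: L2_seminorm_minus_commute[of M g])
  then have "(\<lambda>n. L2_seminorm M (f n) - L2_seminorm M g) \<longlonglongrightarrow> 0"
    by (rule Lim_null_comparison[OF always_eventually[OF allI] lim])
  then show ?thesis
    by (simp add: LIM_zero_iff)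
qed

text \<open>Both sides of the identity that defines a weak gradient are continuous under
  \<open>L^2\<close> convergence, so the limit of the gradients is a weak gradient of the
  limit.\<close>

lemma H10_I:
  fixes \<phi> :: "nat \<Rightarrow> 'a::euclidean_space \<Rightarrow> real"
  assumes "open \<Omega>" "\<And>n. \<phi> n \<in> test_functions \<Omega>"
    and u: "square_integrable (lebesgue_on \<Omega>) u" and g: "square_integrable (lebesgue_on \<Omega>) g"
    and limu: "(\<lambda>n. L2_seminorm (lebesgue_on \<Omega>) (\<lambda>x. \<phi> n x - u x)) \<longlonglongrightarrow> 0"
    and limg: "(\<lambda>n. L2_seminorm (lebesgue_on \<Omega>) (\<lambda>x. gradient (\<phi> n) x - g x)) \<longlonglongrightarrow> 0"
  shows "u \<in> H10 \<Omega>" "AE x in lebesgue_on \<Omega>. weak_gradient \<Omega> u x = g x"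
proof -
  let ?M = "lebesgue_on \<Omega>"
  note t = test_functions_square_integrable[OF assms(2,1)]
  have weak: "is_weak_gradient \<Omega> u g"
    unfolding is_weak_gradient_def
  proof
    fix \<psi> assume \<psi>: "\<psi> \<in> test_functions \<Omega>"
    note p = test_functions_square_integrable[OF \<psi> assms(1)]
    show "(LINT x|?M. u x *\<^sub>R gradient \<psi> x) = - (LINT x|?M. \<psi> x *\<^sub>R g x)"
    proof (rule euclidean_eqI)
      \<comment> \<open>The vector identity is tested coordinatewise, since
        \<open>L2_inner_tendsto\<close> speaks of integrals of inner products.\<close>
      fix b :: 'a assume b: "b \<in> Basis"
      have pb: "square_integrable ?M (\<lambda>x. gradient \<psi> x \<bullet> b)"
        by (rule test_functions_square_integrable(1)[OF test_functions_gradient_inner[OF \<psi> b] assms(1)])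
      have pb': "square_integrable ?M (\<lambda>x. \<psi> x *\<^sub>R b)"
        using p(1) b unfolding square_integrable_def
        by (auto intro!: borel_measurable_scaleR)
      have 1: "(\<lambda>n. LINT x|?M. \<phi> n x * (gradient \<psi> x \<bullet> b)) \<longlonglongrightarrow> (LINT x|?M. u x * (gradient \<psi> x \<bullet> b))"
        using L2_inner_tendsto[OF t(1) u limu pb] by simp
      have 2: "(\<lambda>n. LINT x|?M. \<psi> x * (gradient (\<phi> n) x \<bullet> b)) \<longlonglongrightarrow> (LINT x|?M. \<psi> x * (g x \<bullet> b))"
        using L2_inner_tendsto[OF t(2) g limg pb'] by simp
      have eq: "(LINT x|?M. \<phi> n x * (gradient \<psi> x \<bullet> b)) = - (LINT x|?M. \<psi> x * (gradient (\<phi> n) x \<bullet> b))" for n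
        using is_weak_gradient_test[OF assms(1,2), of n, unfolded is_weak_gradient_def, rule_format, OF \<psi>]
          integral_test_scaleR_inner[OF t(1)[of n] p(2), of b] integral_test_scaleR_inner[OF p(1) t(2)[of n], of b]
        by simp
      have "(LINT x|?M. u x * (gradient \<psi> x \<bullet> b)) = - (LINT x|?M. \<psi> x * (g x \<bullet> b))"
        using LIMSEQ_unique[OF 1[unfolded eq] tendsto_minus[OF 2]] .
      then show "(LINT x|?M. u x *\<^sub>R gradient \<psi> x) \<bullet> b = (- (LINT x|?M. \<psi> x *\<^sub>R g x)) \<bullet> b"
        using u p g by (simp add: integral_test_scaleR_inner)
    qed
  qed
  note w = weak_gradient_eq[OF assms(1) u g weak]
  show "AE x in ?M. weak_gradient \<Omega> u x = g x"
    by (rule w(2))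
  have sm: "L2_seminorm ?M (\<lambda>x. weak_gradient \<Omega> u x - gradient (\<phi> n) x) = L2_seminorm ?M (\<lambda>x. gradient (\<phi> n) x - g x)" for n
    unfolding L2_seminorm_minus_commute[of _ "gradient (\<phi> n)"]
    using w(2) weak_gradient_props(2)[OF w(1)] g t(2)[of n]
    by (intro L2_seminorm_cong_AE) (auto simp: square_integrable_def)
  have "\<exists>\<psi>\<in>test_functions \<Omega>. H1_norm \<Omega> (\<lambda>x. u x - \<psi> x) < \<epsilon>" if "\<epsilon> > 0" for \<epsilon>
  proof -
    have "(\<lambda>n. (L2_seminorm ?M (\<lambda>x. \<phi> n x - u x))\<^sup>2 + (L2_seminorm ?M (\<lambda>x. gradient (\<phi> n) x - g x))\<^sup>2) \<longlonglongrightarrow> 0\<^sup>2 + 0\<^sup>2"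
      by (intro tendsto_intros limu limg)
    then have "\<forall>\<^sub>F n in sequentially. (L2_seminorm ?M (\<lambda>x. \<phi> n x - u x))\<^sup>2 + (L2_seminorm ?M (\<lambda>x. gradient (\<phi> n) x - g x))\<^sup>2 < \<epsilon>\<^sup>2"
      using that by (intro order_tendstoD(2)) auto
    then obtain n where "(L2_seminorm ?M (\<lambda>x. \<phi> n x - u x))\<^sup>2 + (L2_seminorm ?M (\<lambda>x. gradient (\<phi> n) x - g x))\<^sup>2 < \<epsilon>\<^sup>2"
      using eventually_happens'[OF sequentially_bot] by blast
    then have "(H1_norm \<Omega> (\<lambda>x. u x - \<phi> n x))\<^sup>2 < \<epsilon>\<^sup>2"
      unfolding H1_diff_test[OF assms(1) w(1) assms(2)] sm by (simp add: L2_seminorm_minus_commute)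
    then have "H1_norm \<Omega> (\<lambda>x. u x - \<phi> n x) < \<epsilon>"
      using that by (auto intro: power_less_imp_less_base)
    then show ?thesis
      using assms(2) by blast
  qed
  then show "u \<in> H10 \<Omega>"
    using w(1) unfolding H10_def by blast
qed

lemma test_functions_H10:
  assumes "open \<Omega>" "\<phi> \<in> test_functions \<Omega>"
  shows "\<phi> \<in> H10 \<Omega>"
  by (rule H10_I(1)[OF assms(1), where \<phi>="\<lambda>n. \<phi>" and g="gradient \<phi>"])
    (use assms test_functions_square_integrable in \<open>auto simp: L2_seminorm_def\<close>)

section \<open>Bottom of the spectrum\<close>

lemma L2_seminorm_eq_0_iff:
  assumes "square_integrable M f"
  shows "L2_seminorm M f = 0 \<longleftrightarrow> (AE x in M. f x = 0)"
  using assms integral_nonneg_eq_0_iff_AE[of M "\<lambda>x. (norm (f x))\<^sup>2"]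
  by (simp add: L2_seminorm_def square_integrable_def)

lemma L2_seminorm_test:
  assumes "open \<Omega>" "\<phi> \<in> test_functions \<Omega>"
  shows "L2_seminorm (lebesgue_on \<Omega>) \<phi> = L2_seminorm lborel \<phi>"
    "L2_seminorm (lebesgue_on \<Omega>) (gradient \<phi>) = L2_seminorm lborel (gradient \<phi>)"
proof -
  note s = test_functions_smooth[OF assms(2)]
  note c = is_smooth_continuous[OF s] is_smooth_continuous_gradient[OF s]
  show "L2_seminorm (lebesgue_on \<Omega>) \<phi> = L2_seminorm lborel \<phi>"
    unfolding L2_seminorm_def
    by (subst integral_lebesgue_on_eq_lborel)
      (use assms c test_functions_zero[OF assms(2)] in \<open>auto intro!: continuous_intros\<close>)
  show "L2_seminorm (lebesgue_on \<Omega>) (gradient \<phi>) = L2_seminorm lborel (gradient \<phi>)"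
    unfolding L2_seminorm_def
    by (subst integral_lebesgue_on_eq_lborel)
      (use assms c test_functions_gradient_zero[OF assms(2)] in \<open>auto intro!: continuous_intros\<close>)
qed

text \<open>With the norms taken over \<open>lborel\<close> this is a Poincare inequality that every
  open subset of \<open>\<Omega>\<close> inherits with the same constant.\<close>

lemma dirichlet_bottom_le:
  assumes "open \<Omega>" "\<phi> \<in> test_functions \<Omega>"
  shows "dirichlet_bottom \<Omega> * (L2_seminorm lborel \<phi>)\<^sup>2 \<le> (L2_seminorm lborel (gradient \<phi>))\<^sup>2"
proof (cases "AE x in lebesgue_on \<Omega>. \<phi> x = 0")
  case True
  then have "L2_seminorm (lebesgue_on \<Omega>) \<phi> = 0"
    using L2_seminorm_eq_0_iff test_functions_square_integrable assms by blast
  then show ?thesis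
    by (simp flip: L2_seminorm_test[OF assms])
next
  case False
  let ?Q = "\<lambda>u. (LINT x|lebesgue_on \<Omega>. (norm (weak_gradient \<Omega> u x))\<^sup>2) / (LINT x|lebesgue_on \<Omega>. (u x)\<^sup>2)"
  note sq = test_functions_square_integrable[OF assms(2,1)]
  have pos: "L2_seminorm (lebesgue_on \<Omega>) \<phi> > 0"
    using False L2_seminorm_eq_0_iff[OF sq(1)] L2_seminorm_nonneg[of "lebesgue_on \<Omega>" \<phi>] by linarith
  have "dirichlet_bottom \<Omega> \<le> ?Q \<phi>"
    unfolding dirichlet_bottom_def
  proof (rule cINF_lower)
    show "bdd_below (?Q ` {u \<in> H10 \<Omega>. \<not> (AE x in lebesgue_on \<Omega>. u x = 0)})"
      by (rule bdd_belowI2[of _ 0]) (auto intro!: divide_nonneg_nonneg integral_nonneg_AE)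
    show "\<phi> \<in> {u \<in> H10 \<Omega>. \<not> (AE x in lebesgue_on \<Omega>. u x = 0)}"
      using False test_functions_H10[OF assms] by simp
  qed
  also have "\<dots> = (L2_seminorm (lebesgue_on \<Omega>) (weak_gradient \<Omega> \<phi>))\<^sup>2 / (L2_seminorm (lebesgue_on \<Omega>) \<phi>)\<^sup>2"
    by (simp add: L2_seminorm_power2)
  also have "L2_seminorm (lebesgue_on \<Omega>) (weak_gradient \<Omega> \<phi>) = L2_seminorm (lebesgue_on \<Omega>) (gradient \<phi>)"
    using weak_gradient_test[OF assms] weak_gradient_props(2) sq(2)
    by (intro L2_seminorm_cong_AE) (auto simp: square_integrable_def)
  finally show ?thesis
    using pos unfolding L2_seminorm_test[OF assms] by (simp add: pos_le_divide_eq)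
qed

text \<open>Test functions are dense in \<open>H10\<close>, so a bound on their quotients passes to
  all of it. A real infimum can be bounded from below in this way only over a nonempty set; a bump
  in a small box provides a member.\<close>

lemma dirichlet_bottom_ge:
  assumes "open \<Omega>" "\<Omega> \<noteq> {}" "0 \<le> \<mu>"
    and le: "\<And>\<phi>. \<phi> \<in> test_functions \<Omega> \<Longrightarrow> \<mu> * (L2_seminorm lborel \<phi>)\<^sup>2 \<le> (L2_seminorm lborel (gradient \<phi>))\<^sup>2"
  shows "\<mu> \<le> dirichlet_bottom \<Omega>"
  unfolding dirichlet_bottom_def
proof (rule cINF_greatest)
  let ?M = "lebesgue_on \<Omega>"
  obtain x where "x \<in> \<Omega>"
    using assms(2) by blast
  then obtain a b where ab: "cbox a b \<subseteq> \<Omega>" "x \<in> box a b"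
    using open_contains_cbox[OF assms(1)] by metis
  note t = box_bump_test[OF ab(1), of 0]
  have "\<not> (AE x in ?M. box_bump 0 a b x = 0)"
  proof
    assume "AE x in ?M. box_bump 0 a b x = 0"
    then have "AE x in lebesgue. x \<notin> box a b"
      using assms(1) box_bump_inside[of _ a b 0] box_subset_cbox[of a b] ab(1)
      by (subst (asm) AE_restrict_space_iff) (force elim: eventually_mono)+
    then have "box a b \<in> null_sets lebesgue"
      by (subst (asm) AE_iff_null_sets[symmetric]) auto
    then show False
      using ab(2) open_box[of a b] by (metis empty_iff negligible_iff_null_sets open_not_negligible)
  qed
  then show "{u \<in> H10 \<Omega>. \<not> (AE x in ?M. u x = 0)} \<noteq> {}"
    using test_functions_H10[OF assms(1) t] by blast
next
  let ?M = "lebesgue_on \<Omega>"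
  fix u assume u: "u \<in> {u \<in> H10 \<Omega>. \<not> (AE x in ?M. u x = 0)}"
  then have uH: "u \<in> H10 \<Omega>" and "u \<in> H1 \<Omega>"
    by (simp_all add: H10_def)
  note sq = weak_gradient_props[OF this(2)]
  obtain \<phi> where \<phi>: "\<And>n. \<phi> n \<in> test_functions \<Omega>"
    "(\<lambda>n. L2_seminorm ?M (\<lambda>x. \<phi> n x - u x)) \<longlonglongrightarrow> 0"
    "(\<lambda>n. L2_seminorm ?M (\<lambda>x. gradient (\<phi> n) x - weak_gradient \<Omega> u x)) \<longlonglongrightarrow> 0"
    by (rule H10_sequence[OF assms(1) uH]) (rule that)
  note tsq = test_functions_square_integrable[OF \<phi>(1) assms(1)]
  have "\<mu> * (L2_seminorm ?M u)\<^sup>2 \<le> (L2_seminorm ?M (weak_gradient \<Omega> u))\<^sup>2"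
  proof (rule LIMSEQ_le)
    show "(\<lambda>n. \<mu> * (L2_seminorm ?M (\<phi> n))\<^sup>2) \<longlonglongrightarrow> \<mu> * (L2_seminorm ?M u)\<^sup>2"
      by (intro tendsto_intros L2_seminorm_tendsto tsq sq \<phi>)
    show "(\<lambda>n. (L2_seminorm ?M (gradient (\<phi> n)))\<^sup>2) \<longlonglongrightarrow> (L2_seminorm ?M (weak_gradient \<Omega> u))\<^sup>2"
      by (intro tendsto_intros L2_seminorm_tendsto tsq sq \<phi>)
    show "\<exists>N. \<forall>n\<ge>N. \<mu> * (L2_seminorm ?M (\<phi> n))\<^sup>2 \<le> (L2_seminorm ?M (gradient (\<phi> n)))\<^sup>2"
      using le[OF \<phi>(1)] by (simp add: L2_seminorm_test[OF assms(1) \<phi>(1)])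
  qed
  moreover have "L2_seminorm ?M u > 0"
    using u L2_seminorm_eq_0_iff[OF sq(1)] L2_seminorm_nonneg[of ?M u] by (auto simp: less_le)
  ultimately have "\<mu> \<le> (L2_seminorm ?M (weak_gradient \<Omega> u))\<^sup>2 / (L2_seminorm ?M u)\<^sup>2"
    by (simp add: pos_le_divide_eq)
  then show "\<mu> \<le> (LINT x|?M. (norm (weak_gradient \<Omega> u x))\<^sup>2) / (LINT x|?M. (u x)\<^sup>2)"
    by (simp add: L2_seminorm_power2)
qed

section \<open>Torsion functions of bounded open sets\<close>

text \<open>The functional minimised by the solution of \<open>- \<Delta> w = 1\<close>. Its
  integrals extend over the whole space, so the energy of a test function does not depend on the
  domain; this allows functions on nested domains to be compared.\<close>

definition torsion_energy :: "('a::euclidean_space \<Rightarrow> real) \<Rightarrow> real" where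
  "torsion_energy \<phi> = (L2_seminorm lborel (gradient \<phi>))\<^sup>2 / 2 - (LINT x|lborel. \<phi> x)"

lemma test_functions_square_integrable_lborel:
  assumes "\<phi> \<in> test_functions \<Omega>"
  shows "square_integrable lborel \<phi>" "square_integrable lborel (gradient \<phi>)" "integrable lborel \<phi>"
proof -
  obtain K where K: "compact K" "\<And>x. x \<notin> K \<Longrightarrow> \<phi> x = 0"
    using test_functions_supportE[OF assms] by metis
  note s = test_functions_smooth[OF assms]
  note c = is_smooth_continuous[OF s] is_smooth_continuous_gradient[OF s]
  note g0 = gradient_zero_outside[OF compact_imp_closed[OF K(1)] K(2)]
  have "integrable lborel (\<lambda>x. (norm (\<phi> x))\<^sup>2)"
    by (rule integrable_compact_support[OF _ K(1)]) (use c K in \<open>auto intro!: continuous_intros\<close>)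
  then show "square_integrable lborel \<phi>"
    using borel_measurable_continuous_onI[OF c(1)] by (simp add: square_integrable_def)
  have "integrable lborel (\<lambda>x. (norm (gradient \<phi> x))\<^sup>2)"
    by (rule integrable_compact_support[OF _ K(1)]) (use c g0 in \<open>auto intro!: continuous_intros\<close>)
  then show "square_integrable lborel (gradient \<phi>)"
    using borel_measurable_continuous_onI[OF c(2)] by (simp add: square_integrable_def)
  show "integrable lborel \<phi>"
    by (rule integrable_compact_support[OF c(1) K])
qed

text \<open>Used with \<open>e\<close> the gap of an almost minimiser to the infimum,
  \<open>b\<close> its defect in the tested equation and \<open>B\<close> the squared gradient norm
  of the test function: almost minimisers solve the equation approximately.\<close>

lemma nonneg_quadratic_test_bound:
  fixes e b B :: real
  assumes "\<And>t. 0 \<le> e + t * b + t\<^sup>2 / 2 * B" "0 \<le> B"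
  shows "b\<^sup>2 \<le> 2 * e * B"
  using nonneg_quadratic_imp_discriminant[of e "b / 2" "B / 2"] assms by (simp add: power2_eq_square mult_ac)

text \<open>Serves to prove inequalities almost everywhere: \<open>h\<close> is the positive or
  negative part that has to vanish, \<open>k n\<close> an approximation error.\<close>

lemma L2_zero_if_dominated:
  assumes h: "square_integrable M (h :: 'a \<Rightarrow> real)"
    and k: "\<And>n. square_integrable M (k n :: 'a \<Rightarrow> real)"
    and le: "\<And>n. AE x in M. \<bar>h x\<bar> \<le> \<bar>k n x\<bar>"
    and lim: "(\<lambda>n. L2_seminorm M (k n)) \<longlonglongrightarrow> 0"
  shows "AE x in M. h x = 0"
proof -
  have "L2_seminorm M h \<le> L2_seminorm M (k n)" for n
    unfolding L2_seminorm_def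
  proof (intro real_sqrt_le_mono integral_mono_AE)
    show "integrable M (\<lambda>x. (norm (h x))\<^sup>2)" "integrable M (\<lambda>x. (norm (k n x))\<^sup>2)"
      using h k[of n] by (simp_all add: square_integrable_def)
    show "AE x in M. (norm (h x))\<^sup>2 \<le> (norm (k n x))\<^sup>2"
      using le[of n] by eventually_elim (simp add: abs_le_square_iff)
  qed
  then have "L2_seminorm M h \<le> 0"
    using LIMSEQ_le_const[OF lim] by blast
  then show ?thesis
    using L2_seminorm_eq_0_iff[OF h] L2_seminorm_nonneg[of M h] by simp
qed

text \<open>\<open>l\<close> is some constant of a Poincare inequality, not the optimal one for
  \<open>D\<close>: all pieces \<open>\<Omega> \<inter> ball 0 r\<close> share the value
  \<open>dirichlet_bottom \<Omega>\<close>.\<close>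

locale torsion_domain =
  fixes D :: "'a::euclidean_space set" and l :: real
  assumes open_D: "open D" and bounded_D: "bounded D" and l_pos: "0 < l"
    and poincare: "\<phi> \<in> test_functions D \<Longrightarrow>
      l * (L2_seminorm lborel \<phi>)\<^sup>2 \<le> (L2_seminorm lborel (gradient \<phi>))\<^sup>2"
begin

lemma finite_M: "finite_measure (lebesgue_on D)"
  by (intro finite_measure_lebesgue_on lmeasurable_open bounded_D open_D)

definition "vol = measure (lebesgue_on D) D"

lemma vol_nonneg: "0 \<le> vol"
  by (simp add: vol_def)

lemmas test_sq = test_functions_square_integrable[OF _ open_D]
lemmas nrm_test = L2_seminorm_test[OF open_D]

lemma integral_test: "\<phi> \<in> test_functions D \<Longrightarrow> (LINT x|lebesgue_on D. \<phi> x) = (LINT x|lborel. \<phi> x)"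
  by (rule integral_lebesgue_on_eq_lborel[OF open_D is_smooth_continuous[OF test_functions_smooth]])
    (auto intro: test_functions_zero)

lemma poincare_nrm:
  assumes "\<phi> \<in> test_functions D"
  shows "L2_seminorm (lebesgue_on D) \<phi> \<le> L2_seminorm (lebesgue_on D) (gradient \<phi>) / sqrt l"
proof -
  have "(L2_seminorm lborel \<phi>)\<^sup>2 \<le> (L2_seminorm lborel (gradient \<phi>) / sqrt l)\<^sup>2"
    using poincare[OF assms] l_pos by (simp add: power_divide field_simps)
  then show ?thesis
    unfolding nrm_test[OF assms]
    by (rule power2_le_imp_le) (simp add: L2_seminorm_nonneg l_pos less_imp_le)
qed

lemma integral_le_nrm:
  assumes "square_integrable (lebesgue_on D) f"
  shows "(LINT x|lebesgue_on D. \<bar>f x\<bar>) \<le> sqrt vol * L2_seminorm (lebesgue_on D) f"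
  using L1_le_L2[OF finite_M assms] by (simp add: vol_def)

lemma energy_alt:
  assumes "\<phi> \<in> test_functions D"
  shows "torsion_energy \<phi> = (L2_seminorm (lebesgue_on D) (gradient \<phi>))\<^sup>2 / 2 - (LINT x|lebesgue_on D. \<phi> x)"
  by (simp add: torsion_energy_def nrm_test integral_test assms)

text \<open>Cauchy-Schwarz and Poincare bound the linear term by \<open>c * G\<close>, where
  \<open>G\<close> is the gradient norm, and \<open>c * G \<le> c^2 / 2 + G^2 / 2\<close> absorbs it
  into the quadratic term.\<close>

lemma energy_bounded_below: "bdd_below (torsion_energy ` test_functions D)"
proof (rule bdd_belowI2)
  fix \<phi> assume \<phi>: "\<phi> \<in> test_functions D"
  define G where "G = L2_seminorm (lebesgue_on D) (gradient \<phi>)"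
  define c where "c = sqrt vol / sqrt l"
  have "(LINT x|lebesgue_on D. \<phi> x) \<le> (LINT x|lebesgue_on D. \<bar>\<phi> x\<bar>)"
    using L2_imp_integrable[OF finite_M test_sq(1)[OF \<phi>]] by (intro integral_mono) auto
  also have "\<dots> \<le> sqrt vol * L2_seminorm (lebesgue_on D) \<phi>"
    by (rule integral_le_nrm[OF test_sq(1)[OF \<phi>]])
  also have "\<dots> \<le> sqrt vol * (G / sqrt l)"
    unfolding G_def by (intro mult_left_mono poincare_nrm \<phi>) (simp add: vol_nonneg)
  finally have "(LINT x|lebesgue_on D. \<phi> x) \<le> c * G"
    by (simp add: c_def)
  moreover have "c * G \<le> c\<^sup>2 / 2 + G\<^sup>2 / 2"
    using sum_squares_bound[of c G] by simp
  ultimately show "- (c\<^sup>2 / 2) \<le> torsion_energy \<phi>"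
    unfolding energy_alt[OF \<phi>] G_def by simp
qed

lemma energy_add_cmult:
  assumes \<phi>: "\<phi> \<in> test_functions D" and \<psi>: "\<psi> \<in> test_functions D"
  shows "torsion_energy (\<lambda>x. \<phi> x + t * \<psi> x) = torsion_energy \<phi> +
    t * ((LINT x|lebesgue_on D. gradient \<phi> x \<bullet> gradient \<psi> x) - (LINT x|lebesgue_on D. \<psi> x)) +
    t\<^sup>2 / 2 * (L2_seminorm (lebesgue_on D) (gradient \<psi>))\<^sup>2"
proof -
  note s = test_functions_smooth[OF \<phi>] test_functions_smooth[OF \<psi>]
  have t: "(\<lambda>x. \<phi> x + t * \<psi> x) \<in> test_functions D"
    by (intro test_functions_add test_functions_cmult \<phi> \<psi>)
  have "gradient (\<lambda>x. \<phi> x + t * \<psi> x) = (\<lambda>x. gradient \<phi> x + t *\<^sub>R gradient \<psi> x)"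
    using s by (auto simp: gradient_add gradient_cmult is_smooth_mult is_smooth_const)
  then show ?thesis
    unfolding energy_alt[OF t] energy_alt[OF \<phi>] L2_seminorm_power2
    using integral_norm_add_power2[OF test_sq(2)[OF \<phi>] test_sq(2)[OF \<psi>], of t]
      L2_imp_integrable[OF finite_M test_sq(1)[OF \<phi>]] L2_imp_integrable[OF finite_M test_sq(1)[OF \<psi>]]
    by (simp add: algebra_simps)
qed

text \<open>At the midpoint of \<open>\<phi>\<close> and \<open>\<psi>\<close> the energy is the
  mean of the two energies minus one eighth of the squared gradient distance, and it is at least
  \<open>E\<close>. This makes minimising sequences Cauchy.\<close>

lemma energy_parallelogram:
  assumes \<phi>: "\<phi> \<in> test_functions D" and \<psi>: "\<psi> \<in> test_functions D"
    and E: "\<And>\<xi>. \<xi> \<in> test_functions D \<Longrightarrow> E \<le> torsion_energy \<xi>"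
    and le: "torsion_energy \<phi> \<le> E + e" "torsion_energy \<psi> \<le> E + e"
  shows "(L2_seminorm (lebesgue_on D) (\<lambda>x. gradient \<phi> x - gradient \<psi> x))\<^sup>2 \<le> 8 * e"
proof -
  let ?\<xi> = "\<lambda>x. \<psi> x + (- 1) * \<phi> x"
  have \<xi>: "?\<xi> \<in> test_functions D"
    by (intro test_functions_add test_functions_cmult \<phi> \<psi>)
  have g: "gradient ?\<xi> = (\<lambda>x. gradient \<psi> x - gradient \<phi> x)"
    using test_functions_smooth[OF \<phi>] test_functions_smooth[OF \<psi>]
    by (auto simp: gradient_diff)
  have "torsion_energy (\<lambda>x. \<phi> x + 1 * ?\<xi> x) = torsion_energy \<psi>"
    by simp
  moreover have "E \<le> torsion_energy (\<lambda>x. \<phi> x + (1 / 2) * ?\<xi> x)"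
    by (intro E test_functions_add test_functions_cmult[OF \<xi>] \<phi>)
  ultimately have "(L2_seminorm (lebesgue_on D) (gradient ?\<xi>))\<^sup>2 \<le> 8 * e"
    using le unfolding energy_add_cmult[OF \<phi> \<xi>] by (simp add: power2_eq_square field_simps)
  then show ?thesis
    unfolding g by (subst L2_seminorm_minus_commute)
qed

text \<open>The direct method: the gradients of a minimising sequence are Cauchy by
  \<open>energy_parallelogram\<close>, the functions themselves by the Poincare inequality, and the
  limit satisfies the Euler equation since the defects tend to \<open>0\<close>.\<close>

lemma solves_torsion_exists: "\<exists>w. solves_torsion D w"
proof -
  let ?M = "lebesgue_on D"
  define E where "E = (INF \<phi>\<in>test_functions D. torsion_energy \<phi>)"
  have E: "E \<le> torsion_energy \<xi>" if "\<xi> \<in> test_functions D" for \<xi>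
    unfolding E_def by (rule cINF_lower[OF energy_bounded_below that])
  have "\<exists>\<phi>. \<phi> \<in> test_functions D \<and> torsion_energy \<phi> \<le> E + 1 / Suc n" for n
  proof -
    have "(INF \<phi>\<in>test_functions D. torsion_energy \<phi>) < E + 1 / Suc n"
      by (simp add: E_def)
    then show ?thesis
      using cINF_less_iff[OF _ energy_bounded_below] test_functions_0 less_imp_le
      by (metis (no_types, lifting) empty_iff)
  qed
  then obtain \<phi> where \<phi>: "\<And>n. \<phi> n \<in> test_functions D" and \<phi>E: "\<And>n. torsion_energy (\<phi> n) \<le> E + 1 / Suc n"
    by metis
  note sq = test_sq[OF \<phi>]
  have close: "(L2_seminorm ?M (\<lambda>x. gradient (\<phi> m) x - gradient (\<phi> n) x))\<^sup>2 \<le> 8 / Suc N"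
    if "N \<le> m" "N \<le> n" for N m n
  proof -
    have "1 / real (Suc m) \<le> 1 / Suc N" "1 / real (Suc n) \<le> 1 / Suc N"
      using that by (auto intro: frac_le)
    then have "torsion_energy (\<phi> m) \<le> E + 1 / Suc N" "torsion_energy (\<phi> n) \<le> E + 1 / Suc N"
      using \<phi>E[of m] \<phi>E[of n] by linarith+
    from energy_parallelogram[OF \<phi> \<phi> E this] show ?thesis
      by simp
  qed
  have small: "\<exists>N. sqrt (8 / Suc N) < e" if "e > 0" for e :: real
  proof -
    have "(\<lambda>N. sqrt (8 * (1 / Suc N))) \<longlonglongrightarrow> sqrt (8 * 0)"
      by (intro tendsto_intros LIMSEQ_Suc[OF lim_1_over_n])
    then have "\<forall>\<^sub>F N in sequentially. sqrt (8 * (1 / Suc N)) < e"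
      using that by (intro order_tendstoD(2)) auto
    then show ?thesis
      using eventually_happens'[OF sequentially_bot] by force
  qed
  have close': "L2_seminorm ?M (\<lambda>x. gradient (\<phi> m) x - gradient (\<phi> n) x) \<le> sqrt (8 / Suc N)"
    if "N \<le> m" "N \<le> n" for N m n
    using close[OF that] by (rule real_le_rsqrt)
  have Cg: "\<exists>N. \<forall>m\<ge>N. \<forall>n\<ge>N. L2_seminorm ?M (\<lambda>x. gradient (\<phi> m) x - gradient (\<phi> n) x) < e" if "e > 0" for e
    using small[OF that] close' by (meson order_le_less_trans)
  have Cu: "\<exists>N. \<forall>m\<ge>N. \<forall>n\<ge>N. L2_seminorm ?M (\<lambda>x. \<phi> m x - \<phi> n x) < e" if "e > 0" for e
  proof -
    have "0 < e * sqrt l"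
      using that l_pos by simp
    from Cg[OF this] obtain N where N: "\<And>m n. m \<ge> N \<Longrightarrow> n \<ge> N \<Longrightarrow>
        L2_seminorm ?M (\<lambda>x. gradient (\<phi> m) x - gradient (\<phi> n) x) < e * sqrt l"
      by blast
    have "L2_seminorm ?M (\<lambda>x. \<phi> m x - \<phi> n x) < e" if "m \<ge> N" "n \<ge> N" for m n
    proof -
      have "gradient (\<lambda>x. \<phi> m x - \<phi> n x) = (\<lambda>x. gradient (\<phi> m) x - gradient (\<phi> n) x)"
        using test_functions_smooth[OF \<phi>] by (auto simp: gradient_diff)
      then have "L2_seminorm ?M (\<lambda>x. \<phi> m x - \<phi> n x) \<le>
          L2_seminorm ?M (\<lambda>x. gradient (\<phi> m) x - gradient (\<phi> n) x) / sqrt l"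
        using poincare_nrm[OF test_functions_diff[OF \<phi> \<phi>], of m n] by simp
      also have "\<dots> < e"
        using N[OF that] l_pos by (simp add: divide_less_eq)
      finally show ?thesis .
    qed
    then show ?thesis by blast
  qed
  from L2_complete[OF finite_M sq(1) Cu]
  obtain w where w: "square_integrable ?M w" "(\<lambda>n. L2_seminorm ?M (\<lambda>x. \<phi> n x - w x)) \<longlonglongrightarrow> 0"
    by metis
  from L2_complete[OF finite_M sq(2) Cg]
  obtain g where g: "square_integrable ?M g" "(\<lambda>n. L2_seminorm ?M (\<lambda>x. gradient (\<phi> n) x - g x)) \<longlonglongrightarrow> 0"
    by metis
  note H = H10_I[OF open_D \<phi> w(1) g(1) w(2) g(2)]
  have wg: "square_integrable ?M (weak_gradient D w)"
    using weak_gradient_props(2) H(1) unfolding H10_def by blast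
  have "solves_torsion D w"
    unfolding solves_torsion_def
  proof (intro conjI H(1) ballI)
    fix \<psi> assume \<psi>: "\<psi> \<in> test_functions D"
    define B where "B = (L2_seminorm ?M (gradient \<psi>))\<^sup>2"
    define b where "b n = (LINT x|?M. gradient (\<phi> n) x \<bullet> gradient \<psi> x) - (LINT x|?M. \<psi> x)" for n
    have "(b n)\<^sup>2 \<le> 2 * (1 / Suc n) * B" for n
    proof (rule nonneg_quadratic_test_bound)
      fix t
      have "E \<le> torsion_energy (\<lambda>x. \<phi> n x + t * \<psi> x)"
        by (intro E test_functions_add test_functions_cmult \<phi> \<psi>)
      then show "0 \<le> 1 / real (Suc n) + t * b n + t\<^sup>2 / 2 * B"
        using \<phi>E[of n] unfolding energy_add_cmult[OF \<phi> \<psi>] b_def B_def by linarith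
    qed (simp add: B_def)
    moreover have "(\<lambda>n. 2 * (1 / Suc n) * B) \<longlonglongrightarrow> 2 * 0 * B"
      by (intro tendsto_intros LIMSEQ_Suc[OF lim_1_over_n])
    moreover have "(\<lambda>n. (b n)\<^sup>2) \<longlonglongrightarrow> ((LINT x|?M. g x \<bullet> gradient \<psi> x) - (LINT x|?M. \<psi> x))\<^sup>2"
      unfolding b_def by (intro tendsto_intros L2_inner_tendsto sq g test_sq(2)[OF \<psi>])
    ultimately have "((LINT x|?M. g x \<bullet> gradient \<psi> x) - (LINT x|?M. \<psi> x))\<^sup>2 \<le> 2 * 0 * B"
      by (intro LIMSEQ_le) auto
    then have "(LINT x|?M. g x \<bullet> gradient \<psi> x) = (LINT x|?M. \<psi> x)"
      by simp
    moreover have "(LINT x|?M. weak_gradient D w x \<bullet> gradient \<psi> x) = (LINT x|?M. g x \<bullet> gradient \<psi> x)"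
    proof (rule integral_cong_AE)
      show "AE x in ?M. weak_gradient D w x \<bullet> gradient \<psi> x = g x \<bullet> gradient \<psi> x"
        using H(2) by eventually_elim simp
    qed (use wg g(1) test_sq(2)[OF \<psi>] in \<open>auto simp: square_integrable_def\<close>)
    ultimately show "(LINT x|?M. weak_gradient D w x \<bullet> gradient \<psi> x) = (LINT x|?M. \<psi> x)"
      by simp
  qed
  then show ?thesis by blast
qed

lemma torsion_bounded_solves: "solves_torsion D (torsion_bounded D)"
  unfolding torsion_bounded_def by (rule someI_ex[OF solves_torsion_exists])

end

section \<open>Sign and truncation of the approximating test functions\<close>

lemma L2_seminorm_abs: "L2_seminorm M (\<lambda>x. \<bar>f x\<bar>) = L2_seminorm M f" for f :: "'a \<Rightarrow> real"
  by (simp add: L2_seminorm_def)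

lemma square_integrable_mono:
  assumes "square_integrable M g" "f \<in> borel_measurable M" "\<And>x. norm (f x) \<le> norm (g x)"
  shows "square_integrable M f"
proof -
  have "integrable M (\<lambda>x. (norm (f x))\<^sup>2)"
    by (rule Bochner_Integration.integrable_bound[of _ "\<lambda>x. (norm (g x))\<^sup>2"])
      (use assms in \<open>auto simp: square_integrable_def intro!: power_mono\<close>)
  then show ?thesis
    using assms(2) by (simp add: square_integrable_def)
qed

lemma L2_seminorm_mono:
  assumes "square_integrable M f" "square_integrable M g" "\<And>x. norm (f x) \<le> norm (g x)"
  shows "L2_seminorm M f \<le> L2_seminorm M g"
  unfolding L2_seminorm_def
  by (intro real_sqrt_le_mono integral_mono)
    (use assms in \<open>auto simp: square_integrable_def intro!: power_mono\<close>)

lemma square_integrable_lebesgue_on_subset: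
  assumes "S \<subseteq> T" "open S" "open T" and f: "square_integrable (lebesgue_on T) f"
  shows "square_integrable (lebesgue_on S) f"
    "L2_seminorm (lebesgue_on S) f \<le> L2_seminorm (lebesgue_on T) f"
proof -
  have "integrable lebesgue (\<lambda>x. indicator T x *\<^sub>R (norm (f x))\<^sup>2)"
    using f assms(3) by (simp add: square_integrable_def integrable_restrict_space)
  from integrable_mult_indicator[OF _ this, of S]
  have "integrable lebesgue (\<lambda>x. indicator S x *\<^sub>R (indicator T x *\<^sub>R (norm (f x))\<^sup>2))"
    using assms(2) by simp
  also have "(\<lambda>x. indicator S x *\<^sub>R (indicator T x *\<^sub>R (norm (f x))\<^sup>2)) = (\<lambda>x. indicator S x *\<^sub>R (norm (f x))\<^sup>2)"
    using assms(1) by (intro ext) (auto simp: indicator_def)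
  finally have "integrable (lebesgue_on S) (\<lambda>x. (norm (f x))\<^sup>2)"
    using assms(2) by (simp add: integrable_restrict_space)
  then show "square_integrable (lebesgue_on S) f"
    using f measurable_restrict_mono[OF _ assms(1)] by (auto simp: square_integrable_def)
  show "L2_seminorm (lebesgue_on S) f \<le> L2_seminorm (lebesgue_on T) f"
    unfolding L2_seminorm_def
    by (intro real_sqrt_le_mono integral_mono_lebesgue_on_AE)
      (use assms f in \<open>auto simp: square_integrable_def\<close>)
qed

lemma tendsto_0_if_squares_le:
  fixes f g :: "nat \<Rightarrow> real"
  assumes "\<And>n. (f n)\<^sup>2 \<le> g n" "g \<longlonglongrightarrow> 0"
  shows "f \<longlonglongrightarrow> 0"
proof -
  have "(\<lambda>n. sqrt (g n)) \<longlonglongrightarrow> 0"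
    using tendsto_real_sqrt[OF assms(2)] by simp
  moreover have "norm (f n) \<le> sqrt (g n)" for n
    using assms(1)[of n] by (intro real_le_rsqrt) simp
  ultimately show ?thesis
    using Lim_null_comparison[OF always_eventually[OF allI], of f "\<lambda>n. sqrt (g n)"] by simp
qed

lemma tendsto_0_le_bound:
  fixes f g :: "nat \<Rightarrow> real"
  assumes "\<And>n. 0 \<le> f n" "\<And>n. f n \<le> g n" "g \<longlonglongrightarrow> 0"
  shows "f \<longlonglongrightarrow> 0"
  by (rule tendsto_sandwich[OF always_eventually[OF allI] always_eventually[OF allI] tendsto_const assms(3)])
    (rule assms)+

lemma norm_soft_pos'_scaleR:
  assumes "0 < a"
  shows "norm (soft_pos' a t *\<^sub>R v) \<le> norm v" "norm (v - soft_pos' a t *\<^sub>R v) \<le> norm v"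
proof -
  show "norm (soft_pos' a t *\<^sub>R v) \<le> norm v"
    using soft_pos'_bounds[OF assms, of t] by (simp add: mult_left_le_one_le)
  have "v - soft_pos' a t *\<^sub>R v = (1 - soft_pos' a t) *\<^sub>R v"
    by (simp add: algebra_simps)
  then show "norm (v - soft_pos' a t *\<^sub>R v) \<le> norm v"
    using soft_pos'_bounds[OF assms, of t] by (simp add: mult_left_le_one_le)
qed

context torsion_domain
begin

lemma solves_torsionD:
  assumes "solves_torsion D w"
  shows "w \<in> H10 D" "square_integrable (lebesgue_on D) w"
    "square_integrable (lebesgue_on D) (weak_gradient D w)"
    "is_weak_gradient D w (weak_gradient D w)"
    "\<And>\<psi>. \<psi> \<in> test_functions D \<Longrightarrow>
      (LINT x|lebesgue_on D. weak_gradient D w x \<bullet> gradient \<psi> x) = (LINT x|lebesgue_on D. \<psi> x)"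
proof -
  show H: "w \<in> H10 D"
    using assms by (simp add: solves_torsion_def)
  then have "w \<in> H1 D"
    by (simp add: H10_def)
  from weak_gradient_props[OF this] show "square_integrable (lebesgue_on D) w"
    "square_integrable (lebesgue_on D) (weak_gradient D w)" "is_weak_gradient D w (weak_gradient D w)"
    by auto
  show "\<And>\<psi>. \<psi> \<in> test_functions D \<Longrightarrow>
      (LINT x|lebesgue_on D. weak_gradient D w x \<bullet> gradient \<psi> x) = (LINT x|lebesgue_on D. \<psi> x)"
    using assms by (simp add: solves_torsion_def)
qed

text \<open>Completion of the square: up to a constant the energy is half the squared gradient
  distance to the solution, so closeness to \<open>w\<close> can be read off from energies.\<close>

lemma energy_solution:
  assumes "solves_torsion D w" "\<phi> \<in> test_functions D"
  shows "torsion_energy \<phi> = (L2_seminorm (lebesgue_on D) (\<lambda>x. gradient \<phi> x - weak_gradient D w x))\<^sup>2 / 2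
    - (L2_seminorm (lebesgue_on D) (weak_gradient D w))\<^sup>2 / 2"
  using integral_norm_add_power2[OF test_sq(2)[OF assms(2)] solves_torsionD(3)[OF assms(1)], of "- 1"]
    solves_torsionD(5)[OF assms]
  unfolding energy_alt[OF assms(2)] L2_seminorm_power2 by (simp add: inner_commute field_simps)

definition approximates :: "('a \<Rightarrow> real) \<Rightarrow> (nat \<Rightarrow> 'a \<Rightarrow> real) \<Rightarrow> bool" where
  "approximates w \<phi> \<longleftrightarrow> (\<forall>n. \<phi> n \<in> test_functions D) \<and>
    (\<lambda>n. L2_seminorm (lebesgue_on D) (\<lambda>x. \<phi> n x - w x)) \<longlonglongrightarrow> 0 \<and>
    (\<lambda>n. L2_seminorm (lebesgue_on D) (\<lambda>x. gradient (\<phi> n) x - weak_gradient D w x)) \<longlonglongrightarrow> 0"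

lemma approximates_exists:
  assumes "solves_torsion D w"
  shows "\<exists>\<phi>. approximates w \<phi>"
  by (rule H10_sequence[OF open_D solves_torsionD(1)[OF assms]]) (auto simp: approximates_def)

text \<open>By \<open>energy_solution\<close> the gradients of \<open>\<psi> n\<close> inherit the
  convergence, and the Poincare inequality for \<open>\<psi> n - \<phi> n\<close> brings the
  functions along. It plays the part of a maximum principle: approximations may be cut off as long
  as the energy grows by a null sequence only.\<close>

lemma approximates_near:
  assumes w: "solves_torsion D w" and \<phi>: "approximates w \<phi>"
    and \<psi>: "\<And>n. \<psi> n \<in> test_functions D"
    and le: "\<And>n. torsion_energy (\<psi> n) \<le> torsion_energy (\<phi> n) + e n" and e: "e \<longlonglongrightarrow> 0"
  shows "approximates w \<psi>"
proof -
  let ?n = "L2_seminorm (lebesgue_on D)" and ?g = "weak_gradient D w"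
  let ?n' = "L2_seminorm (lebesgue_on D)"
  note wp = solves_torsionD[OF w]
  have \<phi>t: "\<And>n. \<phi> n \<in> test_functions D" and lu: "(\<lambda>n. ?n (\<lambda>x. \<phi> n x - w x)) \<longlonglongrightarrow> 0"
    and lg: "(\<lambda>n. ?n' (\<lambda>x. gradient (\<phi> n) x - ?g x)) \<longlonglongrightarrow> 0"
    using \<phi> by (auto simp: approximates_def)
  have lg': "(\<lambda>n. ?n' (\<lambda>x. gradient (\<psi> n) x - ?g x)) \<longlonglongrightarrow> 0"
  proof (rule tendsto_0_if_squares_le)
    show "(?n' (\<lambda>x. gradient (\<psi> n) x - ?g x))\<^sup>2 \<le> (?n' (\<lambda>x. gradient (\<phi> n) x - ?g x))\<^sup>2 + 2 * e n" for n
      using le[of n] unfolding energy_solution[OF w \<psi>] energy_solution[OF w \<phi>t] by simp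
    show "(\<lambda>n. (?n' (\<lambda>x. gradient (\<phi> n) x - ?g x))\<^sup>2 + 2 * e n) \<longlonglongrightarrow> 0"
      using tendsto_add[OF tendsto_power[OF lg, of 2] tendsto_mult_right_zero[OF e, of 2]] by simp
  qed
  have "?n (\<lambda>x. \<psi> n x - w x) \<le> (?n' (\<lambda>x. gradient (\<psi> n) x - ?g x) + ?n' (\<lambda>x. gradient (\<phi> n) x - ?g x)) / sqrt l
      + ?n (\<lambda>x. \<phi> n x - w x)" for n
  proof -
    have g: "gradient (\<lambda>x. \<psi> n x - \<phi> n x) = (\<lambda>x. gradient (\<psi> n) x - gradient (\<phi> n) x)"
      using test_functions_smooth[OF \<psi>] test_functions_smooth[OF \<phi>t] by (auto simp: gradient_diff)
    have "?n (\<lambda>x. \<psi> n x - \<phi> n x) \<le> ?n' (\<lambda>x. gradient (\<psi> n) x - gradient (\<phi> n) x) / sqrt l"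
      using poincare_nrm[OF test_functions_diff[OF \<psi> \<phi>t], of n n] unfolding g .
    also have "\<dots> \<le> (?n' (\<lambda>x. gradient (\<psi> n) x - ?g x) + ?n' (\<lambda>x. gradient (\<phi> n) x - ?g x)) / sqrt l"
      using L2_triangle_diff[OF test_sq(2)[OF \<psi>] wp(3) test_sq(2)[OF \<phi>t], of n n] l_pos
      by (intro divide_right_mono) (simp_all add: L2_seminorm_minus_commute[of _ ?g])
    finally show ?thesis
      using L2_triangle_diff[OF test_sq(1)[OF \<psi>] test_sq(1)[OF \<phi>t] wp(2), of n n] by simp
  qed
  moreover have "(\<lambda>n. (?n' (\<lambda>x. gradient (\<psi> n) x - ?g x) + ?n' (\<lambda>x. gradient (\<phi> n) x - ?g x)) / sqrt l
      + ?n (\<lambda>x. \<phi> n x - w x)) \<longlonglongrightarrow> 0"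
    using tendsto_add[OF tendsto_divide[OF tendsto_add[OF lg' lg] tendsto_const[of "sqrt l"]] lu] l_pos by simp
  ultimately have "(\<lambda>n. ?n (\<lambda>x. \<psi> n x - w x)) \<longlonglongrightarrow> 0"
    by (rule tendsto_0_le_bound[OF L2_seminorm_nonneg])
  then show ?thesis
    using \<psi> lg' by (simp add: approximates_def)
qed

lemma L2_seminorm_const: "L2_seminorm (lebesgue_on D) (\<lambda>x. c :: real) = \<bar>c\<bar> * sqrt vol"
  by (simp add: L2_seminorm_def vol_def real_sqrt_mult)

lemma square_integrable_const: "square_integrable (lebesgue_on D) (\<lambda>x. c :: real)"
  using square_integrable_scaleR[OF square_integrable_1[OF finite_M], of c] by simp

text \<open>Composition with \<open>soft_pos (1 / Suc n)\<close> shrinks gradients, as its slope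
  lies in \<open>[0, 1]\<close>, and lowers the integral by at most
  \<open>vol / Suc n\<close>.\<close>

lemma approximates_nonneg:
  assumes w: "solves_torsion D w"
  shows "\<exists>\<phi>. approximates w \<phi> \<and> (\<forall>n x. 0 \<le> \<phi> n x)"
proof -
  obtain \<phi> where \<phi>: "approximates w \<phi>"
    using approximates_exists[OF w] by blast
  then have \<phi>t: "\<And>n. \<phi> n \<in> test_functions D"
    by (simp add: approximates_def)
  define \<psi> where "\<psi> n x = soft_pos (1 / Suc n) (\<phi> n x)" for n x
  have sm: "is_smooth (\<psi> n)" for n
    unfolding \<psi>_def by (intro is_smooth_soft_pos test_functions_smooth[OF \<phi>t]) simp
  have \<psi>t: "\<psi> n \<in> test_functions D" for n
    by (rule test_functions_dominated[OF \<phi>t[of n] sm]) (simp add: \<psi>_def soft_pos_nonpos)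
  have g: "gradient (\<psi> n) = (\<lambda>x. soft_pos' (1 / Suc n) (\<phi> n x) *\<^sub>R gradient (\<phi> n) x)" for n
    unfolding \<psi>_def[abs_def] by (rule ext gradient_soft_pos test_functions_smooth \<phi>t | simp)+
  have "approximates w \<psi>"
  proof (rule approximates_near[OF w \<phi> \<psi>t])
    fix n
    have "L2_seminorm (lebesgue_on D) (gradient (\<psi> n)) \<le> L2_seminorm (lebesgue_on D) (gradient (\<phi> n))"
      by (rule L2_seminorm_mono[OF test_sq(2)[OF \<psi>t] test_sq(2)[OF \<phi>t]])
        (simp only: g norm_soft_pos'_scaleR of_nat_Suc zero_less_divide_iff zero_less_one of_nat_0_less_iff
          zero_less_Suc simp_thms flip: of_nat_Suc)
    moreover have "(LINT x|lebesgue_on D. \<phi> n x - 1 / Suc n) \<le> (LINT x|lebesgue_on D. \<psi> n x)"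
    proof (rule integral_mono)
      show "integrable (lebesgue_on D) (\<lambda>x. \<phi> n x - 1 / Suc n)" "integrable (lebesgue_on D) (\<psi> n)"
        by (intro L2_imp_integrable[OF finite_M] square_integrable_diff test_sq(1) square_integrable_const \<phi>t \<psi>t)+
      show "\<phi> n x - 1 / Suc n \<le> \<psi> n x" for x
        unfolding \<psi>_def by (rule soft_pos_bounds) simp
    qed
    moreover have "(LINT x|lebesgue_on D. \<phi> n x - 1 / Suc n) = (LINT x|lebesgue_on D. \<phi> n x) - vol / Suc n"
      using L2_imp_integrable[OF finite_M test_sq(1)[OF \<phi>t]]
        L2_imp_integrable[OF finite_M square_integrable_const]
      by (simp add: vol_def)
    ultimately show "torsion_energy (\<psi> n) \<le> torsion_energy (\<phi> n) + vol * (1 / Suc n)"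
      unfolding energy_alt[OF \<psi>t] energy_alt[OF \<phi>t]
      using power_mono[OF _ L2_seminorm_nonneg, of "lebesgue_on D" "gradient (\<psi> n)" _ 2] by fastforce
  next
    show "(\<lambda>n. vol * (1 / Suc n)) \<longlonglongrightarrow> 0"
      by (rule tendsto_mult_right_zero) (rule LIMSEQ_Suc[OF lim_1_over_n])
  qed
  moreover have "0 \<le> \<psi> n x" for n x
    unfolding \<psi>_def by (rule soft_pos_bounds) simp
  ultimately show ?thesis by blast
qed

lemma solution_nonneg:
  assumes w: "solves_torsion D w"
  shows "AE x in lebesgue_on D. 0 \<le> w x"
proof -
  obtain \<phi> where \<phi>: "approximates w \<phi>" "\<And>n x. 0 \<le> \<phi> n x"
    using approximates_nonneg[OF w] by blast
  note wp = solves_torsionD[OF w]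
  have "AE x in lebesgue_on D. min (w x) 0 = 0"
  proof (rule L2_zero_if_dominated)
    show "square_integrable (lebesgue_on D) (\<lambda>x. min (w x) 0)"
      by (rule square_integrable_mono[OF wp(2)]) (use wp(2) in \<open>auto simp: square_integrable_def\<close>)
    show "square_integrable (lebesgue_on D) (\<lambda>x. \<phi> n x - w x)" for n
      by (intro square_integrable_diff wp test_sq(1)) (use \<phi> in \<open>simp add: approximates_def\<close>)
    \<comment> \<open>As \<open>\<phi> n x \<ge> 0\<close>, the negative part of \<open>w x\<close>
      is at most the distance of \<open>w x\<close> from \<open>\<phi> n x\<close>.\<close>
    show "AE x in lebesgue_on D. \<bar>min (w x) 0\<bar> \<le> \<bar>\<phi> n x - w x\<bar>" for n
    proof (intro AE_I2)
      fix x
      show "\<bar>min (w x) 0\<bar> \<le> \<bar>\<phi> n x - w x\<bar>"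
        using \<phi>(2)[of n x] by linarith
    qed
    show "(\<lambda>n. L2_seminorm (lebesgue_on D) (\<lambda>x. \<phi> n x - w x)) \<longlonglongrightarrow> 0"
      using \<phi>(1) by (simp add: approximates_def)
  qed
  then show ?thesis
    by eventually_elim (simp add: min_def split: if_splits)
qed

text \<open>The smoothed excess \<open>s n\<close> of \<open>\<phi> n\<close> over \<open>b\<close>
  is subtracted. Gradients shrink, and since \<open>w \<le> b\<close> the integral drops by at most
  the integral of \<open>\<bar>\<phi> n - w\<bar>\<close>. The smoothing falls short of the true
  excess by up to \<open>1 / Suc n\<close>, hence the same amount in the upper bound.\<close>

lemma approximates_truncated:
  assumes w: "solves_torsion D w" and b: "AE x in lebesgue_on D. w x \<le> b" "0 < b"
  shows "\<exists>\<phi>. approximates w \<phi> \<and> (\<forall>n x. 0 \<le> \<phi> n x \<and> \<phi> n x \<le> b + 1 / Suc n)"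
proof -
  obtain \<phi> where \<phi>: "approximates w \<phi>" "\<And>n x. 0 \<le> \<phi> n x"
    using approximates_nonneg[OF w] by blast
  note wp = solves_torsionD[OF w]
  have \<phi>t: "\<And>n. \<phi> n \<in> test_functions D"
    using \<phi> by (simp add: approximates_def)
  have pos: "0 < 1 / real (Suc n)" for n
    by simp
  define s where "s n x = soft_pos (1 / Suc n) (\<phi> n x - b)" for n x
  define \<psi> where "\<psi> n x = \<phi> n x - s n x" for n x
  have sms: "is_smooth (s n)" for n
    unfolding s_def by (intro is_smooth_soft_pos is_smooth_diff is_smooth_const test_functions_smooth[OF \<phi>t] pos)
  have st: "s n \<in> test_functions D" for n
    \<comment> \<open>Where \<open>\<phi> n\<close> vanishes, the argument of
      \<open>soft_pos\<close> is \<open>- b < 0\<close>.\<close>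
    by (rule test_functions_dominated[OF \<phi>t[of n] sms]) (use b in \<open>simp add: s_def soft_pos_nonpos\<close>)
  have \<psi>t: "\<psi> n \<in> test_functions D" for n
    unfolding \<psi>_def by (intro test_functions_diff \<phi>t st)
  have gs: "gradient (s n) x = soft_pos' (1 / Suc n) (\<phi> n x - b) *\<^sub>R gradient (\<phi> n) x" for n x
    unfolding s_def
    by (subst gradient_soft_pos[OF pos])
      (simp_all add: is_smooth_diff is_smooth_const test_functions_smooth[OF \<phi>t] gradient_diff gradient_const)
  have g: "gradient (\<psi> n) x = gradient (\<phi> n) x - soft_pos' (1 / Suc n) (\<phi> n x - b) *\<^sub>R gradient (\<phi> n) x" for n x
    unfolding \<psi>_def gs[symmetric] by (intro gradient_diff sms test_functions_smooth[OF \<phi>t])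
  have "approximates w \<psi>"
  proof (rule approximates_near[OF w \<phi>(1) \<psi>t])
    fix n
    have sqd: "square_integrable (lebesgue_on D) (\<lambda>x. \<phi> n x - w x)"
      by (intro square_integrable_diff wp test_sq(1) \<phi>t)
    have "L2_seminorm (lebesgue_on D) (gradient (\<psi> n)) \<le> L2_seminorm (lebesgue_on D) (gradient (\<phi> n))"
      by (rule L2_seminorm_mono[OF test_sq(2)[OF \<psi>t] test_sq(2)[OF \<phi>t]])
        (simp only: g norm_soft_pos'_scaleR(2)[OF pos])
    then have "(L2_seminorm (lebesgue_on D) (gradient (\<psi> n)))\<^sup>2 \<le> (L2_seminorm (lebesgue_on D) (gradient (\<phi> n)))\<^sup>2"
      by (rule power_mono) (rule L2_seminorm_nonneg)
    moreover have "(LINT x|lebesgue_on D. s n x) \<le> (LINT x|lebesgue_on D. \<bar>\<phi> n x - w x\<bar>)"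
    proof (rule integral_mono_AE)
      show "integrable (lebesgue_on D) (s n)"
        by (intro L2_imp_integrable[OF finite_M] test_sq(1) st)
      show "integrable (lebesgue_on D) (\<lambda>x. \<bar>\<phi> n x - w x\<bar>)"
        using L2_imp_integrable[OF finite_M sqd] by simp
      show "AE x in lebesgue_on D. s n x \<le> \<bar>\<phi> n x - w x\<bar>"
        using b(1)
      proof eventually_elim
        case (elim x)
        have "s n x \<le> max (\<phi> n x - b) 0"
          unfolding s_def by (rule soft_pos_bounds[OF pos])
        then show ?case
          using elim by linarith
      qed
    qed
    moreover note integral_le_nrm[OF sqd]
    moreover have "(LINT x|lebesgue_on D. \<psi> n x) = (LINT x|lebesgue_on D. \<phi> n x) - (LINT x|lebesgue_on D. s n x)"
      unfolding \<psi>_def using L2_imp_integrable[OF finite_M test_sq(1)[OF \<phi>t]]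
        L2_imp_integrable[OF finite_M test_sq(1)[OF st]] by simp
    ultimately show "torsion_energy (\<psi> n) \<le> torsion_energy (\<phi> n) +
        sqrt vol * L2_seminorm (lebesgue_on D) (\<lambda>x. \<phi> n x - w x)"
      unfolding energy_alt[OF \<psi>t] energy_alt[OF \<phi>t] by linarith
  next
    show "(\<lambda>n. sqrt vol * L2_seminorm (lebesgue_on D) (\<lambda>x. \<phi> n x - w x)) \<longlonglongrightarrow> 0"
      by (rule tendsto_mult_right_zero) (use \<phi>(1) in \<open>simp add: approximates_def\<close>)
  qed
  moreover have "0 \<le> \<psi> n x \<and> \<psi> n x \<le> b + 1 / Suc n" for n x
    using soft_pos_bounds[OF pos[of n], of "\<phi> n x - b"] \<phi>(2)[of n x] b(2)
    unfolding \<psi>_def s_def by linarith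
  ultimately show ?thesis by blast
qed

end

text \<open>Exchanging the fraction \<open>\<theta>\<close> of the difference lowers the sum of
  squares by \<open>2 \<theta> (1 - \<theta>) (norm (p - q))^2\<close>. It is applied to the
  gradients of two test functions, with a slope of \<open>soft_pos\<close> as
  \<open>\<theta>\<close>.\<close>

lemma norm_convex_swap_le:
  fixes p q :: "'a::real_inner"
  assumes "0 \<le> \<theta>" "\<theta> \<le> 1"
  shows "(norm (p - \<theta> *\<^sub>R (p - q)))\<^sup>2 + (norm (q + \<theta> *\<^sub>R (p - q)))\<^sup>2 \<le> (norm p)\<^sup>2 + (norm q)\<^sup>2"
proof -
  have "(norm p)\<^sup>2 + (norm q)\<^sup>2 - ((norm (p - \<theta> *\<^sub>R (p - q)))\<^sup>2 + (norm (q + \<theta> *\<^sub>R (p - q)))\<^sup>2) =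
      2 * (\<theta> * (1 - \<theta>)) * (norm (p - q))\<^sup>2"
    unfolding power2_norm_eq_inner by (simp add: inner_simps inner_commute algebra_simps)
  also have "\<dots> \<ge> 0"
    using assms by simp
  finally show ?thesis by simp
qed

text \<open>With \<open>s\<close> a smooth version of the positive part of \<open>\<phi> - \<psi>\<close> that vanishes wherever \<open>\<phi>\<close> does, replacing the
  approximations \<open>\<phi>\<close>, \<open>\<psi>\<close> by \<open>\<phi> - s\<close>, \<open>\<psi> + s\<close> does not increase the sum of the two energies. So
  \<open>\<phi> - s\<close>, which is almost dominated by \<open>\<psi>\<close>, still converges to the smaller solution.\<close>

lemma torsion_comparison:
  assumes "torsion_domain D1 l" "torsion_domain D2 l" "D1 \<subseteq> D2"
    and w1: "solves_torsion D1 w1" and w2: "solves_torsion D2 w2"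
  shows "AE x in lebesgue_on D1. w1 x \<le> w2 x"
proof -
  interpret A: torsion_domain D1 l by fact
  interpret B: torsion_domain D2 l by fact
  obtain \<phi> where \<phi>: "A.approximates w1 \<phi>" "\<And>n x. 0 \<le> \<phi> n x"
    using A.approximates_nonneg[OF w1] by blast
  obtain \<psi> where \<psi>: "B.approximates w2 \<psi>" "\<And>n x. 0 \<le> \<psi> n x"
    using B.approximates_nonneg[OF w2] by blast
  have \<phi>t: "\<And>n. \<phi> n \<in> test_functions D1" and \<psi>t: "\<And>n. \<psi> n \<in> test_functions D2"
    using \<phi> \<psi> by (simp_all add: A.approximates_def B.approximates_def)
  note sm = test_functions_smooth[OF \<phi>t] test_functions_smooth[OF \<psi>t]
  note mono = test_functions_mono[OF assms(3), THEN subsetD]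
  define a where "a n = 1 / real (Suc n)" for n
  have a: "0 < a n" for n
    by (simp add: a_def)
  have a0: "a \<longlonglongrightarrow> 0"
    unfolding a_def[abs_def] by (rule LIMSEQ_Suc[OF lim_1_over_n])
  define s where "s n x = soft_pos (a n) (\<phi> n x - \<psi> n x)" for n x
  have sms: "is_smooth (s n)" for n
    unfolding s_def by (intro is_smooth_soft_pos is_smooth_diff sm a)
  have st: "s n \<in> test_functions D1" for n
    by (rule test_functions_dominated[OF \<phi>t[of n] sms]) (use \<psi> in \<open>simp add: s_def soft_pos_nonpos\<close>)
  define m where "m n x = \<phi> n x - s n x" for n x
  define X where "X n x = \<psi> n x + s n x" for n x
  have mt: "m n \<in> test_functions D1" and Xt: "X n \<in> test_functions D2" for n
    unfolding m_def X_def using mono[OF st] by (intro test_functions_diff test_functions_add \<phi>t \<psi>t st; simp)+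
  have gs: "gradient (s n) x = soft_pos' (a n) (\<phi> n x - \<psi> n x) *\<^sub>R (gradient (\<phi> n) x - gradient (\<psi> n) x)" for n x
    unfolding s_def by (simp add: gradient_soft_pos a is_smooth_diff sm gradient_diff)
  have gm: "gradient (m n) x = gradient (\<phi> n) x - soft_pos' (a n) (\<phi> n x - \<psi> n x) *\<^sub>R (gradient (\<phi> n) x - gradient (\<psi> n) x)"
    and gX: "gradient (X n) x = gradient (\<psi> n) x + soft_pos' (a n) (\<phi> n x - \<psi> n x) *\<^sub>R (gradient (\<phi> n) x - gradient (\<psi> n) x)" for n x
    unfolding m_def X_def gs[symmetric] by (intro gradient_diff gradient_add sm sms)+
  have energies: "torsion_energy (m n) + torsion_energy (X n) \<le> torsion_energy (\<phi> n) + torsion_energy (\<psi> n)" for n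
  proof -
    note sq = test_functions_square_integrable_lborel[OF mt[of n]] test_functions_square_integrable_lborel[OF Xt[of n]]
      test_functions_square_integrable_lborel[OF \<phi>t[of n]] test_functions_square_integrable_lborel[OF \<psi>t[of n]]
      test_functions_square_integrable_lborel[OF st[of n]]
    have "(LINT x|lborel. (norm (gradient (m n) x))\<^sup>2 + (norm (gradient (X n) x))\<^sup>2) \<le>
        (LINT x|lborel. (norm (gradient (\<phi> n) x))\<^sup>2 + (norm (gradient (\<psi> n) x))\<^sup>2)"
    proof (rule integral_mono)
      show "(norm (gradient (m n) x))\<^sup>2 + (norm (gradient (X n) x))\<^sup>2 \<le>
          (norm (gradient (\<phi> n) x))\<^sup>2 + (norm (gradient (\<psi> n) x))\<^sup>2" for x
        unfolding gm gX by (intro norm_convex_swap_le soft_pos'_bounds a)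
    qed (use sq in \<open>auto simp: square_integrable_def\<close>)
    moreover have "(LINT x|lborel. m n x) + (LINT x|lborel. X n x) = (LINT x|lborel. \<phi> n x) + (LINT x|lborel. \<psi> n x)"
      unfolding m_def X_def using sq by simp
    ultimately show ?thesis
      using sq unfolding torsion_energy_def L2_seminorm_power2 by (simp add: square_integrable_def)
  qed
  have "A.approximates w1 m"
  proof (rule A.approximates_near[OF w1 \<phi>(1) mt])
    fix n
    \<comment> \<open>By \<open>energy_solution\<close> the energy of \<open>X n\<close> is at least
      the minimal one on \<open>D2\<close>, so passing from \<open>\<phi> n\<close> to
      \<open>m n\<close> costs at most the energy surplus of \<open>\<psi> n\<close>.\<close>
    show "torsion_energy (m n) \<le> torsion_energy (\<phi> n) +
        (L2_seminorm (lebesgue_on D2) (\<lambda>x. gradient (\<psi> n) x - weak_gradient D2 w2 x))\<^sup>2 / 2"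
      using energies[of n]
        zero_le_power2[of "L2_seminorm (lebesgue_on D2) (\<lambda>x. gradient (X n) x - weak_gradient D2 w2 x)"]
      unfolding B.energy_solution[OF w2 \<psi>t] B.energy_solution[OF w2 Xt] by linarith
  next
    have "(\<lambda>n. L2_seminorm (lebesgue_on D2) (\<lambda>x. gradient (\<psi> n) x - weak_gradient D2 w2 x)) \<longlonglongrightarrow> 0"
      using \<psi>(1) by (simp add: B.approximates_def)
    from tendsto_divide[OF tendsto_power[OF this, of 2] tendsto_const[of 2]]
    show "(\<lambda>n. (L2_seminorm (lebesgue_on D2) (\<lambda>x. gradient (\<psi> n) x - weak_gradient D2 w2 x))\<^sup>2 / 2) \<longlonglongrightarrow> 0"
      by simp
  qed
  then have lm: "(\<lambda>n. L2_seminorm (lebesgue_on D1) (\<lambda>x. m n x - w1 x)) \<longlonglongrightarrow> 0"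
    by (simp add: A.approximates_def)
  have l\<psi>: "(\<lambda>n. L2_seminorm (lebesgue_on D2) (\<lambda>x. \<psi> n x - w2 x)) \<longlonglongrightarrow> 0"
    using \<psi>(1) by (simp add: B.approximates_def)
  note w1p = A.solves_torsionD[OF w1] and w2p = B.solves_torsionD[OF w2]
  note sub = square_integrable_lebesgue_on_subset[OF assms(3) A.open_D B.open_D]
  have sm1: "square_integrable (lebesgue_on D1) (\<lambda>x. m n x - w1 x)" for n
    by (intro square_integrable_diff A.test_sq(1) mt w1p)
  have s\<psi>: "square_integrable (lebesgue_on D2) (\<lambda>x. \<psi> n x - w2 x)" for n
    by (intro square_integrable_diff B.test_sq(1) \<psi>t w2p)
  \<comment> \<open>Dominates \<open>w1 - w2\<close>, because
    \<open>m n \<le> \<psi> n + a n\<close>; each of the three terms tends to \<open>0\<close> in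
    \<open>L^2\<close>.\<close>
  define k where "k n x = norm (m n x - w1 x) + (norm (\<psi> n x - w2 x) + a n)" for n x
  have sk': "square_integrable (lebesgue_on D1) (\<lambda>x. norm (\<psi> n x - w2 x) + a n)" for n
    by (intro square_integrable_add square_integrable_norm A.square_integrable_const sub(1) s\<psi>)
  have sk: "square_integrable (lebesgue_on D1) (k n)" for n
    unfolding k_def by (intro square_integrable_add square_integrable_norm sm1 sk')
  have "AE x in lebesgue_on D1. max (w1 x - w2 x) 0 = 0"
  proof (rule L2_zero_if_dominated[OF _ sk])
    have w: "square_integrable (lebesgue_on D1) (\<lambda>x. w1 x - w2 x)"
      by (intro square_integrable_diff w1p sub(1) w2p)
    show "square_integrable (lebesgue_on D1) (\<lambda>x. max (w1 x - w2 x) 0)"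
      by (rule square_integrable_mono[OF w]) (use w in \<open>auto simp: square_integrable_def\<close>)
    show "AE x in lebesgue_on D1. \<bar>max (w1 x - w2 x) 0\<bar> \<le> \<bar>k n x\<bar>" for n
    proof (intro AE_I2)
      fix x
      have "m n x \<le> \<psi> n x + a n"
        using soft_pos_bounds(3)[OF a[of n], of "\<phi> n x - \<psi> n x"] unfolding m_def s_def by linarith
      then show "\<bar>max (w1 x - w2 x) 0\<bar> \<le> \<bar>k n x\<bar>"
        using a[of n] unfolding k_def real_norm_def by linarith
    qed
    show "(\<lambda>n. L2_seminorm (lebesgue_on D1) (k n)) \<longlonglongrightarrow> 0"
    proof (rule Lim_null_comparison[OF always_eventually[OF allI]])
      fix n
      have "L2_seminorm (lebesgue_on D1) (k n) \<le> L2_seminorm (lebesgue_on D1) (\<lambda>x. norm (m n x - w1 x)) +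
          L2_seminorm (lebesgue_on D1) (\<lambda>x. norm (\<psi> n x - w2 x) + a n)"
        unfolding k_def by (intro L2_triangle square_integrable_norm sm1 sk')
      also have "L2_seminorm (lebesgue_on D1) (\<lambda>x. norm (\<psi> n x - w2 x) + a n) \<le>
          L2_seminorm (lebesgue_on D1) (\<lambda>x. norm (\<psi> n x - w2 x)) + L2_seminorm (lebesgue_on D1) (\<lambda>x. a n)"
        by (intro L2_triangle square_integrable_norm A.square_integrable_const sub(1) s\<psi>)
      also have "L2_seminorm (lebesgue_on D1) (\<lambda>x. norm (\<psi> n x - w2 x)) \<le> L2_seminorm (lebesgue_on D2) (\<lambda>x. norm (\<psi> n x - w2 x))"
        by (intro sub(2) square_integrable_norm s\<psi>)
      finally show "norm (L2_seminorm (lebesgue_on D1) (k n)) \<le> L2_seminorm (lebesgue_on D1) (\<lambda>x. m n x - w1 x) +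
          (L2_seminorm (lebesgue_on D2) (\<lambda>x. \<psi> n x - w2 x) + a n * sqrt A.vol)"
        using L2_seminorm_nonneg[of "lebesgue_on D1" "k n"] a[of n]
        by (simp add: A.L2_seminorm_const L2_seminorm_abs)
    next
      show "(\<lambda>n. L2_seminorm (lebesgue_on D1) (\<lambda>x. m n x - w1 x) +
          (L2_seminorm (lebesgue_on D2) (\<lambda>x. \<psi> n x - w2 x) + a n * sqrt A.vol)) \<longlonglongrightarrow> 0"
        using tendsto_add[OF lm tendsto_add[OF l\<psi> tendsto_mult_left_zero[OF a0, of "sqrt A.vol"]]] by simp
    qed
  qed
  then show ?thesis
    by eventually_elim (simp add: max_def split: if_splits)
qed

section \<open>Torsion function of an unbounded open set\<close>

lemma torsion_domain_Int_ball:
  assumes "open \<Omega>" "0 < dirichlet_bottom \<Omega>"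
  shows "torsion_domain (\<Omega> \<inter> ball 0 r) (dirichlet_bottom \<Omega>)"
proof
  show "open (\<Omega> \<inter> ball 0 r)" "bounded (\<Omega> \<inter> ball 0 r)" "0 < dirichlet_bottom \<Omega>"
    using assms by auto
  show "dirichlet_bottom \<Omega> * (L2_seminorm lborel \<phi>)\<^sup>2 \<le> (L2_seminorm lborel (gradient \<phi>))\<^sup>2"
    if "\<phi> \<in> test_functions (\<Omega> \<inter> ball 0 r)" for \<phi>
    using that test_functions_mono[of "\<Omega> \<inter> ball 0 r" \<Omega>] by (intro dirichlet_bottom_le assms) auto
qed

lemma AE_lebesgue_on_subset:
  assumes "AE x in lebesgue_on S. P x" "open S" "open T"
  shows "AE x in lebesgue_on T. x \<in> S \<longrightarrow> P x"
proof -
  have "AE x in lebesgue. x \<in> S \<longrightarrow> P x"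
    using assms(1,2) by (subst (asm) AE_restrict_space_iff) auto
  then have "AE x in lebesgue. x \<in> T \<longrightarrow> (x \<in> S \<longrightarrow> P x)"
    by eventually_elim simp
  then show ?thesis
    using assms(3) by (subst AE_restrict_space_iff) auto
qed

context
  fixes \<Omega> :: "'a::euclidean_space set"
  assumes open_\<Omega>: "open \<Omega>" and bottom_pos: "0 < dirichlet_bottom \<Omega>"
begin

abbreviation "tb r \<equiv> torsion_bounded (\<Omega> \<inter> ball 0 r)"

lemma tb_mono:
  assumes "r \<le> s"
  shows "AE x in lebesgue_on \<Omega>. x \<in> ball 0 r \<longrightarrow> tb r x \<le> tb s x"
proof -
  note t = torsion_domain_Int_ball[OF open_\<Omega> bottom_pos]
  have "AE x in lebesgue_on (\<Omega> \<inter> ball 0 r). tb r x \<le> tb s x"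
    by (rule torsion_comparison[OF t t _ torsion_domain.torsion_bounded_solves torsion_domain.torsion_bounded_solves, OF _ t t])
      (use assms in auto)
  from AE_lebesgue_on_subset[OF this _ open_\<Omega>] have "AE x in lebesgue_on \<Omega>. x \<in> \<Omega> \<inter> ball 0 r \<longrightarrow> tb r x \<le> tb s x"
    using open_\<Omega> by auto
  then show ?thesis
    by (rule lebesgue_on_mono) simp
qed

text \<open>The supremum over integer radii is the limit along every sequence \<open>r\<close>: each
  \<open>r n\<close> lies below some integer, and eventually above any given one. For a fixed
  sequence only countably many comparisons are involved, so their exceptional null sets can be
  united.\<close>

lemma is_torsion_function_exists: "\<exists>w. is_torsion_function \<Omega> w"
proof -
  \<comment> \<open>Set to \<open>0\<close> off \<open>\<Omega> \<inter> ball 0 (real n)\<close>,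
    where the values of \<open>tb (real n)\<close> are arbitrary and would spoil the
    supremum.\<close>
  define f where "f n x = ennreal (if x \<in> \<Omega> \<inter> ball 0 (real n) then tb (real n) x else 0)" for n :: nat and x
  define T where "T x = (SUP n. f n x)" for x
  have "f n \<in> borel_measurable (lebesgue_on \<Omega>)" for n
  proof -
    note t = torsion_domain_Int_ball[OF open_\<Omega> bottom_pos, of "real n"]
    have "tb (real n) \<in> borel_measurable (lebesgue_on (\<Omega> \<inter> ball 0 (real n)))"
      using torsion_domain.solves_torsionD(2)[OF t torsion_domain.torsion_bounded_solves[OF t]]
      by (simp add: square_integrable_def)
    then have "(\<lambda>x. if x \<in> \<Omega> \<inter> ball 0 (real n) then tb (real n) x else 0) \<in> borel_measurable (lebesgue_on \<Omega>)"
      using open_\<Omega> by (subst borel_measurable_if_lebesgue_on) auto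
    then show ?thesis
      unfolding f_def by (rule measurable_compose) simp
  qed
  then have Tm: "T \<in> borel_measurable (lebesgue_on \<Omega>)"
    unfolding T_def[abs_def] by (intro borel_measurable_SUP) auto
  have "AE x in lebesgue_on \<Omega>. (\<lambda>n. ennreal (tb (r n) x)) \<longlonglongrightarrow> T x"
    if r: "filterlim r at_top sequentially" for r :: "nat \<Rightarrow> real"
  proof -
    have "AE x in lebesgue_on \<Omega>. r n \<le> real m \<longrightarrow> x \<in> ball 0 (r n) \<longrightarrow> tb (r n) x \<le> tb (real m) x" for n m
      using tb_mono[of "r n" "real m"] by (cases "r n \<le> real m") auto
    then have up: "AE x in lebesgue_on \<Omega>. \<forall>n m. r n \<le> real m \<longrightarrow> x \<in> ball 0 (r n) \<longrightarrow> tb (r n) x \<le> tb (real m) x"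
      unfolding AE_all_countable by blast
    have "AE x in lebesgue_on \<Omega>. real m \<le> r n \<longrightarrow> x \<in> ball 0 (real m) \<longrightarrow> tb (real m) x \<le> tb (r n) x" for n m
      using tb_mono[of "real m" "r n"] by (cases "real m \<le> r n") auto
    then have down: "AE x in lebesgue_on \<Omega>. \<forall>n m. real m \<le> r n \<longrightarrow> x \<in> ball 0 (real m) \<longrightarrow> tb (real m) x \<le> tb (r n) x"
      unfolding AE_all_countable by blast
    have "AE x in lebesgue_on \<Omega>. x \<in> \<Omega>"
      by (rule AE_I2) simp
    then show ?thesis
      using up down
    proof eventually_elim
      case (elim x)
      have big: "\<forall>\<^sub>F n in sequentially. norm x < r n"
        using r by (simp add: filterlim_at_top_dense)
      show ?case
      proof (rule order_tendstoI)
        fix a assume "a < T x"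
        then obtain k where k: "a < f k x"
          unfolding T_def by (auto simp: less_SUP_iff)
        have x: "x \<in> \<Omega> \<inter> ball 0 (real k)"
          using k by (auto simp: f_def split: if_splits)
        have "\<forall>\<^sub>F n in sequentially. real k \<le> r n"
          using r by (simp add: filterlim_at_top)
        then show "\<forall>\<^sub>F n in sequentially. a < ennreal (tb (r n) x)"
        proof eventually_elim
          case (elim n)
          then have "tb (real k) x \<le> tb (r n) x"
            using \<open>\<forall>n m. real m \<le> r n \<longrightarrow> _ n m\<close> x by simp
          then have "f k x \<le> ennreal (tb (r n) x)"
            using x by (simp add: f_def ennreal_leI)
          then show ?case
            by (rule less_le_trans[OF k])
        qed
      next
        fix a assume a: "T x < a"
        from big show "\<forall>\<^sub>F n in sequentially. ennreal (tb (r n) x) < a"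
        proof eventually_elim
          case (elim n)
          obtain m where m: "r n \<le> real m"
            using real_arch_simple by blast
          then have "tb (r n) x \<le> tb (real m) x"
            using \<open>\<forall>n m. r n \<le> real m \<longrightarrow> _ n m\<close> elim by simp
          then have "ennreal (tb (r n) x) \<le> f m x"
            using m elim \<open>x \<in> \<Omega>\<close> by (simp add: f_def ennreal_leI)
          also have "\<dots> \<le> T x"
            unfolding T_def by (rule SUP_upper) simp
          finally show ?case
            using a by (rule le_less_trans)
        qed
      qed
    qed
  qed
  then show ?thesis
    using Tm unfolding is_torsion_function_def by blast
qed

lemma torsion_function_props:
  shows "torsion_function \<Omega> \<in> borel_measurable (lebesgue_on \<Omega>)"
    "AE x in lebesgue_on \<Omega>. (\<lambda>n. ennreal (tb (real n) x)) \<longlonglongrightarrow> torsion_function \<Omega> x"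
proof -
  have "is_torsion_function \<Omega> (torsion_function \<Omega>)"
    unfolding torsion_function_def by (rule someI_ex[OF is_torsion_function_exists])
  then show "torsion_function \<Omega> \<in> borel_measurable (lebesgue_on \<Omega>)"
    "AE x in lebesgue_on \<Omega>. (\<lambda>n. ennreal (tb (real n) x)) \<longlonglongrightarrow> torsion_function \<Omega> x"
    unfolding is_torsion_function_def using filterlim_real_sequentially by blast+
qed

text \<open>At almost every point of the ball of radius \<open>m\<close> the values
  \<open>tb (real n) x\<close> with \<open>n \<ge> m\<close> are at least
  \<open>tb (real m) x\<close>, and so is their limit.\<close>

lemma torsion_bounded_le_Linf_norm:
  assumes b: "Linf_norm \<Omega> (torsion_function \<Omega>) \<le> ennreal b" "0 \<le> b"
  shows "AE x in lebesgue_on (\<Omega> \<inter> ball 0 (real m)). tb (real m) x \<le> b"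
proof -
  have "AE x in lebesgue_on \<Omega>. real m \<le> real n \<longrightarrow> x \<in> ball 0 (real m) \<longrightarrow> tb (real m) x \<le> tb (real n) x" for n
    using tb_mono[of "real m" "real n"] by (cases "real m \<le> real n") auto
  then have "AE x in lebesgue_on \<Omega>. \<forall>n. real m \<le> real n \<longrightarrow> x \<in> ball 0 (real m) \<longrightarrow> tb (real m) x \<le> tb (real n) x"
    unfolding AE_all_countable by blast
  moreover have "AE x in lebesgue_on \<Omega>. torsion_function \<Omega> x \<le> Linf_norm \<Omega> (torsion_function \<Omega>)"
    unfolding Linf_norm_def by (rule esssup_AE)
  ultimately have "AE x in lebesgue_on \<Omega>. x \<in> ball 0 (real m) \<longrightarrow> tb (real m) x \<le> b"
    using torsion_function_props(2)
  proof eventually_elim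
    case (elim x)
    show ?case
    proof
      assume x: "x \<in> ball 0 (real m)"
      have "ennreal (tb (real m) x) \<le> torsion_function \<Omega> x"
        using elim(1) x by (intro LIMSEQ_le_const[OF elim(3)] exI[of _ m]) (simp add: ennreal_leI)
      also have "\<dots> \<le> ennreal b"
        using elim(2) b(1) by (rule order_trans)
      finally show "tb (real m) x \<le> b"
        using b(2) by simp
    qed
  qed
  then have "AE x in lebesgue. x \<in> \<Omega> \<longrightarrow> x \<in> ball 0 (real m) \<longrightarrow> tb (real m) x \<le> b"
    using open_\<Omega> by (subst (asm) AE_restrict_space_iff) auto
  then have "AE x in lebesgue. x \<in> \<Omega> \<inter> ball 0 (real m) \<longrightarrow> tb (real m) x \<le> b"
    by eventually_elim simp
  then show ?thesis
    using open_\<Omega> by (subst AE_restrict_space_iff) auto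
qed

end

section \<open>The inradius is controlled by the torsion function\<close>

context torsion_domain
begin

text \<open>Partial derivatives of \<open>\<phi>\<close> are again test functions, so the weak
  gradient of \<open>w\<close> may be tested with each of them; summing over the coordinates moves
  the Laplacian from \<open>w\<close> to \<open>\<phi>\<close>.\<close>

lemma integral_solution_laplacian:
  assumes w: "solves_torsion D w" and \<phi>: "\<phi> \<in> test_functions D"
  shows "(LINT x|lebesgue_on D. w x * (\<Sum>i\<in>Basis. gradient (\<lambda>y. gradient \<phi> y \<bullet> i) x \<bullet> i)) = - (LINT x|lborel. \<phi> x)"
    "integrable (lebesgue_on D) (\<lambda>x. w x * (\<Sum>i\<in>Basis. gradient (\<lambda>y. gradient \<phi> y \<bullet> i) x \<bullet> i))"
proof -
  let ?M = "lebesgue_on D" and ?g = "weak_gradient D w"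
  note wp = solves_torsionD[OF w]
  have \<psi>: "(\<lambda>y. gradient \<phi> y \<bullet> i) \<in> test_functions D" if "i \<in> Basis" for i
    by (rule test_functions_gradient_inner[OF \<phi> that])
  have 1: "(LINT x|?M. w x * (gradient (\<lambda>y. gradient \<phi> y \<bullet> i) x \<bullet> i)) = - (LINT x|?M. (gradient \<phi> x \<bullet> i) * (?g x \<bullet> i))"
    if i: "i \<in> Basis" for i
  proof -
    have "(LINT x|?M. w x *\<^sub>R gradient (\<lambda>y. gradient \<phi> y \<bullet> i) x) = - (LINT x|?M. (gradient \<phi> x \<bullet> i) *\<^sub>R ?g x)"
      using wp(4) \<psi>[OF i] unfolding is_weak_gradient_def by simp
    then show ?thesis
      using integral_test_scaleR_inner[OF wp(2) test_sq(2)[OF \<psi>[OF i]], of i]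
        integral_test_scaleR_inner[OF test_sq(1)[OF \<psi>[OF i]] wp(3), of i] by simp
  qed
  have i1: "integrable ?M (\<lambda>x. w x * (gradient (\<lambda>y. gradient \<phi> y \<bullet> i) x \<bullet> i))" if i: "i \<in> Basis" for i
    using square_integrable_inner[OF wp(2) test_sq(1)[OF test_functions_gradient_inner[OF \<psi>[OF i] i]]] by simp
  have i2: "integrable ?M (\<lambda>x. (gradient \<phi> x \<bullet> i) * (?g x \<bullet> i))" if i: "i \<in> Basis" for i
    using integrable_inner_left[OF square_integrable_scaleR_fun[OF test_sq(1)[OF \<psi>[OF i]] wp(3)], of i] by simp
  show "integrable ?M (\<lambda>x. w x * (\<Sum>i\<in>Basis. gradient (\<lambda>y. gradient \<phi> y \<bullet> i) x \<bullet> i))"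
    unfolding sum_distrib_left by (intro Bochner_Integration.integrable_sum i1)
  have "(LINT x|?M. w x * (\<Sum>i\<in>Basis. gradient (\<lambda>y. gradient \<phi> y \<bullet> i) x \<bullet> i)) =
      (\<Sum>i\<in>Basis. LINT x|?M. w x * (gradient (\<lambda>y. gradient \<phi> y \<bullet> i) x \<bullet> i))"
    unfolding sum_distrib_left by (intro Bochner_Integration.integral_sum i1)
  also have "\<dots> = - (\<Sum>i\<in>Basis. LINT x|?M. (gradient \<phi> x \<bullet> i) * (?g x \<bullet> i))"
    by (simp add: 1 sum_negf)
  also have "(\<Sum>i\<in>Basis. LINT x|?M. (gradient \<phi> x \<bullet> i) * (?g x \<bullet> i)) = (LINT x|?M. (\<Sum>i\<in>Basis. (gradient \<phi> x \<bullet> i) * (?g x \<bullet> i)))"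
    by (intro Bochner_Integration.integral_sum[symmetric] i2)
  also have "\<dots> = (LINT x|?M. gradient \<phi> x \<bullet> ?g x)"
    by (subst euclidean_inner[of "gradient \<phi> _"]) (rule refl)
  also have "\<dots> = (LINT x|lborel. \<phi> x)"
    using wp(5)[OF \<phi>] integral_test[OF \<phi>] by (simp add: inner_commute)
  finally show "(LINT x|?M. w x * (\<Sum>i\<in>Basis. gradient (\<lambda>y. gradient \<phi> y \<bullet> i) x \<bullet> i)) = - (LINT x|lborel. \<phi> x)" .
qed

text \<open>For a radial bump \<open>\<phi>\<close> on the ball, the integral of
  \<open>\<phi>\<close> equals that of \<open>w (- \<Delta> \<phi>)\<close>, which is at most
  \<open>b * k\<close> times the volume of the ball, \<open>k = 2 DIM / \<rho>^2\<close>. On the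
  other hand \<open>\<phi> \<ge> 1/2\<close> on the ball of half the radius. The ratio of volumes
  supplies the power of \<open>2\<close>; in the plane the constant is \<open>32\<close>.\<close>

lemma inradius_bound:
  assumes w: "solves_torsion D w" and b: "AE x in lebesgue_on D. w x \<le> b" "0 \<le> b"
    and ball: "cball c \<rho> \<subseteq> D" "0 < \<rho>"
  shows "\<rho>\<^sup>2 \<le> real (DIM('a) * 2 ^ (DIM('a) + 2)) * b"
proof -
  \<comment> \<open>\<open>soft_pos\<close> is convex, so \<open>- \<Delta> \<phi> \<le> - \<Delta> q = 2 DIM / \<rho>\<^sup>2\<close> on the ball.\<close>
  define q where "q y = 1 - (1 / \<rho>\<^sup>2) * (\<Sum>i\<in>Basis. (y \<bullet> i - c \<bullet> i)\<^sup>2)" for y :: 'a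
  define \<phi> where "\<phi> y = soft_pos (1 / 4) (q y)" for y
  have qn: "q y = 1 - (norm (y - c))\<^sup>2 / \<rho>\<^sup>2" for y
  proof -
    have "(norm (y - c))\<^sup>2 = (\<Sum>i\<in>Basis. (y \<bullet> i - c \<bullet> i)\<^sup>2)"
      unfolding power2_norm_eq_inner
      by (subst euclidean_inner) (simp add: inner_diff_left power2_eq_square)
    then show ?thesis
      by (simp add: q_def)
  qed
  have smq: "is_smooth q"
    unfolding q_def[abs_def]
    by (intro is_smooth_diff is_smooth_mult is_smooth_sum is_smooth_power2 is_smooth_const is_smooth_inner) auto
  have Gq: "GDERIV q y :> (- (2 / \<rho>\<^sup>2)) *\<^sub>R (y - c)" for y
  proof -
    have "((\<lambda>y. 1 - (1 / \<rho>\<^sup>2) * ((y - c) \<bullet> (y - c))) has_derivative (\<lambda>h. h \<bullet> ((- (2 / \<rho>\<^sup>2)) *\<^sub>R (y - c)))) (at y)"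
      by (rule derivative_eq_intros refl)+ (auto simp: inner_commute)
    then show ?thesis
      unfolding gderiv_def qn[abs_def] by (simp add: power2_norm_eq_inner)
  qed
  have outside: "q y \<le> 0" if "y \<notin> ball c \<rho>" for y
  proof -
    have "\<rho>\<^sup>2 \<le> (norm (y - c))\<^sup>2"
      using that ball(2) by (intro power_mono) (auto simp: dist_norm norm_minus_commute)
    then show ?thesis
      using ball(2) by (simp add: qn)
  qed
  have sm\<phi>: "is_smooth \<phi>"
    unfolding \<phi>_def by (intro is_smooth_soft_pos smq) simp
  have \<phi>: "\<phi> \<in> test_functions D"
    by (rule test_functionsI[OF sm\<phi> compact_cball ball(1)])
      (use outside ball_subset_cball in \<open>auto simp: \<phi>_def intro!: soft_pos_nonpos outside\<close>)
  have g\<phi>: "gradient \<phi> y = soft_pos' (1 / 4) (q y) *\<^sub>R ((- (2 / \<rho>\<^sup>2)) *\<^sub>R (y - c))" for y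
    unfolding \<phi>_def by (rule gradient_eqI[OF GDERIV_DERIV_compose[OF Gq DERIV_soft_pos]]) simp
  let ?L = "\<lambda>y. \<Sum>i\<in>Basis. gradient (\<lambda>y. gradient \<phi> y \<bullet> i) y \<bullet> i"
  have second: "gradient (\<lambda>y. gradient \<phi> y \<bullet> i) y \<bullet> i \<ge> - (2 / \<rho>\<^sup>2) * indicator (ball c \<rho>) y"
    if i: "i \<in> Basis" for i y
  proof -
    have eq: "(\<lambda>y. gradient \<phi> y \<bullet> i) = (\<lambda>y. soft_pos' (1 / 4) (q y) * ((- (2 / \<rho>\<^sup>2)) * (y \<bullet> i - c \<bullet> i)))"
      by (intro ext) (simp only: g\<phi> inner_diff_left inner_scaleR_left)
    have G1: "GDERIV (\<lambda>y. soft_pos' (1 / 4) (q y)) y :> ((1 / 4)\<^sup>2 * flat (1 / 4) 3 (q y)) *\<^sub>R ((- (2 / \<rho>\<^sup>2)) *\<^sub>R (y - c))"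
      by (rule GDERIV_DERIV_compose[OF Gq DERIV_soft_pos']) simp
    have G2: "GDERIV (\<lambda>y. \<kappa> * (y \<bullet> i - c \<bullet> i)) y :> \<kappa> *\<^sub>R i" for \<kappa>
      unfolding gderiv_def by (auto intro!: derivative_eq_intros)
    define d where "d = y \<bullet> i - c \<bullet> i"
    define fl where "fl = (1 / 4)\<^sup>2 * flat (1 / 4) 3 (q y)"
    define s where "s = soft_pos' (1 / 4) (q y)"
    have "gradient (\<lambda>y. gradient \<phi> y \<bullet> i) y = s *\<^sub>R ((- (2 / \<rho>\<^sup>2)) *\<^sub>R i) +
        ((- (2 / \<rho>\<^sup>2)) * d) *\<^sub>R (fl *\<^sub>R ((- (2 / \<rho>\<^sup>2)) *\<^sub>R (y - c)))"
      unfolding eq s_def fl_def d_def by (rule gradient_eqI[OF GDERIV_mult[OF G1 G2]])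
    moreover have yd: "(y - c) \<bullet> i = d" and ii: "i \<bullet> i = 1"
      using i by (simp_all add: d_def inner_diff_left)
    moreover have alg: "s * (- \<kappa> * 1) + (- \<kappa> * d) * (fl * (- \<kappa> * d)) = - \<kappa> * s + fl * (\<kappa> * d)\<^sup>2" for \<kappa> :: real
      by (simp add: power2_eq_square algebra_simps)
    ultimately have "gradient (\<lambda>y. gradient \<phi> y \<bullet> i) y \<bullet> i = - (2 / \<rho>\<^sup>2) * s + fl * ((2 / \<rho>\<^sup>2) * d)\<^sup>2"
      by (simp only: inner_add_left inner_scaleR_left yd ii alg)
    moreover have "0 \<le> fl * ((2 / \<rho>\<^sup>2) * d)\<^sup>2"
      by (simp add: fl_def flat_def)
    moreover have "- (2 / \<rho>\<^sup>2) * s \<ge> - (2 / \<rho>\<^sup>2) * indicator (ball c \<rho>) y"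
    proof -
      have "s \<le> indicator (ball c \<rho>) y"
      proof (cases "y \<in> ball c \<rho>")
        case True
        then show ?thesis
          using soft_pos'_bounds[of "1/4" "q y"] by (simp add: s_def)
      next
        case False
        then show ?thesis
          using outside[OF False] by (simp add: s_def soft_pos'_def flat_def)
      qed
      then show ?thesis
        by (intro mult_left_mono_neg) auto
    qed
    ultimately show ?thesis
      by linarith
  qed
  define k where "k = 2 * real DIM('a) / \<rho>\<^sup>2"
  have Lge: "- k * indicator (ball c \<rho>) y \<le> ?L y" for y
    using sum_mono[of "Basis :: 'a set" "\<lambda>i. - (2 / \<rho>\<^sup>2) * indicator (ball c \<rho>) y" "\<lambda>i. gradient (\<lambda>y. gradient \<phi> y \<bullet> i) y \<bullet> i", OF second]
    by (simp add: k_def mult_ac)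
  note S = integral_solution_laplacian[OF w \<phi>]
  have ballM: "ball c \<rho> \<subseteq> D"
    using ball ball_subset_cball by blast
  have measD: "measure (lebesgue_on D) (ball c \<rho>) = measure lborel (ball c \<rho>)"
    using ballM open_D by (simp add: measure_restrict_space measure_completion)
  have "(LINT x|lborel. \<phi> x) = (LINT x|lebesgue_on D. - (w x * ?L x))"
    using S(1) by simp
  also have "\<dots> \<le> (LINT x|lebesgue_on D. (b * k) * indicator (ball c \<rho>) x)"
  proof (rule integral_mono_AE)
    show "integrable (lebesgue_on D) (\<lambda>x. - (w x * ?L x))"
      using S(2) by simp
    show "integrable (lebesgue_on D) (\<lambda>x. (b * k) * indicator (ball c \<rho>) x)"
      using ballM open_D finite_measure.emeasure_finite[OF finite_M]
      by (intro integrable_mult_right integrable_real_indicator)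
        (auto simp: sets_restrict_space_iff less_top[symmetric])
    show "AE x in lebesgue_on D. - (w x * ?L x) \<le> (b * k) * indicator (ball c \<rho>) x"
      using b(1) solution_nonneg[OF w]
    proof eventually_elim
      case (elim x)
      have k0: "0 \<le> k"
        by (simp add: k_def)
      \<comment> \<open>Only a lower bound for the Laplacian is known, so \<open>w \<ge> 0\<close>
        is what allows the multiplication.\<close>
      have "w x * (- ?L x) \<le> w x * (k * indicator (ball c \<rho>) x)"
        using elim(2) Lge[of x] by (intro mult_left_mono) auto
      also have "\<dots> \<le> b * (k * indicator (ball c \<rho>) x)"
        using elim k0 by (intro mult_right_mono) auto
      finally show ?case by simp
    qed
  qed
  also have "\<dots> = b * k * measure lborel (ball c \<rho>)"
    using ballM measD by (simp add: Int_absorb2)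
  finally have upper: "(LINT x|lborel. \<phi> x) \<le> b * k * measure lborel (ball c \<rho>)" .
  have "(LINT x|lborel. (1 / 2) * indicator (ball c (\<rho> / 2)) x) \<le> (LINT x|lborel. \<phi> x)"
  proof (rule integral_mono)
    show "integrable lborel (\<lambda>x. (1 / 2 :: real) * indicator (ball c (\<rho> / 2)) x)"
      using emeasure_lborel_ball_finite[of c "\<rho> / 2"] by (intro integrable_mult_right integrable_real_indicator) auto
    show "integrable lborel \<phi>"
      by (rule test_functions_square_integrable_lborel(3)[OF \<phi>])
    fix y
    show "(1 / 2) * indicator (ball c (\<rho> / 2)) y \<le> \<phi> y"
    proof (cases "y \<in> ball c (\<rho> / 2)")
      case True
      then have "(norm (y - c))\<^sup>2 \<le> (\<rho> / 2)\<^sup>2"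
        by (intro power_mono) (auto simp: dist_norm norm_minus_commute)
      \<comment> \<open>The smoothing \<open>soft_pos (1 / 4)\<close> loses at most
        \<open>1/4\<close>, which leaves \<open>1/2\<close>.\<close>
      then have "3 / 4 \<le> q y"
        using ball(2) by (simp add: qn power_divide field_simps)
      then show ?thesis
        using soft_pos_bounds(3)[of "1/4" "q y"] True by (simp add: \<phi>_def)
    next
      case False
      then show ?thesis
        using soft_pos_bounds(1)[of "1/4" "q y"] by (simp add: \<phi>_def)
    qed
  qed
  then have "(1 / 2) * measure lborel (ball c (\<rho> / 2)) \<le> b * k * measure lborel (ball c \<rho>)"
    using upper by simp
  moreover have "measure lborel (ball c (\<rho> / 2)) = (1 / 2) ^ DIM('a) * measure lborel (ball c \<rho>)"
    using ball(2) by (simp add: content_ball_conv_unit_ball[where c=c] power_divide)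
  moreover have "0 < measure lborel (ball c \<rho>)"
    using content_ball_pos ball(2) by blast
  ultimately have "(1 / 2) * (1 / 2) ^ DIM('a) \<le> b * k"
    by (simp add: mult.assoc[symmetric] del: mult.assoc)
  then show ?thesis
    using ball(2) by (simp add: k_def field_simps)
qed

end

section \<open>A Cheeger inequality for planar simply connected sets\<close>

definition pt :: "real \<Rightarrow> real \<Rightarrow> real ^ 2" where
  "pt x y = x *\<^sub>R axis 1 1 + y *\<^sub>R axis 2 1"

lemma pt_nth [simp]: "pt x y $ 1 = x" "pt x y $ 2 = y"
  by (simp_all add: pt_def axis_def)

lemma pt_eta [simp]: "pt (v $ 1) (v $ 2) = v"
  by (simp add: vec_eq_iff forall_2)

lemma in_Basis_vec2: "i \<in> (Basis :: (real ^ 2) set) \<longleftrightarrow> i = axis 1 1 \<or> i = axis 2 1"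
  by (auto simp: Basis_vec_def UNIV_2)

text \<open>The characterisation of simple connectedness by unbounded components of the complement
  speaks of subsets of \<open>complex\<close>; the linear isomorphism \<open>f\<close> carries it
  over to \<open>real ^ 2\<close>.\<close>

lemma unbounded_complement_component:
  fixes \<Omega> :: "(real ^ 2) set"
  assumes "open \<Omega>" "simply_connected \<Omega>" "z \<notin> \<Omega>"
  shows "\<not> bounded (connected_component_set (- \<Omega>) z)"
proof
  assume bd: "bounded (connected_component_set (- \<Omega>) z)"
  define f :: "real ^ 2 \<Rightarrow> complex" where "f v = Complex (v $ 1) (v $ 2)" for v
  define g :: "complex \<Rightarrow> real ^ 2" where "g w = pt (Re w) (Im w)" for w
  have gf: "g (f v) = v" and fg: "f (g w) = w" for v w
    by (simp_all add: f_def g_def)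
  have "linear f" "linear g"
    by (auto intro!: linearI simp: f_def g_def complex_eq_iff vec_eq_iff forall_2)
  then have bl: "bounded_linear f" "bounded_linear g"
    by (simp_all add: linear_conv_bounded_linear)
  note cf = linear_continuous_on[OF bl(1)] and cg = linear_continuous_on[OF bl(2)]
  have im: "f ` \<Omega> = g -` \<Omega>"
    using gf fg by (auto simp: image_iff) metis
  have "open (f ` \<Omega>)"
    unfolding im using cg assms(1) by (simp add: continuous_on_open_vimage open_vimage)
  have "homeomorphism \<Omega> (f ` \<Omega>) f g"
    unfolding homeomorphism_def using gf fg cf cg by (auto simp: image_image)
  then have "\<Omega> homeomorphic (f ` \<Omega>)"
    unfolding homeomorphic_def by blast
  then have sc: "simply_connected (f ` \<Omega>)"
    using assms(2) homeomorphic_simply_connected by blast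
  have fz: "f z \<in> - f ` \<Omega>"
    using assms(3) gf unfolding im by simp
  let ?C = "connected_component_set (- f ` \<Omega>) (f z)"
  have "?C \<in> components (- f ` \<Omega>)"
    using fz by (rule componentsI)
  then have unb: "\<not> bounded ?C"
    using sc simply_connected_eq_unbounded_complement_components[OF \<open>open (f ` \<Omega>)\<close>] by auto
  have "connected (g ` ?C)"
    by (intro connected_continuous_image cg connected_connected_component)
  moreover have "z \<in> g ` ?C"
    using fz gf by (metis connected_component_refl_eq image_eqI mem_Collect_eq)
  moreover have "g ` ?C \<subseteq> - \<Omega>"
    using connected_component_subset[of "- f ` \<Omega>" "f z"] unfolding im by auto
  ultimately have "g ` ?C \<subseteq> connected_component_set (- \<Omega>) z"
    by (intro connected_component_maximal)
  then have "bounded (f ` g ` ?C)"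
    using bd bl(1) bounded_linear_image bounded_subset by blast
  then show False
    using unb fg by (simp add: image_image)
qed

text \<open>Otherwise the four lines bound a rectangle that traps the component of the complement containing
  the given point, although that component is unbounded.\<close>

lemma lines_meet_complement:
  fixes \<Omega> :: "(real ^ 2) set"
  assumes "open \<Omega>" "simply_connected \<Omega>" "pt z1 z2 \<notin> \<Omega>" "a < z1" "z1 < a'" "b < z2" "z2 < b'"
  shows "(\<forall>c. a < c \<and> c < z1 \<longrightarrow> (\<exists>t\<in>{b..<b'}. pt c t \<notin> \<Omega>)) \<or>
    (\<forall>c. z1 < c \<and> c < a' \<longrightarrow> (\<exists>t\<in>{b..<b'}. pt c t \<notin> \<Omega>)) \<or>
    (\<forall>d. b < d \<and> d < z2 \<longrightarrow> (\<exists>t\<in>{a..<a'}. pt t d \<notin> \<Omega>)) \<or>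
    (\<forall>d. z2 < d \<and> d < b' \<longrightarrow> (\<exists>t\<in>{a..<a'}. pt t d \<notin> \<Omega>))"
proof (rule ccontr)
  assume "\<not> ?thesis"
  \<comment> \<open>Each negated disjunct supplies a segment inside \<open>\<Omega>\<close>: two
    vertical ones at \<open>c1 < z1 < c2\<close> and two horizontal ones at
    \<open>d1 < z2 < d2\<close>.\<close>
  then obtain c1 c2 d1 d2 where
    c: "a < c1" "c1 < z1" "z1 < c2" "c2 < a'" and d: "b < d1" "d1 < z2" "z2 < d2" "d2 < b'"
    and in_\<Omega>: "\<And>t. t \<in> {b..<b'} \<Longrightarrow> pt c1 t \<in> \<Omega>" "\<And>t. t \<in> {b..<b'} \<Longrightarrow> pt c2 t \<in> \<Omega>"
      "\<And>t. t \<in> {a..<a'} \<Longrightarrow> pt t d1 \<in> \<Omega>" "\<And>t. t \<in> {a..<a'} \<Longrightarrow> pt t d2 \<in> \<Omega>"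
    by metis
  let ?R = "box (pt c1 d1) (pt c2 d2)"
  let ?C = "connected_component_set (- \<Omega>) (pt z1 z2)"
  have mem_R: "v \<in> ?R \<longleftrightarrow> c1 < v $ 1 \<and> v $ 1 < c2 \<and> d1 < v $ 2 \<and> v $ 2 < d2" for v
    by (auto simp: mem_box_cart forall_2)
  have mem_cR: "v \<in> cbox (pt c1 d1) (pt c2 d2) \<longleftrightarrow> c1 \<le> v $ 1 \<and> v $ 1 \<le> c2 \<and> d1 \<le> v $ 2 \<and> v $ 2 \<le> d2" for v
    by (auto simp: mem_box_cart forall_2)
  have "pt z1 z2 \<in> ?C \<inter> ?R"
    using assms(3) c d by (auto simp: mem_R)
  moreover have "?C - ?R \<noteq> {}"
    using unbounded_complement_component[OF assms(1-3)] bounded_subset[OF bounded_box] by blast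
  \<comment> \<open>A connected set that meets the rectangle and leaves it meets its frontier, which
    lies on the four segments.\<close>
  ultimately have "?C \<inter> frontier ?R \<noteq> {}"
    using connected_Int_frontier[OF connected_connected_component] by blast
  then obtain v where v: "v \<in> ?C" "v \<in> frontier ?R"
    by blast
  have "?R \<noteq> {}"
    using \<open>pt z1 z2 \<in> ?C \<inter> ?R\<close> by blast
  then have "v \<in> cbox (pt c1 d1) (pt c2 d2)" "v \<notin> ?R"
    using v(2) by (simp_all add: frontier_def closure_box interior_open[OF open_box])
  then have "v $ 1 = c1 \<or> v $ 1 = c2 \<or> v $ 2 = d1 \<or> v $ 2 = d2" and
    r: "c1 \<le> v $ 1" "v $ 1 \<le> c2" "d1 \<le> v $ 2" "v $ 2 \<le> d2"
    unfolding mem_R mem_cR by auto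
  then have "pt (v $ 1) (v $ 2) \<in> \<Omega>"
    using in_\<Omega>[of "v $ 2"] in_\<Omega>(3,4)[of "v $ 1"] c d by auto
  then show False
    using v(1) connected_component_subset[of "- \<Omega>" "pt z1 z2"] by auto
qed

text \<open>\<open>F\<close> stands for the absolute value of a function, \<open>G1\<close> and
  \<open>G2\<close> for those of its partial derivatives. From \<open>(x, y)\<close> one moves along
  the first coordinate to \<open>(c, y)\<close>, at cost \<open>B y\<close>, and from there along
  the second to a zero, at cost \<open>A c\<close>. Averaging over \<open>c\<close> in a strip at
  least a quarter as wide as the square gives the bound. Values in \<open>ennreal\<close> avoid
  integrability conditions.\<close>

lemma rectangle_Poincare:
  fixes F G1 G2 :: "real \<Rightarrow> real \<Rightarrow> ennreal"
  assumes [measurable]: "case_prod F \<in> borel_measurable (lborel \<Otimes>\<^sub>M lborel)"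
    "case_prod G1 \<in> borel_measurable (lborel \<Otimes>\<^sub>M lborel)" "case_prod G2 \<in> borel_measurable (lborel \<Otimes>\<^sub>M lborel)"
    "I \<in> sets borel" "J \<in> sets borel"
    and I: "emeasure lborel I = ennreal s" and J: "emeasure lborel J = ennreal s"
    and \<alpha>\<beta>: "{\<alpha><..<\<beta>} \<subseteq> I" "\<alpha> < \<beta>" "s \<le> 4 * (\<beta> - \<alpha>)"
    and h1: "\<And>x x' y. x \<in> I \<Longrightarrow> x' \<in> I \<Longrightarrow> y \<in> J \<Longrightarrow> F x y \<le> F x' y + (\<integral>\<^sup>+\<sigma>. G1 \<sigma> y * indicator I \<sigma> \<partial>lborel)"
    and h2: "\<And>c y. c \<in> {\<alpha><..<\<beta>} \<Longrightarrow> y \<in> J \<Longrightarrow> F c y \<le> (\<integral>\<^sup>+\<tau>. G2 c \<tau> * indicator J \<tau> \<partial>lborel)"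
  shows "(\<integral>\<^sup>+x. \<integral>\<^sup>+y. F x y * (indicator I x * indicator J y) \<partial>lborel \<partial>lborel) \<le>
    4 * ennreal s * (\<integral>\<^sup>+x. \<integral>\<^sup>+y. (G1 x y + G2 x y) * (indicator I x * indicator J y) \<partial>lborel \<partial>lborel)"
proof -
  define d where "d = ennreal (\<beta> - \<alpha>)"
  define S where "S = ennreal s"
  define A where "A c = (\<integral>\<^sup>+\<tau>. G2 c \<tau> * indicator J \<tau> \<partial>lborel)" for c
  define B where "B y = (\<integral>\<^sup>+\<sigma>. G1 \<sigma> y * indicator I \<sigma> \<partial>lborel)" for y
  have [measurable]: "A \<in> borel_measurable lborel" "B \<in> borel_measurable lborel"
    unfolding A_def[abs_def] B_def[abs_def] by measurable
  define K1 where "K1 = (\<integral>\<^sup>+y. B y * indicator J y \<partial>lborel)"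
  define K2 where "K2 = (\<integral>\<^sup>+c. A c * indicator I c \<partial>lborel)"
  have d: "d \<noteq> 0" "d \<noteq> top" "S \<le> 4 * d"
    using \<alpha>\<beta> by (auto simp: d_def S_def ennreal_mult''[symmetric] intro!: ennreal_leI
        simp flip: ennreal_numeral)
  have step1: "d * F x y \<le> K2 + d * B y" if "x \<in> I" "y \<in> J" for x y
  proof -
    have "d * F x y = (\<integral>\<^sup>+c. F x y * indicator {\<alpha><..<\<beta>} c \<partial>lborel)"
      using \<alpha>\<beta> by (simp add: nn_integral_cmult d_def mult.commute)
    also have "\<dots> \<le> (\<integral>\<^sup>+c. A c * indicator I c + B y * indicator {\<alpha><..<\<beta>} c \<partial>lborel)"
    proof (rule nn_integral_mono)
      fix c
      show "F x y * indicator {\<alpha><..<\<beta>} c \<le> A c * indicator I c + B y * indicator {\<alpha><..<\<beta>} c"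
      proof (cases "c \<in> {\<alpha><..<\<beta>}")
        case True
        then have "c \<in> I"
          using \<alpha>\<beta>(1) by blast
        then have "F x y \<le> F c y + B y" "F c y \<le> A c"
          using h1[OF that(1) _ that(2)] h2[OF True that(2)] by (simp_all add: A_def B_def)
        then have "F x y \<le> A c + B y"
          by (meson add_right_mono order_trans)
        then show ?thesis
          using True \<open>c \<in> I\<close> by simp
      qed simp
    qed
    also have "\<dots> = K2 + d * B y"
      using \<alpha>\<beta> by (simp add: nn_integral_add nn_integral_cmult K2_def d_def mult.commute)
    finally show ?thesis .
  qed
  have "d * (\<integral>\<^sup>+x. \<integral>\<^sup>+y. F x y * (indicator I x * indicator J y) \<partial>lborel \<partial>lborel) =
      (\<integral>\<^sup>+x. \<integral>\<^sup>+y. d * F x y * (indicator I x * indicator J y) \<partial>lborel \<partial>lborel)"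
    by (simp add: nn_integral_cmult mult.assoc)
  also have "\<dots> \<le> (\<integral>\<^sup>+x. \<integral>\<^sup>+y. (K2 + d * B y) * (indicator I x * indicator J y) \<partial>lborel \<partial>lborel)"
    using step1 by (intro nn_integral_mono) (simp add: indicator_def)
  also have "\<dots> = (\<integral>\<^sup>+x. (\<integral>\<^sup>+y. K2 * indicator J y + d * (B y * indicator J y) \<partial>lborel) * indicator I x \<partial>lborel)"
    by (intro nn_integral_cong) (simp add: indicator_def algebra_simps)
  also have "\<dots> = (K2 * S + d * K1) * S"
    by (simp add: nn_integral_add nn_integral_cmult K1_def I J S_def)
  \<comment> \<open>\<open>S \<le> 4 * d\<close> in the first summand and \<open>1 \<le> 4\<close>
    in the second produce a common factor \<open>d\<close>, which cancels.\<close>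
  also have "\<dots> \<le> (K2 * (4 * d) + (4 * d) * K1) * S"
    using d(3) mult_right_mono[of 1 4 d] by (intro mult_right_mono add_mono mult_left_mono) auto
  also have "\<dots> = d * (4 * S * (K1 + K2))"
    by (simp add: algebra_simps)
  finally have *: "(\<integral>\<^sup>+x. \<integral>\<^sup>+y. F x y * (indicator I x * indicator J y) \<partial>lborel \<partial>lborel) \<le> 4 * S * (K1 + K2)"
    using d by (simp add: ennreal_mult_le_mult_iff)
  have "K1 = (\<integral>\<^sup>+y. \<integral>\<^sup>+x. G1 x y * (indicator I x * indicator J y) \<partial>lborel \<partial>lborel)"
    unfolding K1_def B_def by (intro nn_integral_cong) (simp add: indicator_def)
  also have "\<dots> = (\<integral>\<^sup>+x. \<integral>\<^sup>+y. G1 x y * (indicator I x * indicator J y) \<partial>lborel \<partial>lborel)"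
    by (rule lborel_pair.Fubini') measurable
  finally have 1: "K1 = (\<integral>\<^sup>+x. \<integral>\<^sup>+y. G1 x y * (indicator I x * indicator J y) \<partial>lborel \<partial>lborel)" .
  have 2: "K2 = (\<integral>\<^sup>+x. \<integral>\<^sup>+y. G2 x y * (indicator I x * indicator J y) \<partial>lborel \<partial>lborel)"
    unfolding K2_def A_def by (intro nn_integral_cong) (simp add: indicator_def)
  have "K1 + K2 = (\<integral>\<^sup>+x. \<integral>\<^sup>+y. (G1 x y + G2 x y) * (indicator I x * indicator J y) \<partial>lborel \<partial>lborel)"
    unfolding 1 2 by (simp add: nn_integral_add distrib_right)
  then show ?thesis
    using * by (simp add: S_def)
qed

text \<open>The fundamental theorem of calculus between \<open>s\<close> and \<open>t\<close>, with
  the integral enlarged to the whole half-open side so that the bound no longer depends on the two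
  points.\<close>

lemma increment_le_nn_integral:
  fixes h h' :: "real \<Rightarrow> real"
  assumes der: "\<And>t. (h has_real_derivative h' t) (at t)" and c: "continuous_on UNIV h'"
    and st: "s \<in> {b..<b'}" "t \<in> {b..<b'}"
  shows "ennreal \<bar>h s - h t\<bar> \<le> (\<integral>\<^sup>+x. ennreal \<bar>h' x\<bar> * indicator {b..<b'} x \<partial>lborel)"
proof -
  have *: "ennreal \<bar>h v - h u\<bar> \<le> (\<integral>\<^sup>+x. ennreal \<bar>h' x\<bar> * indicator {b..<b'} x \<partial>lborel)"
    if "u \<le> v" "b \<le> u" "v < b'" for u v
  proof -
    have c': "continuous_on {u..v} h'"
      using c by (rule continuous_on_subset) simp
    have "h v - h u = (LINT x|lborel. indicator {u..v} x *\<^sub>R h' x)"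
      using der c' that(1)
      by (intro integral_FTC_atLeastAtMost[symmetric])
        (auto simp: has_real_derivative_iff_has_vector_derivative intro: has_vector_derivative_at_within)
    moreover have "integrable lborel (\<lambda>x. indicator {u..v} x *\<^sub>R h' x)"
      by (rule borel_integrable_compact[OF _ c']) simp
    ultimately have "ennreal \<bar>h v - h u\<bar> \<le> (\<integral>\<^sup>+x. norm (indicator {u..v} x *\<^sub>R h' x) \<partial>lborel)"
      using integral_norm_bound_ennreal by (metis real_norm_def)
    also have "\<dots> \<le> (\<integral>\<^sup>+x. ennreal \<bar>h' x\<bar> * indicator {b..<b'} x \<partial>lborel)"
      using that by (intro nn_integral_mono) (auto simp: indicator_def)
    finally show ?thesis .
  qed
  show ?thesis
    using *[of s t] *[of t s] st by (cases "s \<le> t") (auto simp: abs_minus_commute)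
qed

section \<open>Tonelli's theorem in the plane and the tiling by squares\<close>

lemma lborel_eq_distr_pt:
  "(lborel :: (real ^ 2) measure) = distr (lborel \<Otimes>\<^sub>M lborel) borel (case_prod pt)"
proof (rule lborel_eqI)
  have cont: "continuous_on UNIV (\<lambda>z. pt (fst z) (snd z))"
    unfolding pt_def by (intro continuous_intros)
  then have m: "case_prod pt \<in> borel_measurable borel"
    by (simp add: borel_measurable_continuous_onI case_prod_beta')
  then have meas: "case_prod pt \<in> measurable (lborel \<Otimes>\<^sub>M lborel) borel"
    by (simp add: lborel_prod)
  fix l u :: "real ^ 2" assume lu: "\<And>b. b \<in> Basis \<Longrightarrow> l \<bullet> b \<le> u \<bullet> b"
  have le: "l $ 1 \<le> u $ 1" "l $ 2 \<le> u $ 2"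
    using lu[of "axis 1 1"] lu[of "axis 2 1"] by (simp_all add: in_Basis_vec2 inner_axis)
  have "emeasure (distr (lborel \<Otimes>\<^sub>M lborel) borel (case_prod pt)) (box l u) =
      emeasure (lborel \<Otimes>\<^sub>M lborel) ({l $ 1<..<u $ 1} \<times> {l $ 2<..<u $ 2})"
    by (subst emeasure_distr[OF meas])
      (auto simp: mem_box_cart forall_2 space_pair_measure intro!: arg_cong2[where f=emeasure])
  also have "\<dots> = ennreal (u $ 1 - l $ 1) * ennreal (u $ 2 - l $ 2)"
    using le by (simp add: lborel.emeasure_pair_measure_Times)
  also have "\<dots> = ennreal ((u $ 1 - l $ 1) * (u $ 2 - l $ 2))"
    using le by (simp add: ennreal_mult)
  also have "(u $ 1 - l $ 1) * (u $ 2 - l $ 2) = (\<Prod>b\<in>Basis. (u - l) \<bullet> b)"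
  proof -
    have B: "Basis = {axis 1 1, axis 2 1 :: real ^ 2}"
      using in_Basis_vec2 by auto
    have "axis 1 1 \<noteq> (axis 2 1 :: real ^ 2)"
      by (simp add: axis_eq_axis)
    then show ?thesis
      unfolding B by (simp add: inner_axis)
  qed
  finally show "emeasure (distr (lborel \<Otimes>\<^sub>M lborel) borel (case_prod pt)) (box l u) =
      ennreal (\<Prod>b\<in>Basis. (u - l) \<bullet> b)"
    by simp
qed simp

lemma nn_integral_lborel_vec2:
  assumes "f \<in> borel_measurable (borel :: (real ^ 2) measure)"
  shows "(\<integral>\<^sup>+v. f v \<partial>lborel) = (\<integral>\<^sup>+x. \<integral>\<^sup>+y. f (pt x y) \<partial>lborel \<partial>lborel)"
proof -
  have "continuous_on UNIV (\<lambda>z. pt (fst z) (snd z))"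
    unfolding pt_def by (intro continuous_intros)
  then have "case_prod pt \<in> borel_measurable borel"
    by (simp add: borel_measurable_continuous_onI case_prod_beta')
  then have meas: "case_prod pt \<in> measurable (lborel \<Otimes>\<^sub>M lborel) borel"
    by (simp add: lborel_prod)
  have "(\<integral>\<^sup>+v. f v \<partial>lborel) = (\<integral>\<^sup>+z. f (case_prod pt z) \<partial>(lborel \<Otimes>\<^sub>M lborel))"
    unfolding lborel_eq_distr_pt by (rule nn_integral_distr[OF meas]) (simp add: assms)
  also have "\<dots> = (\<integral>\<^sup>+x. \<integral>\<^sup>+y. f (pt x y) \<partial>lborel \<partial>lborel)"
    by (subst lborel.nn_integral_fst[symmetric]) (use measurable_compose[OF meas assms] in auto)
  finally show ?thesis .
qed

text \<open>Countable additivity of the measures with densities \<open>f\<close> and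
  \<open>g\<close> turns estimates on the tiles into one on the whole space with the same
  constant.\<close>

lemma nn_integral_le_of_partition:
  fixes f g :: "'a \<Rightarrow> ennreal" and Q :: "'i :: countable \<Rightarrow> 'a set"
  assumes f: "f \<in> borel_measurable M" and g: "g \<in> borel_measurable M"
    and Q: "\<And>i. Q i \<in> sets M" "disjoint_family Q" "(\<Union>i. Q i) = space M"
    and le: "\<And>i. (\<integral>\<^sup>+x. f x * indicator (Q i) x \<partial>M) \<le> C * (\<integral>\<^sup>+x. g x * indicator (Q i) x \<partial>M)"
  shows "(\<integral>\<^sup>+x. f x \<partial>M) \<le> C * (\<integral>\<^sup>+x. g x \<partial>M)"
proof -
  have eq: "(\<integral>\<^sup>+x. h x \<partial>M) = (\<integral>\<^sup>+i. (\<integral>\<^sup>+x. h x * indicator (Q i) x \<partial>M) \<partial>count_space UNIV)"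
    if h: "h \<in> borel_measurable M" for h :: "'a \<Rightarrow> ennreal"
  proof -
    have "(\<integral>\<^sup>+x. h x \<partial>M) = emeasure (density M h) (\<Union>i. Q i)"
      unfolding Q(3) using h by (subst emeasure_density) (auto intro!: nn_integral_cong)
    also have "\<dots> = (\<integral>\<^sup>+i. emeasure (density M h) (Q i) \<partial>count_space UNIV)"
      by (rule emeasure_UN_countable) (use Q in auto)
    also have "\<dots> = (\<integral>\<^sup>+i. (\<integral>\<^sup>+x. h x * indicator (Q i) x \<partial>M) \<partial>count_space UNIV)"
      using h Q by (simp add: emeasure_density)
    finally show ?thesis .
  qed
  have "(\<integral>\<^sup>+x. f x \<partial>M) \<le> (\<integral>\<^sup>+i. C * (\<integral>\<^sup>+x. g x * indicator (Q i) x \<partial>M) \<partial>count_space UNIV)"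
    unfolding eq[OF f] by (intro nn_integral_mono le)
  also have "\<dots> = C * (\<integral>\<^sup>+x. g x \<partial>M)"
    unfolding eq[OF g] by (rule nn_integral_cmult) simp
  finally show ?thesis .
qed

lemma square_tiling:
  fixes s :: real
  assumes "0 < s"
  defines "T \<equiv> \<lambda>i :: int. {of_int i * s..<(of_int i + 1) * s}"
  defines "Q \<equiv> \<lambda>(i, j). {v :: real ^ 2. v $ 1 \<in> T i \<and> v $ 2 \<in> T j}"
  shows "Q k \<in> sets borel" "disjoint_family Q" "(\<Union>k. Q k) = UNIV"
proof -
  \<comment> \<open>Half-open intervals make membership a statement about a floor, which gives
    disjointness and covering at once.\<close>
  have T: "x \<in> T i \<longleftrightarrow> i = \<lfloor>x / s\<rfloor>" for x i
    unfolding T_def using assms(1) by (auto simp: floor_eq_iff le_divide_eq divide_less_eq eq_commute[of i])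
  have "Q k = (\<lambda>v. v $ 1) -` T (fst k) \<inter> (\<lambda>v. v $ 2) -` T (snd k)"
    by (auto simp: Q_def split: prod.splits)
  moreover have "(\<lambda>v :: real ^ 2. v $ i) \<in> borel_measurable borel" for i
    by (intro borel_measurable_continuous_onI continuous_intros)
  ultimately show "Q k \<in> sets borel"
    unfolding T_def by (auto intro!: sets.Int measurable_sets_borel[where A=borel])
  show "disjoint_family Q"
    unfolding disjoint_family_on_def Q_def by (auto simp: T)
  show "(\<Union>k. Q k) = UNIV"
    unfolding Q_def by (auto simp: T)
qed

lemma measurable_pt:
  fixes k :: "real ^ 2 \<Rightarrow> real"
  assumes "continuous_on UNIV k"
  shows "(\<lambda>(x, y). ennreal \<bar>k (pt x y)\<bar>) \<in> borel_measurable (lborel \<Otimes>\<^sub>M lborel)"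
    "(\<lambda>(x, y). ennreal \<bar>k (pt y x)\<bar>) \<in> borel_measurable (lborel \<Otimes>\<^sub>M lborel)"
proof -
  have c: "continuous_on UNIV (\<lambda>z. \<bar>k (pt (fst z) (snd z))\<bar>)" "continuous_on UNIV (\<lambda>z. \<bar>k (pt (snd z) (fst z))\<bar>)"
    unfolding pt_def by (intro continuous_intros continuous_on_compose2[OF assms]; simp)+
  then show "(\<lambda>(x, y). ennreal \<bar>k (pt x y)\<bar>) \<in> borel_measurable (lborel \<Otimes>\<^sub>M lborel)"
    "(\<lambda>(x, y). ennreal \<bar>k (pt y x)\<bar>) \<in> borel_measurable (lborel \<Otimes>\<^sub>M lborel)"
    unfolding lborel_prod case_prod_beta'
    using borel_measurable_continuous_onI[OF c(1)] borel_measurable_continuous_onI[OF c(2)] by simp_all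
qed

lemma DERIV_pt:
  assumes "is_smooth p"
  shows "((\<lambda>t. p (pt c t)) has_real_derivative gradient p (pt c t) $ 2) (at t)"
    "((\<lambda>t. p (pt t c)) has_real_derivative gradient p (pt t c) $ 1) (at t)"
proof -
  have p: "(p has_derivative (\<lambda>h. h \<bullet> gradient p v)) (at v)" for v
    using is_smooth_GDERIV[OF assms] unfolding gderiv_def .
  have "(pt c has_derivative (\<lambda>h. h *\<^sub>R axis 2 1)) (at t)" "((\<lambda>t. pt t c) has_derivative (\<lambda>h. h *\<^sub>R axis 1 1)) (at t)"
    unfolding pt_def[abs_def] by (auto intro!: derivative_eq_intros)
  from has_derivative_compose[OF this(1) p] has_derivative_compose[OF this(2) p]
  show "((\<lambda>t. p (pt c t)) has_real_derivative gradient p (pt c t) $ 2) (at t)"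
    "((\<lambda>t. p (pt t c)) has_real_derivative gradient p (pt t c) $ 1) (at t)"
    by (simp_all add: has_field_derivative_def inner_axis' mult_commute_abs)
qed

lemma increments_pt:
  assumes "is_smooth p"
  shows "s \<in> {b..<b'} \<Longrightarrow> t \<in> {b..<b'} \<Longrightarrow> ennreal \<bar>p (pt c s) - p (pt c t)\<bar> \<le>
      (\<integral>\<^sup>+x. ennreal \<bar>gradient p (pt c x) $ 2\<bar> * indicator {b..<b'} x \<partial>lborel)"
    "s \<in> {b..<b'} \<Longrightarrow> t \<in> {b..<b'} \<Longrightarrow> ennreal \<bar>p (pt s c) - p (pt t c)\<bar> \<le>
      (\<integral>\<^sup>+x. ennreal \<bar>gradient p (pt x c) $ 1\<bar> * indicator {b..<b'} x \<partial>lborel)"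
proof -
  have "continuous_on UNIV (\<lambda>t. gradient p (pt c t) $ 2)" "continuous_on UNIV (\<lambda>t. gradient p (pt t c) $ 1)"
    unfolding pt_def
    by (intro continuous_intros continuous_on_compose2[OF is_smooth_continuous_gradient[OF assms, of UNIV]]; simp)+
  from increment_le_nn_integral[OF DERIV_pt(1)[OF assms] this(1)] increment_le_nn_integral[OF DERIV_pt(2)[OF assms] this(2)]
  show "s \<in> {b..<b'} \<Longrightarrow> t \<in> {b..<b'} \<Longrightarrow> ennreal \<bar>p (pt c s) - p (pt c t)\<bar> \<le>
      (\<integral>\<^sup>+x. ennreal \<bar>gradient p (pt c x) $ 2\<bar> * indicator {b..<b'} x \<partial>lborel)"
    "s \<in> {b..<b'} \<Longrightarrow> t \<in> {b..<b'} \<Longrightarrow> ennreal \<bar>p (pt s c) - p (pt t c)\<bar> \<le>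
      (\<integral>\<^sup>+x. ennreal \<bar>gradient p (pt x c) $ 1\<bar> * indicator {b..<b'} x \<partial>lborel)"
    by auto
qed

lemma ennreal_abs_triangle: "ennreal \<bar>u - v\<bar> \<le> K \<Longrightarrow> ennreal \<bar>u\<bar> \<le> ennreal \<bar>v\<bar> + K"
proof -
  assume "ennreal \<bar>u - v\<bar> \<le> K"
  have "ennreal \<bar>u\<bar> \<le> ennreal (\<bar>v\<bar> + \<bar>u - v\<bar>)"
    by (intro ennreal_leI) linarith
  also have "\<dots> = ennreal \<bar>v\<bar> + ennreal \<bar>u - v\<bar>"
    by (simp add: ennreal_plus)
  also have "\<dots> \<le> ennreal \<bar>v\<bar> + K"
    by (intro add_left_mono) fact
  finally show ?thesis .
qed

text \<open>The disc of radius \<open>\<rho>\<close> about the centre contains a point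
  \<open>z\<close> outside \<open>\<Omega>\<close>, and \<open>z\<close> has distance at least
  \<open>\<rho>\<close> from every side of the square of side \<open>4 * \<rho>\<close>. So
  whichever of the four strips \<open>lines_meet_complement\<close> offers, its width is at least a
  quarter of the side.\<close>

lemma square_Poincare:
  fixes \<Omega> :: "(real ^ 2) set"
  assumes \<Omega>: "open \<Omega>" "simply_connected \<Omega>" and p: "p \<in> test_functions \<Omega>" and "0 < \<rho>"
    and not_sub: "\<not> cball (pt (a + 2 * \<rho>) (b + 2 * \<rho>)) \<rho> \<subseteq> \<Omega>"
  defines "I \<equiv> {a..<a + 4 * \<rho>}" and "J \<equiv> {b..<b + 4 * \<rho>}"
  shows "(\<integral>\<^sup>+x. \<integral>\<^sup>+y. ennreal \<bar>p (pt x y)\<bar> * (indicator I x * indicator J y) \<partial>lborel \<partial>lborel) \<le>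
    4 * ennreal (4 * \<rho>) * (\<integral>\<^sup>+x. \<integral>\<^sup>+y. (ennreal \<bar>gradient p (pt x y) $ 1\<bar> + ennreal \<bar>gradient p (pt x y) $ 2\<bar>) *
      (indicator I x * indicator J y) \<partial>lborel \<partial>lborel)"
proof -
  note s = test_functions_smooth[OF p]
  note p0 = test_functions_zero[OF p]
  obtain z where z: "z \<in> cball (pt (a + 2 * \<rho>) (b + 2 * \<rho>)) \<rho>" "z \<notin> \<Omega>"
    using not_sub by blast
  define z1 z2 where "z1 = z $ 1" and "z2 = z $ 2"
  have "\<bar>(z - pt (a + 2 * \<rho>) (b + 2 * \<rho>)) $ i\<bar> \<le> \<rho>" for i
    using z(1) component_le_norm_cart[of "z - pt (a + 2 * \<rho>) (b + 2 * \<rho>)" i]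
    by (simp add: dist_norm norm_minus_commute)
  from this[of 1] this[of 2] have z12: "a + \<rho> \<le> z1" "z1 \<le> a + 3 * \<rho>" "b + \<rho> \<le> z2" "z2 \<le> b + 3 * \<rho>"
    by (auto simp: z1_def z2_def abs_le_iff)
  have "pt z1 z2 \<notin> \<Omega>"
    using z(2) by (simp add: z1_def z2_def)
  note lines = lines_meet_complement[OF \<Omega> this, of a "a + 4 * \<rho>" b "b + 4 * \<rho>"]
  have cp: "continuous_on UNIV p" "continuous_on UNIV (\<lambda>v. gradient p v $ i)" for i
    using is_smooth_continuous[OF s] by (auto intro!: continuous_intros is_smooth_continuous_gradient[OF s])
  note meas = measurable_pt(1)[OF cp(1)] measurable_pt(1)[OF cp(2)[of 1]] measurable_pt(1)[OF cp(2)[of 2]]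
    measurable_pt(2)[OF cp(1)] measurable_pt(2)[OF cp(2)[of 2]] measurable_pt(2)[OF cp(2)[of 1]]
  have IJ: "I \<in> sets borel" "J \<in> sets borel" "emeasure lborel I = ennreal (4 * \<rho>)" "emeasure lborel J = ennreal (4 * \<rho>)"
    using \<open>0 < \<rho>\<close> by (simp_all add: I_def J_def)
  have vertical: ?thesis if "{\<alpha><..<\<beta>} \<subseteq> I" "\<alpha> < \<beta>" "4 * \<rho> \<le> 4 * (\<beta> - \<alpha>)"
    and hit: "\<And>c. c \<in> {\<alpha><..<\<beta>} \<Longrightarrow> \<exists>t\<in>J. pt c t \<notin> \<Omega>" for \<alpha> \<beta>
  proof (rule rectangle_Poincare[OF meas(1-3) IJ that(1-3)])
    show "ennreal \<bar>p (pt x y)\<bar> \<le> ennreal \<bar>p (pt x' y)\<bar> + (\<integral>\<^sup>+\<sigma>. ennreal \<bar>gradient p (pt \<sigma> y) $ 1\<bar> * indicator I \<sigma> \<partial>lborel)"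
      if "x \<in> I" "x' \<in> I" for x x' y
      using that unfolding I_def by (intro ennreal_abs_triangle increments_pt(2)[OF s])
    fix c y assume c: "c \<in> {\<alpha><..<\<beta>}" and y: "y \<in> J"
    obtain t where t: "t \<in> J" "pt c t \<notin> \<Omega>"
      using hit[OF c] by blast
    show "ennreal \<bar>p (pt c y)\<bar> \<le> (\<integral>\<^sup>+\<tau>. ennreal \<bar>gradient p (pt c \<tau>) $ 2\<bar> * indicator J \<tau> \<partial>lborel)"
      using increments_pt(1)[OF s, of y b "b + 4 * \<rho>" t c] y t p0[OF t(2)] by (simp add: J_def)
  qed
  \<comment> \<open>The same estimate with the coordinates exchanged; Tonelli restores the order of
    integration.\<close>
  have horizontal: ?thesis if "{\<alpha><..<\<beta>} \<subseteq> J" "\<alpha> < \<beta>" "4 * \<rho> \<le> 4 * (\<beta> - \<alpha>)"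
    and hit: "\<And>c. c \<in> {\<alpha><..<\<beta>} \<Longrightarrow> \<exists>t\<in>I. pt t c \<notin> \<Omega>" for \<alpha> \<beta>
  proof -
    have "(\<integral>\<^sup>+y. \<integral>\<^sup>+x. ennreal \<bar>p (pt x y)\<bar> * (indicator J y * indicator I x) \<partial>lborel \<partial>lborel) \<le>
      4 * ennreal (4 * \<rho>) * (\<integral>\<^sup>+y. \<integral>\<^sup>+x. (ennreal \<bar>gradient p (pt x y) $ 2\<bar> + ennreal \<bar>gradient p (pt x y) $ 1\<bar>) *
        (indicator J y * indicator I x) \<partial>lborel \<partial>lborel)"
    proof (rule rectangle_Poincare[OF meas(4-6) IJ(2,1,4,3) that(1-3)])
      show "ennreal \<bar>p (pt x y)\<bar> \<le> ennreal \<bar>p (pt x y')\<bar> + (\<integral>\<^sup>+\<sigma>. ennreal \<bar>gradient p (pt x \<sigma>) $ 2\<bar> * indicator J \<sigma> \<partial>lborel)"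
        if "y \<in> J" "y' \<in> J" for y y' x
        using that unfolding J_def by (intro ennreal_abs_triangle increments_pt(1)[OF s])
      fix c x assume c: "c \<in> {\<alpha><..<\<beta>}" and x: "x \<in> I"
      obtain t where t: "t \<in> I" "pt t c \<notin> \<Omega>"
        using hit[OF c] by blast
      show "ennreal \<bar>p (pt x c)\<bar> \<le> (\<integral>\<^sup>+\<tau>. ennreal \<bar>gradient p (pt \<tau> c) $ 1\<bar> * indicator I \<tau> \<partial>lborel)"
        using increments_pt(2)[OF s, of x a "a + 4 * \<rho>" t c] x t p0[OF t(2)] by (simp add: I_def)
    qed
    moreover have [measurable]: "I \<in> sets borel" "J \<in> sets borel"
      by (fact IJ)+
    have "(\<integral>\<^sup>+y. \<integral>\<^sup>+x. ennreal \<bar>p (pt x y)\<bar> * (indicator J y * indicator I x) \<partial>lborel \<partial>lborel) =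
      (\<integral>\<^sup>+x. \<integral>\<^sup>+y. ennreal \<bar>p (pt x y)\<bar> * (indicator I x * indicator J y) \<partial>lborel \<partial>lborel)"
      by (subst lborel_pair.Fubini') (use meas(1) in \<open>measurable\<close>, simp add: mult.commute)
    moreover have "(\<integral>\<^sup>+y. \<integral>\<^sup>+x. (ennreal \<bar>gradient p (pt x y) $ 2\<bar> + ennreal \<bar>gradient p (pt x y) $ 1\<bar>) *
        (indicator J y * indicator I x) \<partial>lborel \<partial>lborel) =
      (\<integral>\<^sup>+x. \<integral>\<^sup>+y. (ennreal \<bar>gradient p (pt x y) $ 1\<bar> + ennreal \<bar>gradient p (pt x y) $ 2\<bar>) *
        (indicator I x * indicator J y) \<partial>lborel \<partial>lborel)"
      by (subst lborel_pair.Fubini') (use meas(2,3) in \<open>measurable\<close>, simp add: mult.commute add.commute)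
    ultimately show ?thesis
      by simp
  qed
  have "a < z1" "z1 < a + 4 * \<rho>" "b < z2" "z2 < b + 4 * \<rho>"
    using z12 \<open>0 < \<rho>\<close> by linarith+
  from lines[OF this] show ?thesis
  proof (elim disjE)
    assume *: "\<forall>c. a < c \<and> c < z1 \<longrightarrow> (\<exists>t\<in>{b..<b + 4 * \<rho>}. pt c t \<notin> \<Omega>)"
    show ?thesis
      by (rule vertical[of a z1]) (use * z12 \<open>0 < \<rho>\<close> in \<open>auto simp: I_def J_def\<close>)
  next
    assume *: "\<forall>c. z1 < c \<and> c < a + 4 * \<rho> \<longrightarrow> (\<exists>t\<in>{b..<b + 4 * \<rho>}. pt c t \<notin> \<Omega>)"
    show ?thesis
      by (rule vertical[of z1 "a + 4 * \<rho>"]) (use * z12 \<open>0 < \<rho>\<close> in \<open>auto simp: I_def J_def\<close>)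
  next
    assume *: "\<forall>d. b < d \<and> d < z2 \<longrightarrow> (\<exists>t\<in>{a..<a + 4 * \<rho>}. pt t d \<notin> \<Omega>)"
    show ?thesis
      by (rule horizontal[of b z2]) (use * z12 \<open>0 < \<rho>\<close> in \<open>auto simp: I_def J_def\<close>)
  next
    assume *: "\<forall>d. z2 < d \<and> d < b + 4 * \<rho> \<longrightarrow> (\<exists>t\<in>{a..<a + 4 * \<rho>}. pt t d \<notin> \<Omega>)"
    show ?thesis
      by (rule horizontal[of z2 "b + 4 * \<rho>"]) (use * z12 \<open>0 < \<rho>\<close> in \<open>auto simp: I_def J_def\<close>)
  qed
qed

text \<open>The estimate on one square is summed over a tiling by squares of side
  \<open>4 * \<rho>\<close>. The constant is \<open>4 * 4 * 2\<close>: the factor of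
  \<open>rectangle_Poincare\<close>, the side length in units of \<open>\<rho>\<close>, and the
  bound of two partial derivatives by the norm of the gradient.\<close>

lemma Cheeger_simply_connected:
  fixes \<Omega> :: "(real ^ 2) set"
  assumes \<Omega>: "open \<Omega>" "simply_connected \<Omega>" and p: "p \<in> test_functions \<Omega>" and \<rho>: "0 < \<rho>"
    and inradius: "\<And>c. \<not> cball c \<rho> \<subseteq> \<Omega>"
  shows "(LINT v|lborel. \<bar>p v\<bar>) \<le> 32 * \<rho> * (LINT v|lborel. norm (gradient p v))"
proof -
  note s = test_functions_smooth[OF p]
  note c = is_smooth_continuous[OF s, of UNIV] is_smooth_continuous_gradient[OF s, of UNIV]
  note g0 = test_functions_gradient_zero[OF p]
  define f where "f v = ennreal \<bar>p v\<bar>" for v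
  define g where "g v = ennreal \<bar>gradient p v $ 1\<bar> + ennreal \<bar>gradient p v $ 2\<bar>" for v
  have m: "(\<lambda>v. \<bar>p v\<bar>) \<in> borel_measurable borel" "(\<lambda>v. \<bar>gradient p v $ i\<bar>) \<in> borel_measurable borel" for i
    by (auto intro!: borel_measurable_continuous_onI continuous_intros c)
  have [measurable]: "f \<in> borel_measurable lborel" "g \<in> borel_measurable lborel"
    unfolding f_def[abs_def] g_def[abs_def]
    using borel_measurable_add[OF measurable_compose[OF m(2)[of 1] measurable_ennreal] measurable_compose[OF m(2)[of 2] measurable_ennreal]]
      measurable_compose[OF m(1) measurable_ennreal]
    by simp_all
  define T where "T i = {of_int i * (4 * \<rho>)..<(of_int i + 1) * (4 * \<rho>)}" for i :: int
  define Q where "Q = (\<lambda>(i, j). {v :: real ^ 2. v $ 1 \<in> T i \<and> v $ 2 \<in> T j})"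
  have "0 < 4 * \<rho>"
    using \<rho> by simp
  note tiling = square_tiling[OF this, folded T_def Q_def]
  have T: "T i = {of_int i * (4 * \<rho>)..<of_int i * (4 * \<rho>) + 4 * \<rho>}" for i
    by (simp add: T_def algebra_simps)
  have ind: "indicator (Q (i, j)) (pt x y) = (indicator (T i) x * indicator (T j) y :: ennreal)" for i j x y
    by (simp add: Q_def indicator_def)
  have "(\<integral>\<^sup>+v. f v \<partial>lborel) \<le> (4 * ennreal (4 * \<rho>)) * (\<integral>\<^sup>+v. g v \<partial>lborel)"
  proof (rule nn_integral_le_of_partition)
    show "(\<Union>i. Q i) = space lborel" "disjoint_family Q" "Q k \<in> sets lborel" for k
      using tiling by (simp_all add: Q_def)
    fix k :: "int \<times> int"
    obtain i j where k: "k = (i, j)"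
      by (cases k)
    have [measurable]: "Q k \<in> sets borel"
      using tiling(1)[of k] by (simp add: Q_def)
    have "(\<lambda>v. f v * indicator (Q k) v) \<in> borel_measurable lborel" "(\<lambda>v. g v * indicator (Q k) v) \<in> borel_measurable lborel"
      by measurable
    then have mf: "(\<lambda>v. f v * indicator (Q k) v) \<in> borel_measurable borel"
      and mg: "(\<lambda>v. g v * indicator (Q k) v) \<in> borel_measurable borel"
      by simp_all
    show "(\<integral>\<^sup>+v. f v * indicator (Q k) v \<partial>lborel) \<le> (4 * ennreal (4 * \<rho>)) * (\<integral>\<^sup>+v. g v * indicator (Q k) v \<partial>lborel)"
      using square_Poincare[OF \<Omega> p \<rho> inradius, of "of_int i * (4 * \<rho>)" "of_int j * (4 * \<rho>)"]
      unfolding T[symmetric] nn_integral_lborel_vec2[OF mf] nn_integral_lborel_vec2[OF mg]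
      by (simp add: k ind f_def g_def)
  qed simp_all
  also have "\<dots> \<le> (4 * ennreal (4 * \<rho>)) * (\<integral>\<^sup>+v. ennreal (2 * norm (gradient p v)) \<partial>lborel)"
  proof (intro mult_left_mono nn_integral_mono)
    fix v
    have "g v = ennreal (\<bar>gradient p v $ 1\<bar> + \<bar>gradient p v $ 2\<bar>)"
      by (simp add: g_def ennreal_plus)
    also have "\<dots> \<le> ennreal (2 * norm (gradient p v))"
      using component_le_norm_cart[of "gradient p v" 1] component_le_norm_cart[of "gradient p v" 2]
      by (intro ennreal_leI) linarith
    finally show "g v \<le> ennreal (2 * norm (gradient p v))" .
  qed simp
  also have "(\<integral>\<^sup>+v. ennreal (2 * norm (gradient p v)) \<partial>lborel) = ennreal (2 * (LINT v|lborel. norm (gradient p v)))"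
  proof -
    obtain K where K: "compact K" "\<And>x. x \<notin> K \<Longrightarrow> p x = 0"
      using test_functions_supportE[OF p] by metis
    have "integrable lborel (\<lambda>v. 2 * norm (gradient p v))"
      by (rule integrable_compact_support[OF _ K(1)])
        (use c gradient_zero_outside[OF compact_imp_closed[OF K(1)] K(2)] in \<open>auto intro!: continuous_intros\<close>)
    then show ?thesis
      by (subst nn_integral_eq_integral) auto
  qed
  also have "(\<integral>\<^sup>+v. f v \<partial>lborel) = ennreal (LINT v|lborel. \<bar>p v\<bar>)"
    unfolding f_def using integrable_test_mult[OF p, of "\<lambda>v. \<bar>p v\<bar>"] c
    by (subst nn_integral_eq_integral) (auto intro!: continuous_intros)
  also have "(4 * ennreal (4 * \<rho>)) * ennreal (2 * (LINT v|lborel. norm (gradient p v))) =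
      ennreal (32 * \<rho> * (LINT v|lborel. norm (gradient p v)))"
    using \<rho> by (simp add: ennreal_mult'[symmetric] integral_nonneg_AE flip: ennreal_numeral)
  finally show ?thesis
    using \<rho> by (simp add: integral_nonneg_AE)
qed

section \<open>Stability of the lower bound\<close>

text \<open>Picone's identity: the left side is \<open>F^2\<close> times the squared norm of the
  gradient of \<open>u / F\<close>, and on the right \<open>dF\<close> is paired with the gradient
  of \<open>u^2 / F\<close>.\<close>

lemma gradient_identity:
  fixes du dF :: "'a::real_inner" and u F :: real
  assumes "F \<noteq> 0"
  shows "(norm (du - (u / F) *\<^sub>R dF))\<^sup>2 = (norm du)\<^sup>2 - dF \<bullet> ((2 * u / F) *\<^sub>R du - (u\<^sup>2 / F\<^sup>2) *\<^sub>R dF)"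
  unfolding power2_norm_eq_inner
  using assms by (simp add: inner_diff_left inner_diff_right inner_commute power2_eq_square field_simps)

lemma weighted_AM_GM:
  fixes x y k :: real
  assumes "0 < k"
  shows "2 * (x * y) \<le> k * x\<^sup>2 + y\<^sup>2 / k"
proof -
  have "0 \<le> (k * x - y)\<^sup>2 / k"
    using assms by simp
  also have "\<dots> = k * x\<^sup>2 - 2 * (x * y) + y\<^sup>2 / k"
    using assms by (simp add: power2_eq_square field_simps)
  finally show ?thesis by simp
qed

text \<open>\<open>X\<close> is the density of the excess. It splits into nonnegative parts,
  \<open>e1\<close> being \<open>F^2\<close> times the squared gradient of \<open>u / F\<close> and
  \<open>e2 = (u^2 / F) (1 - F / B)\<close>. \<open>L = sqrt B\<close> is the length scale; a small
  \<open>\<tau>\<close> keeps the two terms not controlled by the excess small, at the price of the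
  factor \<open>1 / \<tau>\<close> on \<open>X\<close>.\<close>

lemma core_pointwise:
  fixes du dF :: "'a::real_inner" and u F B L \<tau> :: real
  assumes F: "0 < F" "F \<le> B" and L: "0 < L" "L\<^sup>2 = B" and \<tau>: "0 < \<tau>"
  defines "X \<equiv> (norm du)\<^sup>2 - dF \<bullet> ((2 * u / F) *\<^sub>R du - (u\<^sup>2 / F\<^sup>2) *\<^sub>R dF) + u\<^sup>2 / F - u\<^sup>2 / B"
  shows "norm (((3 - 2 * F / B) * (2 * u)) *\<^sub>R du - (2 / B * u\<^sup>2) *\<^sub>R dF) \<le>
    3 * L * (1 / \<tau> + 2 * \<tau>) * X + (3 * \<tau> / L) * u\<^sup>2 + (6 * \<tau> * L) * (norm du)\<^sup>2"
proof -
  define v where "v = u / F"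
  define a where "a = du - v *\<^sub>R dF"
  define k where "k = v *\<^sub>R dF"
  define r where "r = 1 - F / B"
  define e1 where "e1 = (norm a)\<^sup>2"
  define e2 where "e2 = u\<^sup>2 / F - u\<^sup>2 / B"
  have B: "0 < B"
    using F by linarith
  have r: "0 \<le> r" "r \<le> 1"
    using F B by (auto simp: r_def)
  have X: "X = e1 + e2"
    unfolding X_def e1_def e2_def a_def v_def by (subst gradient_identity) (use F in auto)
  have e2: "e2 = u\<^sup>2 * r / F"
    unfolding e2_def r_def using F B by (simp add: field_simps)
  have e2pos: "0 \<le> e2"
    unfolding e2 using r F by simp
  \<comment> \<open>\<open>F * r \<le> B\<close> turns \<open>e2\<close> into a bound for the square
    of \<open>u * r\<close>, the small factor next to \<open>k\<close>.\<close>
  have small: "u\<^sup>2 * r\<^sup>2 \<le> B * e2"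
  proof -
    have "u\<^sup>2 * r\<^sup>2 = (F * r) * e2"
      unfolding e2 using F by (simp add: power2_eq_square)
    also have "\<dots> \<le> B * e2"
      using F r e2pos mult_mono[of F B r 1] by (intro mult_right_mono) auto
    finally show ?thesis .
  qed
  have "u * (3 - 2 * F / B) * 2 - 6 * u * r = 2 * u * F / B" "v * F = u"
    using F by (simp_all add: r_def v_def field_simps)
  \<comment> \<open>Comparison of the coefficients of \<open>dF\<close> when the gradient of
    \<open>p\<close> is rewritten in terms of \<open>a\<close> and \<open>k\<close>.\<close>
  then have coeff: "- ((3 - 2 * F / B) * (2 * u)) * v + 6 * u * r * v = - (2 / B * u\<^sup>2)"
    by (simp add: r_def power2_eq_square field_simps)
  have "((3 - 2 * F / B) * (2 * u)) *\<^sub>R du - (2 / B * u\<^sup>2) *\<^sub>R dF =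
      ((3 - 2 * F / B) * (2 * u)) *\<^sub>R a + (6 * u * r) *\<^sub>R k"
    unfolding a_def k_def scaleR_diff_right scaleR_scaleR
    using arg_cong[OF coeff, of "\<lambda>c. c *\<^sub>R dF"] by (simp add: scaleR_add_left scaleR_diff_left)
  also have "norm \<dots> \<le> \<bar>(3 - 2 * F / B) * (2 * u)\<bar> * norm a + \<bar>6 * u * r\<bar> * norm k"
    by (rule norm_triangle_le) simp
  also have "\<dots> \<le> (6 * \<bar>u\<bar>) * norm a + (6 * (\<bar>u\<bar> * r)) * norm k"
  proof (intro add_mono mult_right_mono norm_ge_zero)
    have "\<bar>3 - 2 * F / B\<bar> \<le> 3"
      using F B by (simp add: abs_le_iff field_simps)
    then show "\<bar>(3 - 2 * F / B) * (2 * u)\<bar> \<le> 6 * \<bar>u\<bar>"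
      unfolding abs_mult using mult_right_mono[of "\<bar>3 - 2 * F / B\<bar>" 3 "\<bar>2\<bar> * \<bar>u\<bar>"] by (simp add: abs_mult)
    show "\<bar>6 * u * r\<bar> \<le> 6 * (\<bar>u\<bar> * r)"
      using r by (simp add: abs_mult)
  qed
  also have "\<dots> = 3 * (2 * (norm a * \<bar>u\<bar>)) + 3 * (2 * (norm k * (\<bar>u\<bar> * r)))"
    by (simp add: algebra_simps)
  \<comment> \<open>In the first product \<open>norm a\<close> is the small factor and gets the
    large weight \<open>L / \<tau>\<close>. In the second \<open>norm k\<close> is merely bounded
    and gets the weight \<open>\<tau> * L\<close>, which leaves the large one for
    \<open>u * r\<close>.\<close>
  also have "\<dots> \<le> 3 * ((L / \<tau>) * (norm a)\<^sup>2 + \<bar>u\<bar>\<^sup>2 / (L / \<tau>)) + 3 * ((\<tau> * L) * (norm k)\<^sup>2 + (\<bar>u\<bar> * r)\<^sup>2 / (\<tau> * L))"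
    using L \<tau> by (intro add_mono mult_left_mono weighted_AM_GM) auto
  also have "\<dots> \<le> 3 * ((L / \<tau>) * e1 + (\<tau> / L) * u\<^sup>2) + 3 * ((\<tau> * L) * (2 * (norm du)\<^sup>2 + 2 * e1) + (L / \<tau>) * e2)"
  proof -
    have f1: "\<bar>u\<bar>\<^sup>2 / (L / \<tau>) = (\<tau> / L) * u\<^sup>2"
      using L \<tau> by (simp add: field_simps)
    have f2: "(\<tau> * L) * (norm k)\<^sup>2 \<le> (\<tau> * L) * (2 * (norm du)\<^sup>2 + 2 * e1)"
    proof (rule mult_left_mono)
      have "norm k \<le> norm du + norm a"
        unfolding a_def k_def[symmetric] using norm_triangle_ineq4[of du "du - k"] by simp
      then have "(norm k)\<^sup>2 \<le> (norm du + norm a)\<^sup>2"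
        by (intro power_mono) auto
      also have "\<dots> \<le> 2 * (norm du)\<^sup>2 + 2 * (norm a)\<^sup>2"
        using sum_squares_bound[of "norm du" "norm a"] by (simp add: power2_sum)
      finally show "(norm k)\<^sup>2 \<le> 2 * (norm du)\<^sup>2 + 2 * e1"
        by (simp add: e1_def)
    qed (use L \<tau> in simp)
    have f3: "(\<bar>u\<bar> * r)\<^sup>2 / (\<tau> * L) \<le> (L / \<tau>) * e2"
    proof -
      have "(\<bar>u\<bar> * r)\<^sup>2 / (\<tau> * L) \<le> L\<^sup>2 * e2 / (\<tau> * L)"
        using small L \<tau> by (intro divide_right_mono) (simp_all add: power_mult_distrib)
      also have "\<dots> = (L / \<tau>) * e2"
        using L(1) \<tau> by (simp add: power2_eq_square)
      finally show ?thesis .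
    qed
    show ?thesis
      unfolding f1 e1_def by (intro f2[unfolded e1_def] f3 add_left_mono mult_left_mono add_mono order_refl) simp
  qed
  also have "\<dots> = 3 * L * (1 / \<tau> + 2 * \<tau>) * e1 + 3 * L * (1 / \<tau>) * e2 + (3 * \<tau> / L) * u\<^sup>2 + (6 * \<tau> * L) * (norm du)\<^sup>2"
    by (simp add: algebra_simps)
  also have "\<dots> \<le> 3 * L * (1 / \<tau> + 2 * \<tau>) * X + (3 * \<tau> / L) * u\<^sup>2 + (6 * \<tau> * L) * (norm du)\<^sup>2"
  proof -
    have "3 * L * (1 / \<tau>) * e2 \<le> 3 * L * (1 / \<tau> + 2 * \<tau>) * e2"
      using L \<tau> e2pos by (intro mult_right_mono mult_left_mono) auto
    then show ?thesis
      unfolding X by (simp add: distrib_left)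
  qed
  finally show ?thesis .
qed

text \<open>The bracket is the Rayleigh excess \<open>G - A / B\<close> minus the defect of
  \<open>F\<close> in the equation \<open>- \<Delta> F = 1\<close> tested with
  \<open>\<psi> = u^2 / F\<close>; for an exact solution the defect is \<open>0\<close>.\<close>

lemma core_energy:
  fixes u F :: "'a::euclidean_space \<Rightarrow> real" and B L \<tau> :: real
  assumes u: "u \<in> test_functions \<Omega>" and F: "is_smooth F" "\<And>x. 0 < F x" "\<And>x. F x \<le> B"
    and L: "0 < L" "L\<^sup>2 = B" and \<tau>: "0 < \<tau>"
  defines "\<psi> \<equiv> \<lambda>x. u x * u x * inverse (F x)"
  defines "p \<equiv> \<lambda>x. u x * u x * (3 - 2 / B * F x)"
  defines "A \<equiv> LINT x|lborel. (u x)\<^sup>2" and "G \<equiv> LINT x|lborel. (norm (gradient u x))\<^sup>2"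
  shows "(LINT x|lborel. norm (gradient p x)) \<le>
    3 * L * (1 / \<tau> + 2 * \<tau>) * (G - ((LINT x|lborel. gradient F x \<bullet> gradient \<psi> x) - (LINT x|lborel. \<psi> x)) - A / B)
    + (3 * \<tau> / L) * A + (6 * \<tau> * L) * G"
    "\<psi> \<in> test_functions \<Omega>" "p \<in> test_functions \<Omega>" "A \<le> (LINT x|lborel. \<bar>p x\<bar>)"
    "\<And>x. gradient \<psi> x = (2 * u x / F x) *\<^sub>R gradient u x - ((u x)\<^sup>2 / (F x)\<^sup>2) *\<^sub>R gradient F x"
proof -
  note su = test_functions_smooth[OF u]
  have F0: "F x \<noteq> 0" for x
    using F(2)[of x] by simp
  have sF: "is_smooth (\<lambda>x. inverse (F x))"
    by (rule is_smooth_inverse[OF F(1) F0])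
  have su2: "is_smooth (\<lambda>x. u x * u x)"
    by (rule is_smooth_mult[OF su su])
  have s3: "is_smooth (\<lambda>x. 3 - 2 / B * F x)"
    by (intro is_smooth_diff is_smooth_mult is_smooth_const F)
  have u2: "(\<lambda>x. u x * u x) \<in> test_functions \<Omega>"
    by (rule test_functions_mult[OF u su])
  show \<psi>: "\<psi> \<in> test_functions \<Omega>"
    unfolding \<psi>_def by (rule test_functions_mult[OF u2 sF])
  show p: "p \<in> test_functions \<Omega>"
    unfolding p_def by (rule test_functions_mult[OF u2 s3])
  show g\<psi>: "gradient \<psi> x = (2 * u x / F x) *\<^sub>R gradient u x - ((u x)\<^sup>2 / (F x)\<^sup>2) *\<^sub>R gradient F x" for x
  proof -
    have "gradient \<psi> x = (u x * u x) *\<^sub>R (- (inverse (F x))\<^sup>2 *\<^sub>R gradient F x) + inverse (F x) *\<^sub>R (u x *\<^sub>R gradient u x + u x *\<^sub>R gradient u x)"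
      unfolding \<psi>_def gradient_mult[OF su2 sF] gradient_mult[OF su su] gradient_inverse[OF F(1) F0] ..
    then show ?thesis
      by (simp add: scaleR_add_left[symmetric] power2_eq_square divide_inverse mult_ac)
  qed
  have gp: "gradient p x = ((3 - 2 * F x / B) * (2 * u x)) *\<^sub>R gradient u x - (2 / B * (u x)\<^sup>2) *\<^sub>R gradient F x" for x
  proof -
    have g3: "gradient (\<lambda>x. 3 - 2 / B * F x) x = 0 - (2 / B) *\<^sub>R gradient F x"
      by (subst gradient_diff[OF is_smooth_const is_smooth_mult[OF is_smooth_const F(1)]])
        (simp only: gradient_const gradient_cmult[OF F(1)])
    have "gradient p x = (u x * u x) *\<^sub>R (0 - (2 / B) *\<^sub>R gradient F x) + (3 - 2 / B * F x) *\<^sub>R (u x *\<^sub>R gradient u x + u x *\<^sub>R gradient u x)"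
      unfolding p_def gradient_mult[OF su2 s3] gradient_mult[OF su su] g3 ..
    then show ?thesis
      by (simp add: scaleR_add_left[symmetric] power2_eq_square mult_ac)
  qed
  note cont = is_smooth_continuous[OF su, of UNIV] is_smooth_continuous_gradient[OF su, of UNIV]
    is_smooth_continuous[OF F(1), of UNIV] is_smooth_continuous_gradient[OF F(1), of UNIV]
    is_smooth_continuous[OF test_functions_smooth[OF \<psi>], of UNIV] is_smooth_continuous_gradient[OF test_functions_smooth[OF \<psi>], of UNIV]
    is_smooth_continuous[OF test_functions_smooth[OF p], of UNIV] is_smooth_continuous_gradient[OF test_functions_smooth[OF p], of UNIV]
  obtain K where K: "compact K" "\<And>x. x \<notin> K \<Longrightarrow> u x = 0"
    using test_functions_supportE[OF u] by metis
  note gu0 = gradient_zero_outside[OF compact_imp_closed[OF K(1)] K(2)]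
  have i1: "integrable lborel (\<lambda>x. (u x)\<^sup>2)"
    by (rule integrable_compact_support[OF _ K(1)]) (use cont K in \<open>auto intro!: continuous_intros\<close>)
  have i2: "integrable lborel (\<lambda>x. (norm (gradient u x))\<^sup>2)"
    by (rule integrable_compact_support[OF _ K(1)]) (use cont gu0 in \<open>auto intro!: continuous_intros\<close>)
  have i3: "integrable lborel (\<lambda>x. gradient F x \<bullet> gradient \<psi> x)"
    by (rule integrable_compact_support[OF _ K(1)]) (use cont gu0 K in \<open>auto intro!: continuous_intros simp: g\<psi>\<close>)
  have i4: "integrable lborel \<psi>"
    by (rule test_functions_square_integrable_lborel(3)[OF \<psi>])
  have i5: "integrable lborel (\<lambda>x. norm (gradient p x))"
    by (rule integrable_compact_support[OF _ K(1)]) (use cont gu0 K in \<open>auto intro!: continuous_intros simp: gp\<close>)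
  have i6: "integrable lborel (\<lambda>x. \<bar>p x\<bar>)"
    using test_functions_square_integrable_lborel(3)[OF p] by simp
  define X where "X x = (norm (gradient u x))\<^sup>2 - gradient F x \<bullet> gradient \<psi> x + \<psi> x - (u x)\<^sup>2 / B" for x
  have iX: "integrable lborel X"
    unfolding X_def using i1 i2 i3 i4 by auto
  have LX: "(LINT x|lborel. X x) = G - ((LINT x|lborel. gradient F x \<bullet> gradient \<psi> x) - (LINT x|lborel. \<psi> x)) - A / B"
    unfolding X_def A_def G_def using i1 i2 i3 i4 by simp
  have "(LINT x|lborel. norm (gradient p x)) \<le>
      (LINT x|lborel. 3 * L * (1 / \<tau> + 2 * \<tau>) * X x + (3 * \<tau> / L) * (u x)\<^sup>2 + (6 * \<tau> * L) * (norm (gradient u x))\<^sup>2)"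
  proof (rule integral_mono[OF i5])
    show "integrable lborel (\<lambda>x. 3 * L * (1 / \<tau> + 2 * \<tau>) * X x + (3 * \<tau> / L) * (u x)\<^sup>2 + (6 * \<tau> * L) * (norm (gradient u x))\<^sup>2)"
      using i1 i2 iX by (intro Bochner_Integration.integrable_add integrable_mult_right) auto
    fix x
    have "\<psi> x = (u x)\<^sup>2 / F x"
      by (simp add: \<psi>_def power2_eq_square divide_inverse)
    then show "norm (gradient p x) \<le> 3 * L * (1 / \<tau> + 2 * \<tau>) * X x + (3 * \<tau> / L) * (u x)\<^sup>2 + (6 * \<tau> * L) * (norm (gradient u x))\<^sup>2"
      unfolding X_def gp g\<psi> using core_pointwise[OF F(2,3) L \<tau>] by simp
  qed
  also have "\<dots> = 3 * L * (1 / \<tau> + 2 * \<tau>) * (LINT x|lborel. X x) + (3 * \<tau> / L) * A + (6 * \<tau> * L) * G"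
    unfolding A_def G_def using i1 i2 iX by simp
  finally show "(LINT x|lborel. norm (gradient p x)) \<le>
    3 * L * (1 / \<tau> + 2 * \<tau>) * (G - ((LINT x|lborel. gradient F x \<bullet> gradient \<psi> x) - (LINT x|lborel. \<psi> x)) - A / B)
    + (3 * \<tau> / L) * A + (6 * \<tau> * L) * G"
    unfolding LX .
  show "A \<le> (LINT x|lborel. \<bar>p x\<bar>)"
    unfolding A_def
  proof (rule integral_mono[OF i1 i6])
    fix x
    have "0 < B"
      using F(2,3)[of x] by linarith
    then have "1 \<le> 3 - 2 / B * F x"
      using F(3)[of x] by (simp add: field_simps)
    then have "(u x)\<^sup>2 * 1 \<le> (u x)\<^sup>2 * (3 - 2 / B * F x)"
      by (intro mult_left_mono) auto
    then show "(u x)\<^sup>2 \<le> \<bar>p x\<bar>"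
      by (simp add: p_def power2_eq_square)
  qed
qed

context torsion_domain
begin

text \<open>The truncated approximations of the torsion function, shifted by \<open>\<eta>\<close>, replace the weak
  solution: they are smooth and bounded away from zero, and the defect in the equation tested with
  \<open>u\<^sup>2 / F\<close> tends to zero because the norm of the gradient of that function stays bounded.\<close>

lemma approximate_supersolution:
  assumes w: "solves_torsion D w" and b: "AE x in lebesgue_on D. w x \<le> b" "0 < b"
    and u: "u \<in> test_functions D" and \<eta>: "0 < \<eta>" and \<epsilon>: "0 < \<epsilon>"
  shows "\<exists>F. is_smooth F \<and> (\<forall>x. 0 < F x \<and> F x \<le> b + 2 * \<eta>) \<and>
    \<bar>(LINT x|lborel. gradient F x \<bullet> gradient (\<lambda>x. u x * u x * inverse (F x)) x) -
      (LINT x|lborel. u x * u x * inverse (F x))\<bar> < \<epsilon>"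
proof -
  let ?M = "lebesgue_on D" and ?g = "weak_gradient D w"
  note wp = solves_torsionD[OF w]
  note su = test_functions_smooth[OF u]
  obtain \<phi> where \<phi>: "approximates w \<phi>" "\<And>n x. 0 \<le> \<phi> n x \<and> \<phi> n x \<le> b + 1 / Suc n"
    using approximates_truncated[OF w b] by blast
  have \<phi>t: "\<And>n. \<phi> n \<in> test_functions D"
    and lim: "(\<lambda>n. L2_seminorm ?M (\<lambda>x. gradient (\<phi> n) x - ?g x)) \<longlonglongrightarrow> 0"
    using \<phi>(1) by (auto simp: approximates_def)
  note s\<phi> = test_functions_smooth[OF \<phi>t]
  define F where "F n x = \<phi> n x + \<eta>" for n x
  define \<psi> where "\<psi> n x = u x * u x * inverse (F n x)" for n x
  have sF: "is_smooth (F n)" for n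
    unfolding F_def by (intro is_smooth_add is_smooth_const s\<phi>)
  have gF: "gradient (F n) x = gradient (\<phi> n) x" for n x
    unfolding F_def by (simp add: gradient_add[OF s\<phi> is_smooth_const] gradient_const)
  have F: "\<eta> \<le> F n x" "F n x \<le> b + 1 / Suc n + \<eta>" for n x
    using \<phi>(2)[of n x] by (auto simp: F_def)
  have Fpos: "0 < F n x" for n x
    using F(1)[of n x] \<eta> by linarith
  define B where "B n = b + 1 / Suc n + \<eta>" for n
  have Bpos: "0 < B n" for n
    using b(2) \<eta> by (simp add: B_def add_pos_nonneg)
  have core: "\<psi> n \<in> test_functions D"
    "gradient (\<psi> n) x = (2 * u x / F n x) *\<^sub>R gradient u x - ((u x)\<^sup>2 / (F n x)\<^sup>2) *\<^sub>R gradient (F n) x" for n x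
    unfolding \<psi>_def
    by (rule core_energy(2,5)[OF u sF Fpos, where B="B n" and L="sqrt (B n)" and \<tau>=1, of n];
        use F Bpos[of n] in \<open>simp add: B_def\<close>)+
  obtain K where K: "compact K" "\<And>x. x \<notin> K \<Longrightarrow> u x = 0"
    using test_functions_supportE[OF u] by metis
  have "compact (u ` K)"
    by (intro compact_continuous_image is_smooth_continuous su K)
  then obtain C where C0: "\<And>x. x \<in> K \<Longrightarrow> \<bar>u x\<bar> \<le> C"
    using compact_imp_bounded[of "u ` K"] unfolding bounded_iff by auto
  have C: "\<bar>u x\<bar> \<le> \<bar>C\<bar>" for x
    using C0[of x] K(2)[of x] by (cases "x \<in> K") auto
  \<comment> \<open>Bounds \<open>\<bar>u / F n\<bar>\<close> uniformly in \<open>n\<close> because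
    \<open>F n \<ge> \<eta>\<close>; this is what the shift by \<open>\<eta>\<close> is for.\<close>
  define q where "q = \<bar>C\<bar> / \<eta>"
  have q: "\<bar>u x / F n x\<bar> \<le> q" for n x
  proof -
    have "\<bar>u x\<bar> / F n x \<le> \<bar>C\<bar> / \<eta>"
      using C[of x] F(1)[of n x] \<eta> by (intro frac_le) auto
    then show ?thesis
      using Fpos[of n x] by (simp add: q_def)
  qed
  have q0: "0 \<le> q"
    using \<eta> by (simp add: q_def)
  have bound: "L2_seminorm ?M (gradient (\<psi> n)) \<le> 2 * q * L2_seminorm ?M (gradient u) + q\<^sup>2 * L2_seminorm ?M (gradient (\<phi> n))" for n
  proof -
    let ?a = "\<lambda>x. norm ((2 * q) *\<^sub>R gradient u x)" and ?b = "\<lambda>x. norm (q\<^sup>2 *\<^sub>R gradient (\<phi> n) x)"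
    have sq: "square_integrable ?M ?a" "square_integrable ?M ?b"
      by (intro square_integrable_norm square_integrable_scaleR test_sq u \<phi>t)+
    have "L2_seminorm ?M (gradient (\<psi> n)) = L2_seminorm ?M (\<lambda>x. norm (gradient (\<psi> n) x))"
      by (simp add: L2_seminorm_def)
    also have "\<dots> \<le> L2_seminorm ?M (\<lambda>x. ?a x + ?b x)"
    proof (rule L2_seminorm_mono)
      fix x
      have "norm (gradient (\<psi> n) x) \<le> \<bar>2 * (u x / F n x)\<bar> * norm (gradient u x) + \<bar>(u x / F n x)\<^sup>2\<bar> * norm (gradient (\<phi> n) x)"
        unfolding core gF using norm_triangle_ineq4 by (metis (no_types, lifting) norm_scaleR power_divide times_divide_eq_right)
      also have "\<dots> \<le> (2 * q) * norm (gradient u x) + q\<^sup>2 * norm (gradient (\<phi> n) x)"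
      proof (intro add_mono mult_right_mono norm_ge_zero)
        show "\<bar>2 * (u x / F n x)\<bar> \<le> 2 * q"
          using q[of x n] by linarith
        show "\<bar>(u x / F n x)\<^sup>2\<bar> \<le> q\<^sup>2"
          using power_mono[OF q[of x n] abs_ge_zero, of 2] by (simp only: power2_abs abs_power2)
      qed
      finally show "norm (norm (gradient (\<psi> n) x)) \<le> norm (?a x + ?b x)"
        using q0 by simp
    qed (intro square_integrable_norm test_sq core square_integrable_add sq)+
    also have "\<dots> \<le> L2_seminorm ?M ?a + L2_seminorm ?M ?b"
      by (rule L2_triangle[OF sq])
    also have "L2_seminorm ?M ?a = 2 * q * L2_seminorm ?M (gradient u)"
      using q0 L2_seminorm_scaleR[of ?M "2 * q" "gradient u"] by (simp add: L2_seminorm_def)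
    also have "L2_seminorm ?M ?b = q\<^sup>2 * L2_seminorm ?M (gradient (\<phi> n))"
      using L2_seminorm_scaleR[of ?M "q\<^sup>2" "gradient (\<phi> n)"] by (simp add: L2_seminorm_def)
    finally show ?thesis .
  qed
  define err where "err n = (LINT x|lborel. gradient (F n) x \<bullet> gradient (\<psi> n) x) - (LINT x|lborel. \<psi> n x)" for n
  have "norm (err n) \<le> L2_seminorm ?M (\<lambda>x. gradient (\<phi> n) x - ?g x) *
      (2 * q * L2_seminorm ?M (gradient u) + q\<^sup>2 * L2_seminorm ?M (gradient (\<phi> n)))" for n
  proof -
    note s\<psi> = test_functions_smooth[OF core(1)]
    have "(LINT x|lborel. gradient (F n) x \<bullet> gradient (\<psi> n) x) = (LINT x|?M. gradient (F n) x \<bullet> gradient (\<psi> n) x)"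
      by (rule integral_lebesgue_on_eq_lborel[symmetric, OF open_D])
        (use is_smooth_continuous_gradient[OF sF] is_smooth_continuous_gradient[OF s\<psi>]
          test_functions_gradient_zero[OF core(1)] in \<open>auto intro!: continuous_intros\<close>)
    also have "\<dots> = (LINT x|?M. gradient (\<phi> n) x \<bullet> gradient (\<psi> n) x)"
      by (simp add: gF)
    \<comment> \<open>Subtracting the exact equation for \<open>w\<close>, tested with the same
      \<open>\<psi> n\<close>, leaves only a difference of gradients that tends to
      \<open>0\<close>.\<close>
    finally have "err n = (LINT x|?M. gradient (\<phi> n) x \<bullet> gradient (\<psi> n) x) - (LINT x|?M. ?g x \<bullet> gradient (\<psi> n) x)"
      unfolding err_def wp(5)[OF core(1)] integral_test[OF core(1)] by simp
    also have "\<dots> = (LINT x|?M. (gradient (\<phi> n) x - ?g x) \<bullet> gradient (\<psi> n) x)"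
      using square_integrable_inner[OF test_sq(2)[OF \<phi>t[of n]] test_sq(2)[OF core(1)[of n]]]
        square_integrable_inner[OF wp(3) test_sq(2)[OF core(1)[of n]]]
      by (simp add: inner_diff_left)
    finally have "norm (err n) \<le> L2_seminorm ?M (\<lambda>x. gradient (\<phi> n) x - ?g x) * L2_seminorm ?M (gradient (\<psi> n))"
      using L2_Cauchy_Schwarz[OF square_integrable_diff[OF test_sq(2)[OF \<phi>t[of n]] wp(3)] test_sq(2)[OF core(1)[of n]]]
      by simp
    also have "\<dots> \<le> L2_seminorm ?M (\<lambda>x. gradient (\<phi> n) x - ?g x) *
      (2 * q * L2_seminorm ?M (gradient u) + q\<^sup>2 * L2_seminorm ?M (gradient (\<phi> n)))"
      by (intro mult_left_mono bound L2_seminorm_nonneg)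
    finally show ?thesis .
  qed
  moreover have "(\<lambda>n. L2_seminorm ?M (\<lambda>x. gradient (\<phi> n) x - ?g x) *
      (2 * q * L2_seminorm ?M (gradient u) + q\<^sup>2 * L2_seminorm ?M (gradient (\<phi> n)))) \<longlonglongrightarrow> 0"
  proof -
    have "(\<lambda>n. L2_seminorm ?M (\<lambda>x. gradient (\<phi> n) x - ?g x) *
      (2 * q * L2_seminorm ?M (gradient u) + q\<^sup>2 * L2_seminorm ?M (gradient (\<phi> n)))) \<longlonglongrightarrow>
      0 * (2 * q * L2_seminorm ?M (gradient u) + q\<^sup>2 * L2_seminorm ?M ?g)"
      by (intro tendsto_intros lim L2_seminorm_tendsto test_sq \<phi>t wp)
    then show ?thesis by simp
  qed
  ultimately have "err \<longlonglongrightarrow> 0"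
    by (rule Lim_null_comparison[OF always_eventually[OF allI]])
  then have "\<forall>\<^sub>F n in sequentially. \<bar>err n\<bar> < \<epsilon>"
    using \<epsilon> by (auto simp: tendsto_iff dist_norm)
  \<comment> \<open>Turns the bound \<open>b + 1 / Suc n + \<eta>\<close> on \<open>F n\<close> into
    \<open>b + 2 * \<eta>\<close>.\<close>
  moreover have "\<forall>\<^sub>F n in sequentially. 1 / real (Suc n) < \<eta>"
    using LIMSEQ_Suc[OF lim_1_over_n] \<eta> by (rule order_tendstoD)
  ultimately have "\<forall>\<^sub>F n in sequentially. \<bar>err n\<bar> < \<epsilon> \<and> 1 / real (Suc n) < \<eta>"
    by eventually_elim simp
  then obtain n where n: "\<bar>err n\<bar> < \<epsilon>" "1 / real (Suc n) < \<eta>"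
    using eventually_happens'[OF sequentially_bot] by blast
  have "F n x \<le> b + 2 * \<eta>" for x
    using F(2)[of n x] n(2) by linarith
  then show ?thesis
    using sF Fpos n(1) unfolding err_def \<psi>_def by (intro exI[of _ "F n"]) auto
qed

end

section \<open>The numerical constants\<close>

lemma inverse_fact_square_le: "inverse ((fact m)\<^sup>2) \<le> (inverse (fact m) :: real)"
proof (rule le_imp_inverse_le)
  have "fact m * 1 \<le> fact m * (fact m :: real)"
    by (intro mult_left_mono fact_ge_1) simp
  then show "fact m \<le> ((fact m)\<^sup>2 :: real)"
    by (simp add: power2_eq_square)
qed simp

text \<open>Domination by the exponential series at \<open>y = (x / 2)^2\<close> settles all
  convergence questions about \<open>bessel_J0\<close>.\<close>

lemma bessel_term_bound:
  fixes y :: real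
  assumes "0 \<le> y"
  shows "norm ((-1) ^ m / (fact m)\<^sup>2 * y ^ m) \<le> inverse (fact m) * y ^ m"
    "norm (y ^ m / (fact m)\<^sup>2) \<le> inverse (fact m) * y ^ m"
proof -
  have "norm ((-1) ^ m / (fact m)\<^sup>2 * y ^ m) = inverse ((fact m)\<^sup>2) * y ^ m"
    using assms by (cases "even m") (simp_all add: divide_inverse)
  moreover have "norm (y ^ m / (fact m)\<^sup>2) = inverse ((fact m)\<^sup>2) * y ^ m"
    using assms by (simp add: divide_inverse)
  ultimately show "norm ((-1) ^ m / (fact m)\<^sup>2 * y ^ m) \<le> inverse (fact m) * y ^ m"
    "norm (y ^ m / (fact m)\<^sup>2) \<le> inverse (fact m) * y ^ m"
    using mult_right_mono[OF inverse_fact_square_le, of "y ^ m" m] assms by simp_all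
qed

lemma bessel_terms_tendsto_0:
  fixes y :: real
  assumes "0 \<le> y"
  shows "(\<lambda>m. y ^ m / (fact m)\<^sup>2) \<longlonglongrightarrow> 0"
  by (rule summable_LIMSEQ_zero, rule summable_comparison_test[OF _ summable_exp[of y]])
    (intro exI allI impI bessel_term_bound assms)

lemma bessel_J0_summable: "summable (\<lambda>m. (-1) ^ m / (fact m)\<^sup>2 * (x / 2) ^ (2 * m) :: real)"
  unfolding power_mult
  by (rule summable_comparison_test[OF _ summable_exp[of "(x / 2)\<^sup>2"]])
    (intro exI allI impI bessel_term_bound zero_le_power2)

lemma bessel_J0_continuous: "continuous_on UNIV bessel_J0"
proof -
  define c :: "nat \<Rightarrow> real" where "c m = (-1) ^ m / (fact m)\<^sup>2" for m
  have "summable (\<lambda>m. c m * y ^ m)" if "0 \<le> y" for y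
    using bessel_J0_summable[of "2 * sqrt y"] that by (simp add: c_def power_mult)
  then have "isCont (\<lambda>y. \<Sum>m. c m * y ^ m) z" for z
    by (intro isCont_powser[of c "\<bar>z\<bar> + 1"]) auto
  then have "continuous_on UNIV (\<lambda>y. \<Sum>m. c m * y ^ m)"
    by (simp add: continuous_at_imp_continuous_on)
  from continuous_on_compose2[OF this, of UNIV "\<lambda>x. (x / 2)\<^sup>2"]
  show ?thesis
    by (simp add: bessel_J0_def[abs_def] c_def power_mult continuous_intros)
qed

lemma bessel_J0_eq_minus:
  "bessel_J0 x = (\<Sum>m. (-1) ^ m * (((x / 2)\<^sup>2) ^ m / (fact m)\<^sup>2))"
  by (simp add: bessel_J0_def power_mult)

text \<open>For \<open>\<bar>x\<bar> \<le> 1\<close> the absolute values of the terms decrease, so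
  by Leibniz the alternating series is at least the sum of its first two terms,
  \<open>1 - (x / 2)^2\<close>.\<close>

lemma bessel_J0_pos:
  assumes "\<bar>x\<bar> \<le> 1"
  shows "0 < bessel_J0 x"
proof -
  define a where "a m = ((x / 2)\<^sup>2) ^ m / (fact m)\<^sup>2" for m
  have s: "summable (\<lambda>m. (-1) ^ m * a m)"
    using bessel_J0_summable[of x] by (simp add: a_def power_mult)
  have y: "(x / 2)\<^sup>2 \<le> 1 / 4" "0 \<le> (x / 2)\<^sup>2"
    using assms abs_square_le_1[of x] by (auto simp: power_divide)
  have "a \<longlonglongrightarrow> 0"
    unfolding a_def[abs_def] by (rule bessel_terms_tendsto_0) simp
  moreover have "0 \<le> a m" for m
    by (simp add: a_def)
  moreover have "a (Suc m) \<le> a m" for m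
  proof -
    have "((x / 2)\<^sup>2) ^ Suc m \<le> ((x / 2)\<^sup>2) ^ m"
      using y by (intro power_decreasing) auto
    moreover have "((fact m)\<^sup>2 :: real) \<le> (fact (Suc m))\<^sup>2"
      by (intro power_mono fact_mono) auto
    ultimately show ?thesis
      unfolding a_def using y by (intro frac_le) auto
  qed
  ultimately have "(\<Sum>i<2 * 1. (-1) ^ i * a i) \<le> (\<Sum>m. (-1) ^ m * a m)"
    by (rule summable_Leibniz'(2))
  moreover have "(\<Sum>i<2 * 1. (-1) ^ i * a i) = 1 - (x / 2)\<^sup>2"
    by (simp add: a_def numeral_2_eq_2)
  ultimately show ?thesis
    using y unfolding bessel_J0_eq_minus a_def by linarith
qed

text \<open>Sign change between \<open>0\<close> and \<open>3\<close>. At \<open>3\<close> the term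
  of index \<open>1\<close> is larger than that of index \<open>0\<close>, so Leibniz is applied
  from index \<open>2\<close> on; the two terms before it sum to \<open>-5/4\<close>, and the tail
  is below \<open>5/4\<close>.\<close>

lemma bessel_J0_zero_exists: "\<exists>x. 0 < x \<and> bessel_J0 x = 0"
proof -
  have "bessel_J0 3 < 0"
  proof -
    define a where "a m = (((3 :: real) / 2)\<^sup>2) ^ (m + 2) / (fact (m + 2))\<^sup>2" for m :: nat
    define f where "f m = (-1) ^ m * (((3 / 2)\<^sup>2) ^ m / (fact m)\<^sup>2 :: real)" for m
    have s: "summable f"
      using bessel_J0_summable[of 3] by (simp add: f_def[abs_def] power_mult)
    have fa: "f (m + 2) = (-1) ^ m * a m" for m
      by (simp add: f_def a_def)
    have "a \<longlonglongrightarrow> 0"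
      unfolding a_def[abs_def]
      by (rule LIMSEQ_ignore_initial_segment[OF bessel_terms_tendsto_0]) simp
    moreover have "0 \<le> a m" for m
      by (simp add: a_def)
    moreover have "a (Suc m) \<le> a m" for m
    proof -
      have "a (Suc m) = a m * ((3 / 2)\<^sup>2 / (real m + 3)\<^sup>2)"
      proof -
        have "fact (Suc m + 2) = (real m + 3) * fact (m + 2)"
          using fact_Suc[of "m + 2", where 'a=real] by (simp del: fact_Suc)
        moreover have "P * k / (r * Q)\<^sup>2 = P / Q\<^sup>2 * (k / r\<^sup>2)" for P Q k r :: real
          by (simp add: power_mult_distrib)
        ultimately show ?thesis
          unfolding a_def add_Suc power_Suc2 by metis
      qed
      also have "\<dots> \<le> a m * 1"
      proof (rule mult_left_mono)
        show "(3 / 2)\<^sup>2 / (real m + 3)\<^sup>2 \<le> 1"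
          using power_mono[of "3 / 2" "real m + 3" 2] by (subst divide_le_eq_1_pos) auto
      qed (simp add: a_def)
      finally show ?thesis by simp
    qed
    ultimately have "(\<Sum>m. (-1) ^ m * a m) \<le> (\<Sum>i<2 * 1 + 1. (-1) ^ i * a i)"
      by (rule summable_Leibniz'(4))
    then have "(\<Sum>m. f (m + 2)) \<le> a 0 - a 1 + a 2"
      unfolding fa by (simp add: eval_nat_numeral)
    moreover have "bessel_J0 3 = (\<Sum>m. f (m + 2)) + (\<Sum>i<2. f i)"
      unfolding bessel_J0_eq_minus f_def[symmetric] by (rule suminf_split_initial_segment[OF s])
    moreover have "(\<Sum>i<2. f i) = 1 - 9 / 4"
      by (simp add: f_def numeral_2_eq_2)
    moreover have "a 0 - a 1 + a 2 < 5 / 4"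
      by (simp add: a_def fact_numeral eval_nat_numeral)
    ultimately show ?thesis
      by simp
  qed
  then have "\<exists>x\<ge>0. x \<le> 3 \<and> bessel_J0 x = 0"
    using bessel_J0_pos[of 0] bessel_J0_continuous continuous_on_subset
    by (intro IVT2') (auto intro: continuous_on_subset)
  then show ?thesis
    using bessel_J0_pos[of 0] by (metis abs_zero less_eq_real_def order_less_irrefl zero_le_one)
qed

text \<open>\<open>LEAST\<close> over the reals has a meaning only if the minimum is attained. As no
  zero lies in \<open>(0, 1]\<close>, the positive zeros are the zeros in
  \<open>[1, \<infinity>)\<close>; they form a closed set, which contains its infimum.\<close>

lemma j0_ge_1: "1 \<le> j0"
proof -
  define Z where "Z = {x \<in> {1..}. bessel_J0 x = 0}"
  have Z: "0 < x \<and> bessel_J0 x = 0 \<longleftrightarrow> x \<in> Z" for x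
    unfolding Z_def using bessel_J0_pos[of x] by (cases "x \<le> 1") (auto simp: abs_if)
  have "closed Z"
    unfolding Z_def using bessel_J0_continuous
    by (intro continuous_closed_preimage_constant) (auto intro: continuous_on_subset)
  moreover have "Z \<noteq> {}"
    using bessel_J0_zero_exists Z by blast
  moreover have "bdd_below Z"
    unfolding Z_def by (rule bdd_belowI[of _ 1]) simp
  ultimately have "Inf Z \<in> Z"
    by (intro closed_contains_Inf)
  moreover have "j0 = Inf Z"
    unfolding j0_def Z
    by (rule Least_equality) (use \<open>Inf Z \<in> Z\<close> \<open>bdd_below Z\<close> in \<open>auto intro: cInf_lower\<close>)
  ultimately show ?thesis
    by (simp add: Z_def)
qed

text \<open>\<open>GREATEST\<close> likewise calls for an attained maximum. Since
  \<open>0 \<le> f c \<le> 1 / c\<close>, values far out are below \<open>f c2 > 0\<close>, so the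
  maximum over a compact interval is global; at its location \<open>m \<ge> 1\<close> it is at most
  \<open>1 / m\<close>.\<close>

lemma c1_le_1: "c1 \<le> 1"
proof -
  define f where "f c = (1 - 2 powr (9 / 2) * exp (- c)) ^ 7 / c ^ 9" for c :: real
  define c0 :: real where "c0 = 9 / 2 * ln 2"
  \<comment> \<open>\<open>ln (1 / 2) \<le> - 1 / 2\<close> gives
    \<open>c0 \<ge> 9 / 4\<close>.\<close>
  have c0: "1 \<le> c0"
    using ln_le_minus_one[of "1 / 2"] by (simp add: c0_def ln_div)
  have two: "2 powr (9 / 2) * exp (- c0) = 1"
    by (simp add: c0_def powr_def exp_minus)
  have base: "0 \<le> 1 - 2 powr (9 / 2) * exp (- c)" "1 - 2 powr (9 / 2) * exp (- c) \<le> 1" if "c0 \<le> c" for c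
  proof -
    have "2 powr (9 / 2) * exp (- c) \<le> 2 powr (9 / 2) * exp (- c0)"
      using that by (intro mult_left_mono) auto
    then show "0 \<le> 1 - 2 powr (9 / 2) * exp (- c)"
      using two by simp
  qed simp
  have f_le: "0 \<le> f c" "f c \<le> 1 / c" if "c0 \<le> c" for c
  proof -
    show "0 \<le> f c"
      unfolding f_def using base[OF that] c0 that by simp
    have "f c \<le> 1 / c ^ 1"
      unfolding f_def using base[OF that] c0 that
      by (intro frac_le power_le_one power_increasing) auto
    then show "f c \<le> 1 / c" by simp
  qed
  define c2 where "c2 = c0 + 1"
  have "0 < f c2"
  proof -
    have "2 powr (9 / 2) * exp (- c2) < 2 powr (9 / 2) * exp (- c0)"
      by (simp add: c2_def)
    then show ?thesis
      unfolding f_def using two c0 by (auto simp: c2_def intro!: divide_pos_pos zero_less_power)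
  qed
  define T where "T = max c2 (1 / f c2)"
  have "continuous_on {c0..T} f"
    unfolding f_def using c0 by (intro continuous_intros) auto
  moreover have "{c0..T} \<noteq> {}"
    by (simp add: T_def c2_def)
  ultimately obtain m where m: "m \<in> {c0..T}" "\<And>c. c \<in> {c0..T} \<Longrightarrow> f c \<le> f m"
    using continuous_attains_sup[OF compact_Icc] by metis
  have max: "f c \<le> f m" if "c0 \<le> c" for c
  proof (cases "c \<le> T")
    case True
    then show ?thesis
      using m(2) that by simp
  next
    case False
    have "1 / f c2 < c"
      using False unfolding T_def not_le max_less_iff_conj by (rule conjunct2)
    then have *: "1 / c \<le> f c2"
      using \<open>0 < f c2\<close> c0 that by (simp add: field_simps)
    have "f c \<le> 1 / c"
      by (rule f_le[OF that])
    also have "\<dots> \<le> f c2"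
      by (rule *)
    also have "\<dots> \<le> f m"
      by (rule m) (simp add: T_def c2_def)
    finally show ?thesis .
  qed
  have "c1 = f m"
    unfolding c1_def
    by (rule Greatest_equality) (use m(1) max in \<open>auto simp: f_def c0_def\<close>)
  also have "\<dots> \<le> 1 / m"
    using m(1) by (intro f_le) simp
  also have "\<dots> \<le> 1"
    using m(1) c0 by simp
  finally show ?thesis .
qed

text \<open>The factor \<open>10 ^ 4 + 2 / 10 ^ 4\<close> is \<open>1 / \<tau> + 2 \<tau>\<close>
  for \<open>\<tau> = 10^-4\<close>. With \<open>a = A / b\<close> the excess is at most
  \<open>3 * a / 10 ^ 8\<close>, one unit each from \<open>G\<close>, \<open>err\<close> and
  \<open>B\<close>. In units of \<open>a * K\<close> the summands of \<open>I\<close> are at most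
  \<open>91\<close>, \<open>30\<close> and \<open>61\<close> times \<open>10^-5\<close>, together
  below \<open>2 / 1000\<close>. The Cheeger factor is \<open>32 * 23 / 4 = 184\<close>, and
  \<open>184 * 2 / 1000 < 1\<close>.\<close>

lemma core_numeric:
  fixes A G E b B L K I \<rho> err :: real
  assumes A: "0 < A" and K: "0 < K" "K\<^sup>2 = b" and L: "K \<le> L" "L \<le> 1001 / 1000 * K" "L\<^sup>2 = B"
    and B: "B \<le> b * (1 + 1 / 10 ^ 8)"
    and G: "G \<le> (1 + 1 / 10 ^ 8) * A / b" and err: "\<bar>err\<bar> \<le> A / (10 ^ 8 * b)"
    and I: "I \<le> 3 * L * (10 ^ 4 + 2 / 10 ^ 4) * (G - err - A / B) + (3 / 10 ^ 4 / L) * A + (6 / 10 ^ 4 * L) * G"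
    and le: "A \<le> 32 * (23 / 4 * K) * I"
  shows False
proof -
  define a where "a = A / b"
  have b: "0 < b"
    using K by (metis zero_less_power)
  have a: "0 < a" "A = a * K\<^sup>2"
    using A b K by (simp_all add: a_def)
  have Bpos: "0 < B"
    using K L by (metis less_le_trans zero_less_power)
  have "A / (b * (1 + 1 / 10 ^ 8)) \<le> A / B"
    using A B Bpos by (intro divide_left_mono) (auto intro: mult_pos_pos b)
  moreover have "A / (b * (1 + 1 / 10 ^ 8)) = a * (1 / (1 + 1 / 10 ^ 8))"
    by (simp add: a_def field_simps)
  moreover have "a * (1 - 1 / 10 ^ 8) \<le> a * (1 / (1 + 1 / 10 ^ 8))"
    using a(1) by (intro mult_left_mono) (auto simp: field_simps)
  ultimately have AB: "a * (1 - 1 / 10 ^ 8) \<le> A / B"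
    by linarith
  have G': "G \<le> (1 + 1 / 10 ^ 8) * a" and err': "\<bar>err\<bar> \<le> a / 10 ^ 8"
    using G err by (simp_all add: a_def field_simps)
  have E: "G - err - A / B \<le> 3 * a / 10 ^ 8"
    using G' err' AB by (simp add: algebra_simps)
  have Lpos: "0 < L"
    using K L by linarith
  have "3 * L * (10 ^ 4 + 2 / 10 ^ 4) * (G - err - A / B) \<le> 3 * L * (10 ^ 4 + 2 / 10 ^ 4) * (3 * a / 10 ^ 8)"
    using Lpos by (intro mult_left_mono E) simp
  also have "\<dots> = (9 * (10 ^ 4 + 2 / 10 ^ 4) / 10 ^ 8) * a * L"
    by simp
  also have "\<dots> \<le> (9 * (10 ^ 4 + 2 / 10 ^ 4) / 10 ^ 8) * a * (1001 / 1000 * K)"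
    using a L by (intro mult_left_mono) auto
  finally have 1: "3 * L * (10 ^ 4 + 2 / 10 ^ 4) * (G - err - A / B) \<le> (9 * (10 ^ 4 + 2 / 10 ^ 4) / 10 ^ 8) * a * (1001 / 1000 * K)" .
  have "(3 / 10 ^ 4 / L) * A \<le> (3 / 10 ^ 4 / K) * A"
    using K L A by (intro mult_right_mono divide_left_mono) auto
  also have "\<dots> = 3 / 10 ^ 4 * (a * K)"
    using K(1) by (simp add: a(2) power2_eq_square)
  finally have 2: "(3 / 10 ^ 4 / L) * A \<le> 3 / 10 ^ 4 * (a * K)" .
  have "(6 / 10 ^ 4 * L) * G \<le> (6 / 10 ^ 4 * L) * ((1 + 1 / 10 ^ 8) * a)"
    using Lpos by (intro mult_left_mono G') simp
  also have "\<dots> = 6 / 10 ^ 4 * ((1 + 1 / 10 ^ 8) * a) * L"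
    by simp
  also have "\<dots> \<le> 6 / 10 ^ 4 * ((1 + 1 / 10 ^ 8) * a) * (1001 / 1000 * K)"
    using a L by (intro mult_left_mono) auto
  finally have 3: "(6 / 10 ^ 4 * L) * G \<le> 6 / 10 ^ 4 * ((1 + 1 / 10 ^ 8) * a) * (1001 / 1000 * K)" .
  have aK: "0 < a * K"
    using a K by simp
  have "(9 * (10 ^ 4 + 2 / 10 ^ 4) / 10 ^ 8) * a * (1001 / 1000 * K) =
      (9 * (10 ^ 4 + 2 / 10 ^ 4) / 10 ^ 8 * (1001 / 1000)) * (a * K)"
    by simp
  also have "\<dots> \<le> 91 / 10 ^ 5 * (a * K)"
    using aK by (intro mult_right_mono) auto
  finally have 1: "3 * L * (10 ^ 4 + 2 / 10 ^ 4) * (G - err - A / B) \<le> 91 / 10 ^ 5 * (a * K)"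
    using 1 by (rule order_trans[rotated])
  have "6 / 10 ^ 4 * ((1 + 1 / 10 ^ 8) * a) * (1001 / 1000 * K) =
      (6 / 10 ^ 4 * (1 + 1 / 10 ^ 8) * (1001 / 1000)) * (a * K)"
    by simp
  also have "\<dots> \<le> 61 / 10 ^ 5 * (a * K)"
    using aK by (intro mult_right_mono) auto
  finally have 3: "(6 / 10 ^ 4 * L) * G \<le> 61 / 10 ^ 5 * (a * K)"
    using 3 by (rule order_trans[rotated])
  have "I \<le> 91 / 10 ^ 5 * (a * K) + 3 / 10 ^ 4 * (a * K) + 61 / 10 ^ 5 * (a * K)"
    using I add_mono[OF add_mono[OF 1 2] 3] by (rule order_trans)
  also have "\<dots> = (91 / 10 ^ 5 + 3 / 10 ^ 4 + 61 / 10 ^ 5) * (a * K)"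
    by (simp only: distrib_right)
  also have "\<dots> \<le> 2 / 1000 * (a * K)"
    using aK by (intro mult_right_mono) auto
  finally have "I \<le> 2 / 1000 * (a * K)" .
  then have "32 * (23 / 4 * K) * I \<le> 32 * (23 / 4 * K) * (2 / 1000 * (a * K))"
    using K by (intro mult_left_mono) auto
  also have "\<dots> = 368 / 1000 * A"
    by (simp add: a(2) power2_eq_square)
  finally show False
    using le A by linarith
qed

section \<open>The improved bound for Rayleigh quotients\<close>

lemma simply_connected_Rayleigh_lower_bound:
  fixes \<Omega> :: "(real ^ 2) set"
  assumes \<Omega>: "open \<Omega>" "simply_connected \<Omega>" "0 < dirichlet_bottom \<Omega>"
    and b: "0 < b" "\<And>m. AE x in lebesgue_on (\<Omega> \<inter> ball 0 (real m)). torsion_bounded (\<Omega> \<inter> ball 0 (real m)) x \<le> b"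
    and u: "u \<in> test_functions \<Omega>"
  shows "(1 + 1 / 10 ^ 8) / b * (L2_seminorm lborel u)\<^sup>2 \<le> (L2_seminorm lborel (gradient u))\<^sup>2"
proof (rule ccontr)
  define A where "A = (LINT x|lborel. (u x)\<^sup>2)"
  define G where "G = (LINT x|lborel. (norm (gradient u x))\<^sup>2)"
  assume "\<not> ?thesis"
  then have GA: "G < (1 + 1 / 10 ^ 8) / b * A"
    by (simp add: A_def G_def L2_seminorm_power2)
  have "0 \<le> G" "0 \<le> A"
    by (simp_all add: A_def G_def integral_nonneg_AE)
  then have A: "0 < A"
    using GA by (cases "A = 0") auto
  define K where "K = sqrt b"
  have K: "0 < K" "K\<^sup>2 = b"
    using b by (simp_all add: K_def)
  note dom = torsion_domain_Int_ball[OF \<Omega>(1,3)]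
  note sol = torsion_domain.torsion_bounded_solves[OF dom]
  \<comment> \<open>\<open>23 / 4\<close> is a convenient number with square above
    \<open>32\<close>, the constant of \<open>inradius_bound\<close> in the plane.\<close>
  have inradius: "\<not> cball c (23 / 4 * K) \<subseteq> \<Omega>" for c
  proof
    assume sub: "cball c (23 / 4 * K) \<subseteq> \<Omega>"
    obtain m :: nat where m: "norm c + 23 / 4 * K < real m"
      using reals_Archimedean2 by blast
    have "cball c (23 / 4 * K) \<subseteq> \<Omega> \<inter> ball 0 (real m)"
    proof
      fix x assume x: "x \<in> cball c (23 / 4 * K)"
      have "norm x \<le> norm c + norm (c - x)"
        using norm_triangle_ineq4[of c "c - x"] by simp
      then show "x \<in> \<Omega> \<inter> ball 0 (real m)"
        using x sub m by (auto simp: dist_norm)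
    qed
    from torsion_domain.inradius_bound[OF dom sol b(2) _ this] have "(23 / 4 * K)\<^sup>2 \<le> 32 * b"
      using b(1) K(1) by simp
    then show False
      using b(1) K(2) by (simp add: power_mult_distrib power_divide)
  qed
  \<comment> \<open>The compact support of \<open>u\<close> fits into a ball, so the torsion
    function of one bounded piece is enough.\<close>
  obtain m :: nat where um: "u \<in> test_functions (\<Omega> \<inter> ball 0 (real m))"
  proof -
    obtain C where C: "compact C" "C \<subseteq> \<Omega>" "\<And>x. x \<notin> C \<Longrightarrow> u x = 0"
      using test_functions_supportE[OF u] by metis
    obtain r where r: "\<And>x. x \<in> C \<Longrightarrow> norm x \<le> r"
      using compact_imp_bounded[OF C(1)] unfolding bounded_iff by auto
    obtain m :: nat where m: "r < real m"
      using reals_Archimedean2 by blast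
    have "C \<subseteq> \<Omega> \<inter> ball 0 (real m)"
      using C(2) r m by fastforce
    then show ?thesis
      using that test_functionsI[OF test_functions_smooth[OF u] C(1) _ C(3)] by blast
  qed
  \<comment> \<open>Makes \<open>b + 2 * \<eta>\<close> equal to
    \<open>b * (1 + 1 / 10 ^ 8)\<close>, a perturbation of the size of the assumed excess.\<close>
  define \<eta> where "\<eta> = b / (2 * 10 ^ 8)"
  have \<eta>: "0 < \<eta>"
    using b(1) by (simp add: \<eta>_def)
  have \<epsilon>: "0 < A / (10 ^ 8 * b)"
    using A b(1) by simp
  obtain F where F: "is_smooth F" "\<And>x. 0 < F x" "\<And>x. F x \<le> b + 2 * \<eta>"
    "\<bar>(LINT x|lborel. gradient F x \<bullet> gradient (\<lambda>x. u x * u x * inverse (F x)) x) -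
      (LINT x|lborel. u x * u x * inverse (F x))\<bar> < A / (10 ^ 8 * b)"
    using torsion_domain.approximate_supersolution[OF dom sol b(2,1) um \<eta> \<epsilon>] by blast
  define B where "B = b + 2 * \<eta>"
  define L where "L = sqrt B"
  have B: "0 < B" "b \<le> B" "B = b * (1 + 1 / 10 ^ 8)"
    using b(1) \<eta> by (simp_all add: B_def \<eta>_def algebra_simps)
  have L: "0 < L" "L\<^sup>2 = B"
    using B by (simp_all add: L_def)
  have KL: "K \<le> L"
    using B by (simp add: K_def L_def)
  have LK: "L \<le> 1001 / 1000 * K"
  proof (rule power2_le_imp_le)
    show "L\<^sup>2 \<le> (1001 / 1000 * K)\<^sup>2"
      unfolding L(2) power_mult_distrib K(2) B(3) using b(1) by (simp add: power2_eq_square field_simps)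
  qed (use K in simp)
  \<comment> \<open>\<open>\<tau> = 10^-4\<close> balances the excess, of order \<open>10^-8\<close>
    and multiplied by \<open>1 / \<tau>\<close>, against the terms of order
    \<open>\<tau>\<close>.\<close>
  note core = core_energy[OF u F(1,2) F(3)[folded B_def] L, of "1 / 10 ^ 4"]
  let ?p = "\<lambda>x. u x * u x * (3 - 2 / B * F x)"
  have p: "?p \<in> test_functions \<Omega>"
    using core(3) by simp
  have "A \<le> (LINT x|lborel. \<bar>?p x\<bar>)"
    using core(4) by (simp add: A_def)
  also have "\<dots> \<le> 32 * (23 / 4 * K) * (LINT x|lborel. norm (gradient ?p x))"
    by (rule Cheeger_simply_connected[OF \<Omega>(1,2) p _ inradius]) (use K in simp)
  finally have le: "A \<le> 32 * (23 / 4 * K) * (LINT x|lborel. norm (gradient ?p x))" .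
  show False
  proof (rule core_numeric[OF A K KL LK L(2) _ _ _ _ le])
    show "B \<le> b * (1 + 1 / 10 ^ 8)"
      using B by simp
    show "G \<le> (1 + 1 / 10 ^ 8) * A / b"
      using GA by simp
    show "\<bar>(LINT x|lborel. gradient F x \<bullet> gradient (\<lambda>x. u x * u x * inverse (F x)) x) -
      (LINT x|lborel. u x * u x * inverse (F x))\<bar> \<le> A / (10 ^ 8 * b)"
      using F(4) by simp
    show "(LINT x|lborel. norm (gradient ?p x)) \<le> 3 * L * (10 ^ 4 + 2 / 10 ^ 4) *
      (G - ((LINT x|lborel. gradient F x \<bullet> gradient (\<lambda>x. u x * u x * inverse (F x)) x) -
      (LINT x|lborel. u x * u x * inverse (F x))) - A / B) + (3 / 10 ^ 4 / L) * A + (6 / 10 ^ 4 * L) * G"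
      using core(1) unfolding A_def G_def by simp
  qed
qed

lemma theorem1_constant_less: "3 ^ 5 * (67 - 44 * sqrt 2) / (2 ^ 34 * 5 * 7 * j0) * c1 < 1 / 10 ^ 8"
proof -
  \<comment> \<open>The upper bound makes \<open>67 - 44 * sqrt 2\<close> positive, the lower one
    bounds it by \<open>27 / 5\<close>.\<close>
  have s: "14 / 10 \<le> sqrt 2" "sqrt 2 \<le> 3 / 2"
    by (rule real_le_rsqrt real_le_lsqrt; simp add: power2_eq_square)+
  have "3 ^ 5 * (67 - 44 * sqrt 2) / (2 ^ 34 * 5 * 7 * j0) * c1 \<le> 3 ^ 5 * (67 - 44 * sqrt 2) / (2 ^ 34 * 5 * 7 * j0) * 1"
    using s j0_ge_1 by (intro mult_left_mono c1_le_1 divide_nonneg_nonneg) auto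
  also have "\<dots> \<le> 3 ^ 5 * (67 - 44 * (14 / 10)) / (2 ^ 34 * 5 * 7 * 1)"
    unfolding mult_1_right using s j0_ge_1 by (intro frac_le mult_left_mono) auto
  also have "\<dots> < 1 / 10 ^ 8"
    by simp
  finally show ?thesis .
qed

theorem theorem1:
  fixes \<Omega> :: "(real ^ 2) set"
  assumes "\<Omega> \<noteq> {}" and "open \<Omega>" and "simply_connected \<Omega>"
    and "dirichlet_bottom \<Omega> > 0"
  shows "Linf_norm \<Omega> (torsion_function \<Omega>) * ennreal (dirichlet_bottom \<Omega>)
           > ennreal (1 + 3 ^ 5 * (67 - 44 * sqrt 2) / (2 ^ 34 * 5 * 7 * j0) * c1)"
proof (cases "Linf_norm \<Omega> (torsion_function \<Omega>) = top")
  case True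
  then show ?thesis
    using assms(4) by (simp add: ennreal_top_mult less_top[symmetric])
next
  case False
  define b where "b = enn2real (Linf_norm \<Omega> (torsion_function \<Omega>))"
  have N: "Linf_norm \<Omega> (torsion_function \<Omega>) = ennreal b" and b0: "0 \<le> b"
    using False by (simp_all add: b_def less_top)
  have bound: "AE x in lebesgue_on (\<Omega> \<inter> ball 0 (real m)). torsion_bounded (\<Omega> \<inter> ball 0 (real m)) x \<le> b" for m
    by (rule torsion_bounded_le_Linf_norm[OF assms(2,4) _ b0]) (simp add: N)
  \<comment> \<open>Any ball inside \<open>\<Omega>\<close> forces this through
    \<open>inradius_bound\<close>; it is needed before dividing by \<open>b\<close>.\<close>
  have "0 < b"
  proof -
    obtain c where "c \<in> \<Omega>"
      using assms(1) by blast
    then obtain r where r: "0 < r" "cball c r \<subseteq> \<Omega>"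
      using assms(2) open_contains_cball by blast
    obtain m :: nat where m: "norm c + r < real m"
      using reals_Archimedean2 by blast
    have sub: "cball c r \<subseteq> \<Omega> \<inter> ball 0 (real m)"
    proof
      fix x assume x: "x \<in> cball c r"
      have "norm x \<le> norm c + norm (c - x)"
        using norm_triangle_ineq4[of c "c - x"] by simp
      then show "x \<in> \<Omega> \<inter> ball 0 (real m)"
        using x r(2) m by (auto simp: dist_norm)
    qed
    note dom = torsion_domain_Int_ball[OF assms(2,4)]
    from torsion_domain.inradius_bound[OF dom torsion_domain.torsion_bounded_solves[OF dom] bound b0 sub r(1)]
    have "0 < real (DIM(real ^ 2) * 2 ^ (DIM(real ^ 2) + 2)) * b"
      using zero_less_power[OF r(1), of 2] by linarith
    then show ?thesis
      by (simp add: zero_less_mult_iff)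
  qed
  have "(1 + 1 / 10 ^ 8) / b \<le> dirichlet_bottom \<Omega>"
    by (rule dirichlet_bottom_ge[OF assms(2,1)])
      (use \<open>0 < b\<close> simply_connected_Rayleigh_lower_bound[OF assms(2-4) \<open>0 < b\<close> bound] in auto)
  then have "1 + 1 / 10 ^ 8 \<le> b * dirichlet_bottom \<Omega>"
    by (simp only: pos_divide_le_eq[OF \<open>0 < b\<close>] mult.commute[of b])
  then have "1 + 3 ^ 5 * (67 - 44 * sqrt 2) / (2 ^ 34 * 5 * 7 * j0) * c1 < b * dirichlet_bottom \<Omega>"
    using theorem1_constant_less by linarith
  then show ?thesis
    unfolding N using \<open>0 < b\<close> assms(4) by (simp add: ennreal_mult[symmetric] ennreal_lessI)
qed

end
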